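(* Let $t$ and $\Delta$ be integers with $3 \le t \le \Delta+1$. Let $G$ be a graph with $m$ edges and maximum degree at most $\Delta$, and write $m = q\binom{\Delta+1}{2} + b$ with integers $q \ge 0$ and $0 \le b < \binom{\Delta+1}{2}$. Then $k_t(G) \le k_t(qK_{\Delta+1} \cup L_b)$. Moreover, equality holds if and only if $G$ is isomorphic to $qK_{\Delta+1} \cup L$ for some $L \in \mathcal{L}_{t,\Delta}(b)$.
   Context: All graphs are finite and simple. Two graphs are considered equivalent if they are isomorphic after deleting all isolated vertices (equivalently, graphs are taken to have no isolated vertices). For a graph $H$, $k_t(H)$ denotes the number of cliques of order $t$ (copies of $K_t$) in $H$. $qK_{\Delta+1} \cup L$ denotes the disjoint union of $q$ copies of $K_{\Delta+1}$ and the graph $L$. Every non-negative integer $m$ can be written uniquely as $m = \binom{r}{2} + s$ with integers $0 \le s < r$. The colex graph $L_m$ (for $m=\binom{r}{2}+s$, $0\le s<r$) is the graph consisting of a clique on $r$ vertices together with one additional vertex adjacent to exactly $s$ vertices of the clique (equivalently, the graph on $\mathbb{N}$ whose edges are the first $m$ two-element subsets of $\mathbb{N}$ in colex order, where $A<B$ iff $\max(A \triangle B)\in B$); $L_0$ is the empty graph. For $m=0$, $\mathcal{L}_{t,\Delta}(0)$ consists of the empty graph. For $0 < m \le \binom{\Delta+1}{2}$ with $m = \binom{r}{2}+s$, $0 \le s < r$, the family $\mathcal{L}_{t,\Delta}(m)$ is: if $s \ge t-1$, just $\{L_m\}$; if $r \ge t$ and $s < t-1$, $L_m$ together with all $m$-edge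 graphs of maximum degree at most $\Delta$ containing $K_r$ as a subgraph; if $r < t$, $L_m$ together with all $m$-edge graphs of maximum degree at most $\Delta$. *)

theory Defs
  imports "HOL-Library.Ramsey"
begin

datatype 'a graph = Graph (verts: "'a set") (edges: "'a set set")

definition simple_graph :: "'a graph \<Rightarrow> bool" where
  "simple_graph G \<longleftrightarrow> finite (verts G) \<and> edges G \<subseteq> [verts G]\<^bsup>2\<^esup>"

definition num_edges :: "'a graph \<Rightarrow> nat" where
  "num_edges G = card (edges G)"

definition degree :: "'a graph \<Rightarrow> 'a \<Rightarrow> nat" where
  "degree G v = card {u \<in> verts G. {u, v} \<in> edges G}"

text \<open>Inserting 0 fixes the maximum degree of the graph without vertices to be 0.\<close>

definition max_degree :: "'a graph \<Rightarrow> nat" where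
  "max_degree G = Max (insert 0 (degree G ` verts G))"

definition cliques :: "nat \<Rightarrow> 'a graph \<Rightarrow> 'a set set" where
  "cliques t G = {K \<in> [verts G]\<^bsup>t\<^esup>. clique K (edges G)}"

definition num_cliques :: "nat \<Rightarrow> 'a graph \<Rightarrow> nat" where
  "num_cliques t G = card (cliques t G)"

definition graph_iso :: "'a graph \<Rightarrow> 'b graph \<Rightarrow> bool" where
  "graph_iso G H \<longleftrightarrow>
    (\<exists>f. bij_betw f (verts G) (verts H) \<and>
         (\<forall>u \<in> verts G. \<forall>v \<in> verts G. {u, v} \<in> edges G \<longleftrightarrow> {f u, f v} \<in> edges H))"

definition delete_isolated :: "'a graph \<Rightarrow> 'a graph" where
  "delete_isolated G = Graph {v \<in> verts G. degree G v \<noteq> 0} (edges G)"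

text \<open>Throughout, graphs are identified when they are isomorphic up to isolated vertices.\<close>

definition graph_equiv :: "'a graph \<Rightarrow> 'b graph \<Rightarrow> bool" (infix \<open>\<simeq>\<close> 50) where
  "G \<simeq> H \<longleftrightarrow> graph_iso (delete_isolated G) (delete_isolated H)"

definition empty_graph :: "'a graph" where
  "empty_graph = Graph {} {}"

definition complete_graph :: "nat \<Rightarrow> nat graph" where
  "complete_graph n = Graph {..<n} ([{..<n}]\<^bsup>2\<^esup>)"

definition disjoint_union :: "'a graph \<Rightarrow> 'b graph \<Rightarrow> ('a + 'b) graph" where
  "disjoint_union G H =
    Graph (verts G <+> verts H) ((`) Inl ` edges G \<union> (`) Inr ` edges H)"

definition copies :: "nat \<Rightarrow> 'a graph \<Rightarrow> (nat \<times> 'a) graph" where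
  "copies q G = Graph ({..<q} \<times> verts G) (\<Union>i<q. (`) (Pair i) ` edges G)"

text \<open>The unique pair \<open>(r, s)\<close> with \<open>m = (r choose 2) + s\<close> and \<open>s < r\<close>;
  in particular it is \<open>(1, 0)\<close> for \<open>m = 0\<close>.\<close>

definition colex_decomp :: "nat \<Rightarrow> nat \<times> nat" where
  "colex_decomp m = (THE (r, s). m = (r choose 2) + s \<and> s < r)"

text \<open>The clique has vertices \<open>{..<r}\<close> and \<open>r\<close> is the additional vertex. That vertex is
  isolated if \<open>s = 0\<close>; so \<open>colex_graph 0\<close> is two isolated vertices, which is the
  empty graph up to \<open>\<simeq>\<close>.\<close>

definition colex_graph :: "nat \<Rightarrow> nat graph" where
  "colex_graph m =
    (case colex_decomp m of (r, s) \<Rightarrow> Graph {..r} ([{..<r}]\<^bsup>2\<^esup> \<union> (\<lambda>i. {i, r}) ` {..<s}))"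

text \<open>The extremal family is only meant for \<open>m \<le> (\<Delta> + 1) choose 2\<close>. Vertices are taken
  in \<^typ>\<open>nat\<close>, which covers all finite graphs up to isomorphism.\<close>

definition extremal_family :: "nat \<Rightarrow> nat \<Rightarrow> nat \<Rightarrow> nat graph set" where
  "extremal_family t \<Delta> m =
    (if m = 0 then {empty_graph}
     else case colex_decomp m of (r, s) \<Rightarrow>
       if s \<ge> t - 1 then {colex_graph m}
       else if r \<ge> t then
         insert (colex_graph m)
           {H. simple_graph H \<and> num_edges H = m \<and> max_degree H \<le> \<Delta> \<and> cliques r H \<noteq> {}}
       else
         insert (colex_graph m)
           {H. simple_graph H \<and> num_edges H = m \<and> max_degree H \<le> \<Delta>})"

lemma choose_2_add_less:
  fixes r s r' :: nat
  assumes "s < r" "r < r'"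
  shows "(r choose 2) + s < (r' choose 2)"
proof -
  have "Suc r choose 2 \<le> r' choose 2"
    using assms by (intro binomial_right_mono) auto
  moreover have "Suc r choose 2 = (r choose 2) + r"
    by (simp add: numeral_2_eq_2)
  ultimately show ?thesis
    using assms by linarith
qed

lemma colex_decomp_ex: "\<exists>r s. m = (r choose 2) + s \<and> s < (r::nat)"
proof (induction m)
  case 0
  show ?case by (intro exI[of _ 1] exI[of _ 0]) simp
next
  case (Suc m)
  then obtain r s where rs: "m = (r choose 2) + s" "s < r" by blast
  show ?case
  proof (cases "Suc s = r")
    case True
    then have "Suc m = (Suc r choose 2) + 0 \<and> 0 < Suc r"
      using rs by (simp add: numeral_2_eq_2)
    then show ?thesis by blast
  next
    case False
    then have "Suc m = (r choose 2) + Suc s \<and> Suc s < r"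
      using rs by simp
    then show ?thesis by blast
  qed
qed

lemma colex_decomp_eq:
  assumes "s < r"
  shows "colex_decomp ((r choose 2) + s) = (r, s)"
  unfolding colex_decomp_def
proof (rule the_equality, goal_cases)
  case 1
  then show ?case using assms by simp
next
  case (2 p)
  obtain r' s' where p: "p = (r', s')" by force
  with 2 have eq: "(r choose 2) + s = (r' choose 2) + s'" and less: "s' < r'"
    by auto
  have "\<not> r < r'" "\<not> r' < r"
    using choose_2_add_less[OF assms, of r'] choose_2_add_less[OF less, of r] eq by auto
  then show ?case using eq p by simp
qed

end

theory Submission
  imports Defs Complex_Main
begin

text \<open>
Write \<open>N\<close> for the number of edges of \<open>K\<^bsub>\<Delta>+1\<^esub>\<close>. A copy of \<open>K\<^bsub>\<Delta>+1\<^esub>\<close> is a component, so all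
copies can be split off; what remains to be shown is that a \<open>K\<^bsub>\<Delta>+1\<^esub>\<close>-free graph with \<open>m \<ge> N\<close>
edges stays strictly below the bound (for \<open>m < N\<close> the bound is the Kruskal-Katona theorem,
which follows by deleting a vertex of minimum degree).

Let \<open>m = qN + (r choose 2) + s\<close> in a minimal counterexample with \<open>n\<close> non-isolated vertices.
A cut with \<open>l\<close> edges is crossed by at most \<open>l choose (t - 1)\<close> cliques, so by minimality every
cut has at least \<open>r\<close> edges. If \<open>n \<le> q(\<Delta> + 1) + r\<close>, then Chase's bound in terms of the number of
vertices suffices. Otherwise apply the Kruskal-Katona theorem inside each neighbourhood and bound
the result by a chord of a convex function. Summing up, one needs an upper bound for the number
of edges inside neighbourhoods, i.e. many induced paths with three vertices; these are
provided by the at least \<open>r\<close> edges leaving each closed neighbourhood.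
\<close>

section \<open>Numerical preliminaries\<close>

text \<open>Characterising equality is what forces strict inequalities throughout: once every
  \<open>K_{D+1}\<close>-free graph with at least \<open>N\<close> edges lies strictly below the
  bound, an extremal graph keeps fewer than \<open>N\<close> edges after stripping, and its
  remainder is an equality case of Kruskal-Katona. The threshold \<open>r\<close> for cuts marks the
  range in which the bound pays for the loss: removing \<open>l < r\<close> edges leaves the
  quotient \<open>q\<close> alone and lowers the bound by at least \<open>l choose (t - 1)\<close>.
  The chord joins the points over \<open>(r - 1) choose 2\<close> and \<open>D choose 2\<close>
  because neighbourhoods in \<open>K_r\<close> and \<open>K_{D+1}\<close> contain exactly that many
  edges, so it is exact on \<open>q\<close> copies of \<open>K_{D+1}\<close> together with
  \<open>K_r\<close>. The resulting estimate decreases as the number \<open>n\<close> of vertices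
  grows and is used only from \<open>n = q (D + 1) + r + 1\<close> on; smaller \<open>n\<close>
  needs the estimate by vertices.\<close>

lemma choose_diff_mono:
  fixes w x d k :: nat
  assumes "w \<le> x"
  shows "(w + d choose k) + (x choose k) \<le> (x + d choose k) + (w choose k)"
proof (induction d)
  case (Suc d)
  show ?case
  proof (cases k)
    case (Suc j)
    have "(w + d choose j) \<le> (x + d choose j)"
      using assms by (intro binomial_right_mono) auto
    then show ?thesis using Suc.IH Suc by simp
  qed simp
qed simp

lemma choose_spread:
  fixes u w x y k :: nat
  assumes "x \<le> u" "y \<le> u" "x + y = u + w"
  shows "(x choose k) + (y choose k) \<le> (u choose k) + (w choose k)"
proof -
  have "w \<le> x" "w + (u - x) = y" "x + (u - x) = u" using assms by linarith+
  with choose_diff_mono[of w x "u - x" k] show ?thesis by simp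
qed

lemma choose_strict_right_mono:
  fixes a b k :: nat
  assumes "a < b" "1 \<le> k" "k \<le> b"
  shows "(a choose k) < (b choose k)"
proof -
  obtain c where c: "b = Suc c" using assms by (cases b) auto
  obtain j where j: "k = Suc j" using assms by (cases k) auto
  have "(a choose k) \<le> (c choose k)" using assms c by (intro binomial_right_mono) auto
  moreover have "0 < (c choose j)" using assms c j by simp
  moreover have "(b choose k) = (c choose j) + (c choose k)" by (simp add: c j)
  ultimately show ?thesis by linarith
qed

text \<open>Lowering \<open>u\<close> and \<open>y\<close> by one keeps the sum relation, so the
  weak form applies; the two Pascal terms split off differ strictly because \<open>k - 1\<close> is
  positive and at most \<open>u - 1\<close>.\<close>

lemma choose_spread_strict:
  fixes u w x y k :: nat
  assumes "x < u" "y < u" "x + y = u + w" "2 \<le> k" "k \<le> u"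
  shows "(x choose k) + (y choose k) < (u choose k) + (w choose k)"
proof -
  obtain v where v: "u = Suc v" using assms by (cases u) auto
  obtain j where j: "k = Suc j" using assms by (cases k) auto
  obtain z where z: "y = Suc z" using assms by (cases y) auto
  have "(x choose k) + (z choose k) \<le> (v choose k) + (w choose k)"
    using assms v z by (intro choose_spread) auto
  moreover have "(z choose j) < (v choose j)"
    using assms v j z by (intro choose_strict_right_mono) auto
  moreover have "(y choose k) = (z choose j) + (z choose k)" "(u choose k) = (v choose j) + (v choose k)"
    by (simp_all add: v j z)
  ultimately show ?thesis by linarith
qed

lemma choose_superadditive:
  fixes x y k :: nat
  assumes "1 \<le> k"
  shows "(x choose k) + (y choose k) \<le> (x + y choose k)"
  using choose_spread[of x "x + y" y 0 k] assms by (simp add: binomial_eq_0)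

section \<open>Clique numbers of colex graphs\<close>

lemma Suc_choose_two: "(Suc r choose 2) = (r choose 2) + r"
  by (simp add: numeral_2_eq_2)

lemma Suc_choose_eq: "1 \<le> k \<Longrightarrow> (Suc n choose k) = (n choose k) + (n choose (k - 1))"
  by (cases k) auto

text \<open>The number of \<open>k\<close>-cliques of the colex graph with \<open>m\<close> edges.\<close>

definition gam :: "nat \<Rightarrow> nat \<Rightarrow> nat" where
  "gam k m = (case colex_decomp m of (r, s) \<Rightarrow> (r choose k) + (s choose (k - 1)))"

lemma gam_eq_less: "s < r \<Longrightarrow> gam k ((r choose 2) + s) = (r choose k) + (s choose (k - 1))"
  by (simp add: gam_def colex_decomp_eq)

text \<open>Admitting \<open>s = r\<close> saves case distinctions later: a vertex joined to all of
  \<open>K_r\<close> completes \<open>K_(r+1)\<close>, and Pascal's rule makes both readings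
  agree.\<close>

lemma gam_eq:
  assumes "s \<le> r" "2 \<le> k"
  shows "gam k ((r choose 2) + s) = (r choose k) + (s choose (k - 1))"
proof (cases "s < r")
  case False
  then have "s = r" using assms by simp
  moreover have "gam k ((Suc r choose 2) + 0) = (Suc r choose k) + (0 choose (k - 1))"
    by (rule gam_eq_less) simp
  moreover have "(0 choose (k - 1) :: nat) = 0" using assms by (simp add: binomial_eq_0)
  ultimately show ?thesis using assms Suc_choose_eq[of k r] by (simp add: Suc_choose_two)
qed (simp add: gam_eq_less)

lemma gam_choose_two: "2 \<le> k \<Longrightarrow> gam k (r choose 2) = (r choose k)"
  using gam_eq[of 0 r k] by (simp add: binomial_eq_0)

lemma gam_0: "2 \<le> k \<Longrightarrow> gam k 0 = 0"
  using gam_choose_two[of k 0] by (simp add: binomial_eq_0)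

lemma gam_mono:
  assumes "2 \<le> k" "m \<le> n"
  shows "gam k m \<le> gam k n"
  using assms(2)
proof (induction rule: dec_induct)
  case (step n)
  obtain r s where n: "n = (r choose 2) + s" "s < r" using colex_decomp_ex by blast
  have "gam k n \<le> gam k (Suc n)"
    using gam_eq[of s r k] gam_eq[of "Suc s" r k] n assms(1)
      binomial_right_mono[of s "Suc s" "k - 1"] by simp
  with step.IH show ?case by linarith
qed simp

text \<open>Pays for the deletion of a vertex of degree \<open>d\<close>, or of a cut with
  \<open>d\<close> edges. If \<open>d\<close> fits into the last row of the colex graph,
  superadditivity suffices; otherwise rows of lengths \<open>d\<close> and
  \<open>r - 1 + s - d\<close> are traded for the more uneven \<open>r - 1\<close> and
  \<open>s\<close>.\<close>

lemma gam_step: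
  assumes "x + d = (r choose 2) + s" "s < r" "d < r" "2 \<le> k"
  shows "gam k x + (d choose (k - 1)) \<le> gam k ((r choose 2) + s)"
proof (cases "d \<le> s")
  case True
  then have x: "x = (r choose 2) + (s - d)" using assms by simp
  have "(s - d choose (k - 1)) + (d choose (k - 1)) \<le> (s choose (k - 1))"
    using choose_superadditive[of "k - 1" "s - d" d] True assms by simp
  then show ?thesis using gam_eq_less[of "s - d" r k] gam_eq_less[of s r k] assms x by simp
next
  case False
  obtain u where u: "r = Suc u" using assms by (cases r) auto
  have x: "x = (u choose 2) + (u + s - d)"
    using assms False by (simp add: u Suc_choose_two)
  have "(d choose (k - 1)) + (u + s - d choose (k - 1)) \<le> (u choose (k - 1)) + (s choose (k - 1))"
    using assms False u by (intro choose_spread) auto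
  moreover have "gam k x = (u choose k) + (u + s - d choose (k - 1))"
    unfolding x using False assms by (intro gam_eq) auto
  ultimately show ?thesis
    using gam_eq_less[of s r k] assms Suc_choose_eq[of k u] by (simp add: u)
qed

text \<open>Isolates the last row of the colex graph, along which \<open>gam\<close> grows by a
  single binomial. For \<open>s = 0\<close> that row is the full last row of \<open>K_r\<close>,
  with \<open>r - 1\<close> edges.\<close>

lemma gam_last:
  assumes "0 < b" "2 \<le> k"
  obtains d r where "0 < d" "d \<le> b" "d < r" "(r choose 2) \<le> b"
    "\<And>e. e \<le> d \<Longrightarrow> gam k (b - d + e) = gam k (b - d) + (e choose (k - 1))"
proof -
  obtain r s where b: "b = (r choose 2) + s" "s < r" using colex_decomp_ex by blast
  show ?thesis
  proof (cases "s = 0")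
    case False
    then show ?thesis using b assms gam_eq[of _ r k] gam_choose_two[of k r]
      by (intro that[of s r]) auto
  next
    case True
    obtain u where u: "r = Suc u" using b by (cases r) auto
    have "u \<noteq> 0" using b assms True u by (auto simp: binomial_eq_0)
    then show ?thesis using b True assms gam_eq[of _ u k] gam_choose_two[of k u]
      by (intro that[of u r]) (auto simp: u Suc_choose_two)
  qed
qed

lemma choose_2_block_le:
  fixes r r' s' n :: nat
  assumes "(r choose 2) \<le> n" "n = (r' choose 2) + s'" "s' < r'"
  shows "r \<le> r'"
  using choose_2_add_less[of s' r' r] assms by linarith

text \<open>The last row of the smaller colex graph is moved over to the larger one. Its length
  \<open>d\<close> is below \<open>r\<close>, hence below the clique size \<open>r2\<close> of
  \<open>a + d\<close>, so by \<open>gam_step\<close> the move loses nothing.\<close>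

lemma gam_superadditive_le:
  assumes "2 \<le> k" "b \<le> a"
  shows "gam k a + gam k b \<le> gam k (a + b)"
  using assms(2)
proof (induction b arbitrary: a rule: less_induct)
  case (less b)
  show ?case
  proof (cases "b = 0")
    case False
    then obtain d r where d: "0 < d" "d \<le> b" "d < r" "(r choose 2) \<le> b"
      "\<And>e. e \<le> d \<Longrightarrow> gam k (b - d + e) = gam k (b - d) + (e choose (k - 1))"
      using gam_last[of b k] assms by blast
    obtain r2 s2 where r2: "a + d = (r2 choose 2) + s2" "s2 < r2" using colex_decomp_ex by blast
    have "r \<le> r2" using choose_2_block_le[of r "a + d"] d less.prems r2 by simp
    then have "gam k a + (d choose (k - 1)) \<le> gam k (a + d)"
      using gam_step[of a d r2 s2 k] r2 d assms by simp
    moreover have "gam k b = gam k (b - d) + (d choose (k - 1))" using d(5)[of d] d(2) by simp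
    moreover have "gam k (a + d) + gam k (b - d) \<le> gam k (a + d + (b - d))"
      using d less.prems by (intro less.IH) auto
    ultimately show ?thesis using d(2) by simp
  qed (use assms in \<open>simp add: gam_0\<close>)
qed

lemma gam_superadditive: "2 \<le> k \<Longrightarrow> gam k a + gam k b \<le> gam k (a + b)"
  using gam_superadditive_le[of k a b] gam_superadditive_le[of k b a]
  by (cases "a \<le> b") (auto simp: add.commute)

text \<open>Rows are moved as for plain superadditivity until one of them would complete
  \<open>K_(D+1)\<close>. That last move is a proper exchange of rows, strict because
  \<open>k - 1\<close> is at least 2.\<close>

lemma gam_superadditive_wrap_le:
  assumes "3 \<le> k" "k \<le> D + 1" "b \<le> a" "a < (D + 1 choose 2)" "(D + 1 choose 2) \<le> a + b"
  shows "gam k a + gam k b < (D + 1 choose k) + gam k (a + b - (D + 1 choose 2))"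
  using assms(3-)
proof (induction b arbitrary: a rule: less_induct)
  case (less b)
  then have "0 < b" by linarith
  then obtain d r where d: "0 < d" "d \<le> b" "d < r" "(r choose 2) \<le> b"
    "\<And>e. e \<le> d \<Longrightarrow> gam k (b - d + e) = gam k (b - d) + (e choose (k - 1))"
    using gam_last[of b k] assms(1) by auto
  have gb: "gam k b = gam k (b - d) + (d choose (k - 1))" using d(5)[of d] d(2) by simp
  have N: "(D + 1 choose 2) = (D choose 2) + D" by (simp add: Suc_choose_two)
  have "r \<le> D" using less.prems d(4) binomial_right_mono[of "D + 1" r 2] by linarith
  show ?case
  proof (cases "a + d < (D + 1 choose 2)")
    case True
    obtain r2 s2 where r2: "a + d = (r2 choose 2) + s2" "s2 < r2" using colex_decomp_ex by blast
    have "r \<le> r2" using choose_2_block_le[of r "a + d"] d less.prems r2 by simp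
    then have "gam k a + (d choose (k - 1)) \<le> gam k (a + d)"
      using gam_step[of a d r2 s2 k] r2 d assms by simp
    moreover have "gam k (a + d) + gam k (b - d)
        < (D + 1 choose k) + gam k (a + d + (b - d) - (D + 1 choose 2))"
      using d less.prems True by (intro less.IH) auto
    ultimately show ?thesis using d(2) gb by simp
  next
    case False
    \<comment> \<open>Overflow: \<open>a\<close> already consists of \<open>K_D\<close> and
      \<open>s\<close> edges of the next row. Only \<open>D - s\<close> edges of the moved row are
      needed to complete \<open>K_(D+1)\<close>; the other \<open>e\<close> stay behind.\<close>
    define s where "s = a - (D choose 2)"
    have s: "a = (D choose 2) + s" "s < D" "D \<le> s + d"
      using False less.prems N d(3) \<open>r \<le> D\<close> unfolding s_def by linarith+
    define e where "e = s + d - D"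
    have e: "e < d" "s + d = D + e" using s unfolding e_def by linarith+
    have "(s choose (k - 1)) + (d choose (k - 1)) < (D choose (k - 1)) + (e choose (k - 1))"
      using s e d \<open>r \<le> D\<close> assms by (intro choose_spread_strict) auto
    moreover have "gam k a = (D choose k) + (s choose (k - 1))"
      using s assms gam_eq[of s D k] by simp
    moreover have "a + b - (D + 1 choose 2) = b - d + e"
      using s e d(2) N by linarith
    moreover have "(D + 1 choose k) = (D choose k) + (D choose (k - 1))"
      using assms Suc_choose_eq[of k D] by simp
    ultimately show ?thesis using gb d(5)[of e] e by simp
  qed
qed

lemma gam_superadditive_wrap:
  assumes "3 \<le> k" "k \<le> D + 1" "a < (D + 1 choose 2)" "b < (D + 1 choose 2)"
    "(D + 1 choose 2) \<le> a + b"
  shows "gam k a + gam k b < (D + 1 choose k) + gam k (a + b - (D + 1 choose 2))"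
  using gam_superadditive_wrap_le[of k D a b] gam_superadditive_wrap_le[of k D b a] assms
  by (cases "a \<le> b") (auto simp: add.commute)

text \<open>The number of \<open>k\<close>-cliques of \<open>qK\<^bsub>D+1\<^esub> \<union> L\<^sub>b\<close>, where \<open>m = q((D + 1) choose 2) + b\<close>.\<close>

definition gmax :: "nat \<Rightarrow> nat \<Rightarrow> nat \<Rightarrow> nat" where
  "gmax k D m = m div (D + 1 choose 2) * (D + 1 choose k) + gam k (m mod (D + 1 choose 2))"

lemma gmax_eq:
  assumes "b < (D + 1 choose 2)"
  shows "gmax k D (q * (D + 1 choose 2) + b) = q * (D + 1 choose k) + gam k b"
proof -
  have "(q * N + b) div N = q \<and> (q * N + b) mod N = b" if "b < N" for N
    using that by simp
  from this[OF assms] show ?thesis by (simp only: gmax_def)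
qed

lemma gmax_less: "m < (D + 1 choose 2) \<Longrightarrow> gmax k D m = gam k m"
  using gmax_eq[of m D k 0] by simp

text \<open>Only the residues interact. If their sum stays below the modulus, \<open>gam\<close> is
  superadditive; otherwise one more \<open>K_(D+1)\<close> appears and the gain is strict.\<close>

lemma gmax_superadditive:
  assumes "3 \<le> k" "k \<le> D + 1"
  shows "gmax k D a + gmax k D b \<le> gmax k D (a + b)"
    and "\<lbrakk>a < (D + 1 choose 2); b < (D + 1 choose 2); (D + 1 choose 2) \<le> a + b\<rbrakk>
      \<Longrightarrow> gmax k D a + gmax k D b < gmax k D (a + b)"
proof -
  let ?N = "D + 1 choose 2"
  have "0 < ?N" using assms by simp
  define a' b' where ab: "a' = a mod ?N" "b' = b mod ?N"
  have less: "a' < ?N" "b' < ?N" unfolding ab using \<open>0 < ?N\<close> by simp_all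
  have a: "a = a div ?N * ?N + a'" and b: "b = b div ?N * ?N + b'" unfolding ab by (simp_all only: div_mult_mod_eq)
  have g: "gmax k D a + gmax k D b = (a div ?N + b div ?N) * (D + 1 choose k) + (gam k a' + gam k b')"
    by (simp add: gmax_def ab algebra_simps)
  have small: "gmax k D (a + b) = (a div ?N + b div ?N) * (D + 1 choose k) + gam k (a' + b')"
    if "a' + b' < ?N"
  proof -
    have "a + b = (a div ?N + b div ?N) * ?N + (a' + b')"
      using a b by (simp add: distrib_right)
    then show ?thesis using gmax_eq[OF that, of k "a div ?N + b div ?N"] by simp
  qed
  have large: "gmax k D (a + b) = (a div ?N + b div ?N) * (D + 1 choose k)
      + ((D + 1 choose k) + gam k (a' + b' - ?N))" if "?N \<le> a' + b'"
  proof -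
    have "a + b = (a div ?N + b div ?N + 1) * ?N + (a' + b' - ?N)"
      using a b that by (simp add: distrib_right)
    moreover have "a' + b' - ?N < ?N" using less by linarith
    ultimately show ?thesis using gmax_eq[of "a' + b' - ?N" D k "a div ?N + b div ?N + 1"]
      by (simp add: algebra_simps)
  qed
  have wrap: "gam k a' + gam k b' < (D + 1 choose k) + gam k (a' + b' - ?N)" if "?N \<le> a' + b'"
    using gam_superadditive_wrap[of k D a' b'] assms less that by simp
  show "gmax k D a + gmax k D b \<le> gmax k D (a + b)"
  proof (cases "a' + b' < ?N")
    case True
    then show ?thesis unfolding g small[OF True]
      using gam_superadditive[of k a' b'] assms by simp
  next
    case False
    then show ?thesis using g large wrap by simp
  qed
  show "gmax k D a + gmax k D b < gmax k D (a + b)" if "a < ?N" "b < ?N" "?N \<le> a + b"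
  proof -
    have "a' = a" "b' = b" using that ab by simp_all
    then show ?thesis using g large wrap that by simp
  qed
qed

lemma gmax_mono:
  assumes "3 \<le> k" "k \<le> D + 1" "m \<le> n"
  shows "gmax k D m \<le> gmax k D n"
  using gmax_superadditive(1)[OF assms(1,2), of m "n - m"] assms(3) by simp

text \<open>Since \<open>r - 1\<close> is at most \<open>r choose 2\<close>, fewer than
  \<open>r\<close> edges never exhaust the residue; the quotient \<open>q\<close> survives and
  \<open>gam_step\<close> applies to the residue alone.\<close>

lemma gmax_step:
  assumes "3 \<le> k" "m = q * (D + 1 choose 2) + ((r choose 2) + s)" "s < r" "r \<le> D" "l < r"
  shows "l \<le> (r choose 2) + s" "gmax k D (m - l) + (l choose (k - 1)) \<le> gmax k D m"
proof -
  have "r - 1 \<le> (r choose 2)"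
    by (cases r) (auto simp: Suc_choose_two)
  then show l: "l \<le> (r choose 2) + s" using assms by linarith
  have less: "(r choose 2) + s < (D + 1 choose 2)"
    using choose_2_add_less[of s r "D + 1"] assms by simp
  have ml: "m - l = q * (D + 1 choose 2) + ((r choose 2) + s - l)" using assms l by simp
  have "gam k ((r choose 2) + s - l) + (l choose (k - 1)) \<le> gam k ((r choose 2) + s)"
    using assms l by (intro gam_step) auto
  moreover have "gmax k D m = q * (D + 1 choose k) + gam k ((r choose 2) + s)"
    unfolding assms(2) by (rule gmax_eq[OF less])
  moreover have "gmax k D (m - l) = q * (D + 1 choose k) + gam k ((r choose 2) + s - l)"
    unfolding ml by (rule gmax_eq) (use less in linarith)
  ultimately show "gmax k D (m - l) + (l choose (k - 1)) \<le> gmax k D m" by simp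
qed

section \<open>Convexity of clique counts as a function of the number of edges\<close>

lemma choose_ratio_mono:
  fixes j k p :: nat
  assumes "1 \<le> p" "j \<le> k"
  shows "k * (j choose p) \<le> j * (k choose p)"
proof (cases "j = 0")
  case True
  then show ?thesis using assms by (simp add: binomial_eq_0)
next
  case False
  then obtain j' k' p' where s: "j = Suc j'" "k = Suc k'" "p = Suc p'"
    using assms by (cases j; cases k; cases p) auto
  \<comment> \<open>Absorption: \<open>p (j choose p) = j ((j - 1) choose (p - 1))\<close>, so the
    quotient of \<open>j choose p\<close> by \<open>j\<close> is monotone in
    \<open>j\<close>.\<close>
  have "p * (k * (j choose p)) = k * (p * (j choose p))" by simp
  also have "p * (j choose p) = j * (j' choose p')" using Suc_times_binomial_eq[of j' p'] s by simp
  also have "k * (j * (j' choose p')) \<le> k * (j * (k' choose p'))"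
    using assms s by (intro mult_le_mono binomial_right_mono) auto
  also have "\<dots> = j * (k * (k' choose p'))" by simp
  also have "k * (k' choose p') = p * (k choose p)" using Suc_times_binomial_eq[of k' p'] s by simp
  also have "j * (p * (k choose p)) = p * (j * (k choose p))" by simp
  finally show ?thesis using assms by simp
qed

text \<open>With respect to \<open>k choose 2\<close>, the sequence \<open>k choose p\<close> is convex; its slope
  between \<open>k\<close> and \<open>k + 1\<close> is \<open>(k choose (p - 1)) / k\<close>.\<close>

lemma choose_slope_le:
  assumes "2 \<le> p" "i \<le> k"
  shows "real k * (real (k choose p) - real (i choose p))
    \<le> real (k choose (p - 1)) * (real (k choose 2) - real (i choose 2))"
proof -
  have "j \<le> k \<Longrightarrow> real k * (real (j choose p) - real (i choose p))
    \<le> real (k choose (p - 1)) * (real (j choose 2) - real (i choose 2))" if "i \<le> j" for j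
    using that
  proof (induction j rule: dec_induct)
    case (step j)
    have "real (k * (j choose (p - 1))) \<le> real (j * (k choose (p - 1)))"
      unfolding of_nat_le_iff using assms step.prems by (intro choose_ratio_mono) auto
    moreover have "(Suc j choose p) = (j choose p) + (j choose (p - 1))"
      using Suc_choose_eq assms by simp
    ultimately show ?case using step by (simp add: Suc_choose_two algebra_simps)
  qed simp
  then show ?thesis using assms by simp
qed

lemma choose_slope_ge:
  assumes "2 \<le> p" "k \<le> i"
  shows "real (k choose (p - 1)) * (real (i choose 2) - real (k choose 2))
    \<le> real k * (real (i choose p) - real (k choose p))"
  using assms(2)
proof (induction i rule: dec_induct)
  case (step j)
  have "real (j * (k choose (p - 1))) \<le> real (k * (j choose (p - 1)))"
    unfolding of_nat_le_iff using assms step.hyps by (intro choose_ratio_mono) auto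
  moreover have "(Suc j choose p) = (j choose p) + (j choose (p - 1))"
    using Suc_choose_eq assms by simp
  ultimately show ?case using step.IH by (simp add: Suc_choose_two algebra_simps)
qed simp

text \<open>Within a block \<open>gam\<close> stays below the segment joining the points over
  \<open>k choose 2\<close> and \<open>(k + 1) choose 2\<close>, and the polygon of these segments
  is convex, hence below its chords.\<close>

lemma gam_chord:
  assumes "2 \<le> p" "i \<le> j" "(i choose 2) \<le> y" "y \<le> (j choose 2)"
  shows "(real (gam p y) - real (i choose p)) * (real (j choose 2) - real (i choose 2))
    \<le> (real (j choose p) - real (i choose p)) * (real y - real (i choose 2))"
proof (cases "y = (j choose 2)")
  case True
  then show ?thesis using gam_choose_two assms by simp
next
  case False
  obtain k s where y: "y = (k choose 2) + s" "s < k" using colex_decomp_ex by blast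
  have k: "0 < k" "i \<le> k" "k < j"
    using y assms False choose_2_block_le[of i y k s] binomial_right_mono[of j k 2]
    by (auto simp: not_less[symmetric])
  \<comment> \<open>Slope of the segment over the block of \<open>y\<close>: \<open>k\<close>
    further edges bring \<open>k choose (p - 1)\<close> further cliques.\<close>
  define \<sigma> where "\<sigma> = real (k choose (p - 1)) / real k"
  have "real (k * (s choose (p - 1))) \<le> real (s * (k choose (p - 1)))"
    unfolding of_nat_le_iff using assms y by (intro choose_ratio_mono) auto
  then have s: "real (s choose (p - 1)) \<le> real s * \<sigma>"
    using k by (simp add: \<sigma>_def field_simps)
  have lo: "real (k choose p) - real (i choose p) \<le> \<sigma> * (real (k choose 2) - real (i choose 2))"
    using choose_slope_le[OF assms(1) k(2)] k by (simp add: \<sigma>_def field_simps)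
  have hi: "\<sigma> * (real (j choose 2) - real (k choose 2)) \<le> real (j choose p) - real (k choose p)"
    using choose_slope_ge[OF assms(1), of k j] k by (simp add: \<sigma>_def field_simps)
  have g: "real (gam p y) = real (k choose p) + real (s choose (p - 1))"
    using gam_eq_less[of s k p] y by simp
  \<comment> \<open>The mean slope left of \<open>y\<close> is at most \<open>\<sigma>\<close>, the
    one right of \<open>y\<close> at least \<open>\<sigma>\<close>; eliminating
    \<open>\<sigma>\<close> leaves the chord inequality.\<close>
  define a b u v where abuv: "a = real (gam p y) - real (i choose p)" "b = real (j choose p) - real (gam p y)"
    "u = real y - real (i choose 2)" "v = real (j choose 2) - real y"
  have "a \<le> \<sigma> * u" using lo s g y by (simp add: abuv algebra_simps)
  moreover have "\<sigma> * v \<le> b" using hi s g y by (simp add: abuv algebra_simps)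
  moreover have "0 \<le> u" "0 \<le> v" using assms by (simp_all add: abuv)
  ultimately have "a * v \<le> \<sigma> * u * v" "u * (\<sigma> * v) \<le> u * b"
    by (auto intro: mult_right_mono mult_left_mono)
  then have "a * (u + v) \<le> (a + b) * u" by (simp add: algebra_simps)
  then show ?thesis by (simp add: abuv)
qed

section \<open>Graphs as edge sets\<close>

text \<open>Isolated vertices do not matter to the theorem, so a graph is its set of edges: the
  vertex set is \<open>\<Union>E\<close>, and induced subgraphs are
  \<open>E \<inter> Pow W\<close>.\<close>

definition edge_set :: "'a set set \<Rightarrow> bool" where
  "edge_set E \<longleftrightarrow> finite E \<and> (\<forall>e\<in>E. card e = 2)"

definition nbhd :: "'a set set \<Rightarrow> 'a \<Rightarrow> 'a set" where
  "nbhd E v = {u. {u, v} \<in> E}"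

text \<open>No vertex set is mentioned: from \<open>t = 2\<close> on, cliques lie inside
  \<open>\<Union>E\<close> by themselves. For \<open>t = 1\<close> every singleton of the type
  qualifies, whence the recurring assumption \<open>2 \<le> t\<close>.\<close>

definition kcl :: "nat \<Rightarrow> 'a set set \<Rightarrow> 'a set set" where
  "kcl t E = {K. card K = t \<and> clique K E}"

lemma edge_set_finite: "edge_set E \<Longrightarrow> finite E"
  and edge_set_card: "edge_set E \<Longrightarrow> e \<in> E \<Longrightarrow> card e = 2"
  by (auto simp: edge_set_def)

lemma edge_set_subset: "edge_set E \<Longrightarrow> F \<subseteq> E \<Longrightarrow> edge_set F"
  by (auto simp: edge_set_def finite_subset)

lemma edge_setE:
  assumes "edge_set E" "e \<in> E"
  obtains u v where "e = {u, v}" "u \<noteq> v"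
  using edge_set_card[OF assms] by (metis card_2_iff)

lemma edge_set_finite_Union: "edge_set E \<Longrightarrow> finite (\<Union>E)"
  using edge_set_card[of E] edge_set_finite[of E]
  by (intro finite_Union) (auto intro!: card_ge_0_finite)

lemma edge_neq: "edge_set E \<Longrightarrow> {u, v} \<in> E \<Longrightarrow> u \<noteq> v"
  using edge_set_card[of E "{u, v}"] by auto

lemma nbhd_iff: "u \<in> nbhd E v \<longleftrightarrow> {u, v} \<in> E"
  by (simp add: nbhd_def)

lemma nbhd_sym: "u \<in> nbhd E v \<longleftrightarrow> v \<in> nbhd E u"
  by (simp add: nbhd_def insert_commute)

lemma nbhd_irrefl: "edge_set E \<Longrightarrow> v \<notin> nbhd E v"
  using edge_neq[of E v v] by (auto simp: nbhd_def)

lemma nbhd_subset: "nbhd E v \<subseteq> \<Union>E"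
  by (auto simp: nbhd_def)

lemma finite_nbhd: "edge_set E \<Longrightarrow> finite (nbhd E v)"
  using nbhd_subset edge_set_finite_Union finite_subset by metis

lemma nbhd_nonempty: "edge_set E \<Longrightarrow> v \<in> \<Union>E \<Longrightarrow> nbhd E v \<noteq> {}"
proof -
  assume E: "edge_set E" and "v \<in> \<Union>E"
  then obtain e where e: "e \<in> E" "v \<in> e" by auto
  obtain x y where "e = {x, y}" using edge_setE[OF E e(1)] by metis
  then show ?thesis using e by (auto simp: nbhd_def insert_commute)
qed

lemma nbhd_mono: "F \<subseteq> E \<Longrightarrow> nbhd F v \<subseteq> nbhd E v"
  by (auto simp: nbhd_def)

lemma nbhd_Int_Pow: "v \<in> W \<Longrightarrow> nbhd (E \<inter> Pow W) v = nbhd E v \<inter> W"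
  by (auto simp: nbhd_def)

lemma cliqueD: "clique K E \<Longrightarrow> u \<in> K \<Longrightarrow> v \<in> K \<Longrightarrow> u \<noteq> v \<Longrightarrow> {u, v} \<in> E"
  by (auto simp: clique_def)

lemma clique_subset: "clique K E \<Longrightarrow> L \<subseteq> K \<Longrightarrow> clique L E"
  by (auto simp: clique_def)

lemma clique_mono: "clique K F \<Longrightarrow> F \<subseteq> E \<Longrightarrow> clique K E"
  by (auto simp: clique_def)

lemma clique_insert:
  "clique (insert v K) E \<longleftrightarrow> clique K E \<and> (\<forall>u\<in>K. u \<noteq> v \<longrightarrow> {u, v} \<in> E)"
proof (intro iffI conjI ballI impI)
  assume *: "clique K E \<and> (\<forall>u\<in>K. u \<noteq> v \<longrightarrow> {u, v} \<in> E)"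
  have "{x, y} \<in> E" if "x \<in> insert v K" "y \<in> insert v K" "x \<noteq> y" for x y
  proof (cases "x = v")
    case True
    then have "y \<in> K" "y \<noteq> v" using that by auto
    then have "{y, v} \<in> E" using * by simp
    then show ?thesis using True by (simp add: insert_commute)
  next
    case False
    then show ?thesis using * that cliqueD[of K E x y] by blast
  qed
  then show "clique (insert v K) E" unfolding clique_def by blast
qed (auto simp: clique_def)

lemma kcl_finite_member: "K \<in> kcl t E \<Longrightarrow> 1 \<le> t \<Longrightarrow> finite K"
  by (intro card_ge_0_finite) (simp add: kcl_def)

lemma clique_subset_Union:
  assumes "clique K E" "2 \<le> card K"
  shows "K \<subseteq> \<Union>E"
proof
  fix x assume "x \<in> K"
  have "finite K" using assms(2) by (intro card_ge_0_finite) simp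
  then have "\<not> K \<subseteq> {x}" using assms(2) card_mono[of "{x}" K] by auto
  then obtain y where "y \<in> K" "y \<noteq> x" by auto
  then show "x \<in> \<Union>E" using cliqueD[OF assms(1) \<open>x \<in> K\<close>, of y] by auto
qed

lemma kcl_subset_Union: "K \<in> kcl t E \<Longrightarrow> 2 \<le> t \<Longrightarrow> K \<subseteq> \<Union>E"
  using clique_subset_Union by (auto simp: kcl_def)

lemma finite_kcl:
  assumes "edge_set E" "2 \<le> t"
  shows "finite (kcl t E)"
proof (rule finite_subset)
  show "kcl t E \<subseteq> Pow (\<Union>E)" using kcl_subset_Union assms by blast
  show "finite (Pow (\<Union>E))" using edge_set_finite_Union assms by simp
qed

lemma kcl_Int_Pow:
  assumes "2 \<le> t"
  shows "kcl t (E \<inter> Pow W) = {K \<in> kcl t E. K \<subseteq> W}"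
proof
  show "kcl t (E \<inter> Pow W) \<subseteq> {K \<in> kcl t E. K \<subseteq> W}"
  proof
    fix K assume K: "K \<in> kcl t (E \<inter> Pow W)"
    then have "K \<subseteq> W" using kcl_subset_Union[OF K assms] by auto
    then show "K \<in> {K \<in> kcl t E. K \<subseteq> W}" using K by (simp add: kcl_def clique_def)
  qed
  show "{K \<in> kcl t E. K \<subseteq> W} \<subseteq> kcl t (E \<inter> Pow W)"
    by (auto simp: kcl_def clique_def)
qed

lemma kcl_mono: "F \<subseteq> E \<Longrightarrow> kcl t F \<subseteq> kcl t E"
  by (auto simp: kcl_def clique_def)

lemma kcl_two: "edge_set E \<Longrightarrow> kcl 2 E = E"
proof
  assume E: "edge_set E"
  show "kcl 2 E \<subseteq> E"
    by (auto simp: kcl_def clique_def card_2_iff)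
  show "E \<subseteq> kcl 2 E"
  proof
    fix e assume e: "e \<in> E"
    then obtain x y where "e = {x, y}" "x \<noteq> y" using edge_setE[OF E e] by metis
    then show "e \<in> kcl 2 E" using e by (auto simp: kcl_def clique_def insert_commute)
  qed
qed

lemma kcl_empty: "2 \<le> t \<Longrightarrow> kcl t {} = {}"
proof -
  assume t: "2 \<le> t"
  have False if "K \<in> kcl t {}" for K
    using kcl_subset_Union[OF that t] that t by (simp add: kcl_def)
  then show ?thesis by blast
qed

lemma card_incident:
  assumes "edge_set E"
  shows "card {e \<in> E. v \<in> e} = card (nbhd E v)"
proof -
  have "{e \<in> E. v \<in> e} = (\<lambda>u. {u, v}) ` nbhd E v"
  proof (intro equalityI subsetI)
    fix e assume e: "e \<in> {e \<in> E. v \<in> e}"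
    then obtain x y where "e = {x, y}" using edge_setE[OF assms, of e] by blast
    then show "e \<in> (\<lambda>u. {u, v}) ` nbhd E v" using e by (auto simp: nbhd_def insert_commute)
  qed (auto simp: nbhd_def)
  moreover have "inj_on (\<lambda>u. {u, v}) (nbhd E v)"
    by (auto simp: inj_on_def doubleton_eq_iff)
  ultimately show ?thesis by (simp add: card_image)
qed

lemma sum_card_kcl:
  assumes "edge_set E" "2 \<le> t" "finite V" "\<Union>E \<subseteq> V"
  shows "(\<Sum>v\<in>V. card {K \<in> kcl t E. v \<in> K}) = t * card (kcl t E)"
proof (rule sum_multicount)
  show "\<forall>K\<in>kcl t E. card {v \<in> V. v \<in> K} = t"
  proof
    fix K assume K: "K \<in> kcl t E"
    then have "{v \<in> V. v \<in> K} = K" using kcl_subset_Union[OF K] assms by auto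
    then show "card {v \<in> V. v \<in> K} = t" using K by (simp add: kcl_def)
  qed
qed (use assms finite_kcl in auto)

lemma handshake:
  assumes "edge_set E" "finite V" "\<Union>E \<subseteq> V"
  shows "(\<Sum>v\<in>V. card (nbhd E v)) = 2 * card E"
  using sum_card_kcl[OF assms(1) _ assms(2,3), of 2] card_incident[OF assms(1)]
  by (simp add: kcl_two[OF assms(1)])

lemma star_subset:
  assumes "K \<in> kcl t E" "v \<in> K" "1 \<le> t"
  shows "K - {v} \<subseteq> nbhd E v" "card (K - {v}) = t - 1" "clique (K - {v}) E"
proof -
  have K: "card K = t" "clique K E" using assms by (auto simp: kcl_def)
  show "K - {v} \<subseteq> nbhd E v" using K(2) assms(2) by (auto simp: nbhd_def dest: cliqueD)
  show "card (K - {v}) = t - 1" using K(1) assms(2) by simp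
  show "clique (K - {v}) E" using K(2) by (rule clique_subset) auto
qed

lemma star_image:
  assumes "edge_set E" "1 \<le> t"
  shows "(\<lambda>K. K - {v}) ` {K \<in> kcl t E. v \<in> K}
      = {L. L \<subseteq> nbhd E v \<and> card L = t - 1 \<and> clique L E}" (is "?l = ?r")
proof
  show "?l \<subseteq> ?r"
  proof
    fix L assume "L \<in> ?l"
    then obtain K where "K \<in> kcl t E" "v \<in> K" "L = K - {v}" by auto
    then show "L \<in> ?r" using star_subset[of K t E v] assms(2) by simp
  qed
  show "?r \<subseteq> ?l"
  proof
    fix L assume L: "L \<in> ?r"
    then have "finite L" "v \<notin> L"
      using finite_subset finite_nbhd[OF assms(1), of v] nbhd_irrefl[OF assms(1), of v] by auto
    then have "insert v L \<in> {K \<in> kcl t E. v \<in> K}" "L = insert v L - {v}"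
      using L assms(2) by (auto simp: kcl_def clique_insert nbhd_def)
    then show "L \<in> ?l" by blast
  qed
qed

lemma card_star:
  assumes "edge_set E" "1 \<le> t"
  shows "card {K \<in> kcl t E. v \<in> K} = card {L. L \<subseteq> nbhd E v \<and> card L = t - 1 \<and> clique L E}"
proof -
  have "inj_on (\<lambda>K. K - {v}) {K \<in> kcl t E. v \<in> K}"
  proof (rule inj_onI)
    fix K L assume "K \<in> {K \<in> kcl t E. v \<in> K}" "L \<in> {K \<in> kcl t E. v \<in> K}" "K - {v} = L - {v}"
    then have "insert v (K - {v}) = insert v (L - {v})" "v \<in> K" "v \<in> L" by auto
    then show "K = L" by (simp add: insert_absorb)
  qed
  from card_image[OF this] show ?thesis unfolding star_image[OF assms] by simp
qed

lemma card_star_le: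
  assumes "edge_set E" "1 \<le> t"
  shows "card {K \<in> kcl t E. v \<in> K} \<le> (card (nbhd E v) choose (t - 1))"
proof -
  have "card {L. L \<subseteq> nbhd E v \<and> card L = t - 1 \<and> clique L E}
      \<le> card {L. L \<subseteq> nbhd E v \<and> card L = t - 1}"
    using finite_nbhd[OF assms(1), of v] by (intro card_mono) auto
  then show ?thesis using card_star[OF assms] n_subsets[OF finite_nbhd[OF assms(1)]] by simp
qed

text \<open>Equality makes every \<open>(t - 1)\<close>-subset of the neighbourhood a clique, and
  since \<open>t - 1\<close> is at least 2, each pair of neighbours lies in such a subset.\<close>

lemma card_star_eq_imp_clique:
  assumes "edge_set E" "3 \<le> t" "t - 1 \<le> card (nbhd E v)"
    "(card (nbhd E v) choose (t - 1)) \<le> card {K \<in> kcl t E. v \<in> K}"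
  shows "clique (insert v (nbhd E v)) E"
proof -
  let ?A = "{L. L \<subseteq> nbhd E v \<and> card L = t - 1 \<and> clique L E}"
  let ?B = "{L. L \<subseteq> nbhd E v \<and> card L = t - 1}"
  have fin: "finite (nbhd E v)" using finite_nbhd[OF assms(1)] .
  then have "finite ?B" by simp
  moreover have "?A \<subseteq> ?B" by auto
  moreover have "card ?A = card ?B"
    using card_star[OF assms(1), of t v] card_star_le[OF assms(1), of t v] n_subsets[OF fin, of "t - 1"]
      assms by simp
  ultimately have AB: "?A = ?B" by (rule card_subset_eq)
  have "{x, y} \<in> E" if xy: "x \<in> nbhd E v" "y \<in> nbhd E v" "x \<noteq> y" for x y
  proof -
    have "t - 1 - 2 \<le> card (nbhd E v - {x, y})" using fin xy assms by (simp add: card_Diff_subset)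
    then obtain M where M: "M \<subseteq> nbhd E v - {x, y}" "card M = t - 1 - 2" "finite M"
      by (rule obtain_subset_with_card_n)
    then have "card ({x, y} \<union> M) = 2 + (t - 1 - 2)"
      using xy by (subst card_Un_disjoint) auto
    then have "{x, y} \<union> M \<in> ?B" using M xy assms by auto
    then have "clique ({x, y} \<union> M) E" using AB by blast
    then show ?thesis using xy(3) by (auto simp: clique_def)
  qed
  then have "clique (nbhd E v) E" unfolding clique_def by blast
  then show ?thesis by (auto simp: clique_insert nbhd_def)
qed

lemma card_star_nbhd:
  assumes "edge_set E" "3 \<le> t"
  shows "card {K \<in> kcl t E. v \<in> K} = card (kcl (t - 1) (E \<inter> Pow (nbhd E v)))"
proof -
  have "{L. L \<subseteq> nbhd E v \<and> card L = t - 1 \<and> clique L E} = kcl (t - 1) (E \<inter> Pow (nbhd E v))"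
    using assms by (subst kcl_Int_Pow) (auto simp: kcl_def)
  then show ?thesis using card_star[OF assms(1), of t v] assms by simp
qed

section \<open>Edge cuts and the cliques crossing them\<close>

definition cut :: "'a set set \<Rightarrow> 'a set \<Rightarrow> 'a set set" where
  "cut E S = {e \<in> E. e \<inter> S \<noteq> {} \<and> e - S \<noteq> {}}"

lemma card_edges_split:
  assumes "edge_set E"
  shows "card E = card (E \<inter> Pow S) + card (E \<inter> Pow (- S)) + card (cut E S)"
proof -
  have fin: "finite E" using assms by (rule edge_set_finite)
  have "{} \<notin> E" using edge_set_card[OF assms] by force
  then have "(E \<inter> Pow S) \<inter> (E \<inter> Pow (- S)) = {}"
  proof -
    have "e = {}" if "e \<subseteq> S" "e \<subseteq> - S" for e using that by blast
    with \<open>{} \<notin> E\<close> show ?thesis by blast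
  qed
  moreover have "((E \<inter> Pow S) \<union> (E \<inter> Pow (- S))) \<inter> cut E S = {}" by (auto simp: cut_def)
  moreover have "E = ((E \<inter> Pow S) \<union> (E \<inter> Pow (- S))) \<union> cut E S" by (auto simp: cut_def)
  ultimately show ?thesis using fin card_Un_disjoint[of "E \<inter> Pow S" "E \<inter> Pow (- S)"]
      card_Un_disjoint[of "(E \<inter> Pow S) \<union> (E \<inter> Pow (- S))" "cut E S"]
    by (simp add: cut_def)
qed

lemma doubleton_cut_eq:
  "\<lbrakk>{a, b} = {c, d}; a \<in> S; c \<in> S; b \<notin> S; d \<notin> S\<rbrakk> \<Longrightarrow> a = c \<and> b = d"
  by (auto simp: doubleton_eq_iff)

text \<open>A clique that meets both sides of a cut is determined by the edges of a spanning
  double star of its part of the cut.\<close>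

lemma card_crossing_le:
  assumes "edge_set E" "2 \<le> t"
  shows "card {K \<in> kcl t E. K \<inter> S \<noteq> {} \<and> K - S \<noteq> {}} \<le> (card (cut E S) choose (t - 1))"
proof -
  let ?X = "{K \<in> kcl t E. K \<inter> S \<noteq> {} \<and> K - S \<noteq> {}}"
  define a where "a K = (SOME x. x \<in> K \<inter> S)" for K
  define b where "b K = (SOME x. x \<in> K - S)" for K
  \<comment> \<open>Two stars: from \<open>a K\<close> to the part outside \<open>S\<close>, and
    from \<open>b K\<close> to the part inside. They share just the edge \<open>{a K, b K}\<close>,
    so together they have \<open>t - 1\<close> edges.\<close>
  define f where "f K = (\<lambda>y. {a K, y}) ` (K - S) \<union> (\<lambda>x. {x, b K}) ` (K \<inter> S)" for K
  have ab: "a K \<in> K \<inter> S" "b K \<in> K - S" if K: "K \<in> ?X" for K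
  proof -
    obtain x y where "x \<in> K \<inter> S" "y \<in> K - S" using K by auto
    from someI[of "\<lambda>x. x \<in> K \<inter> S", OF this(1)] someI[of "\<lambda>x. x \<in> K - S", OF this(2)]
    show "a K \<in> K \<inter> S" "b K \<in> K - S" unfolding a_def b_def .
  qed
  have Un: "\<Union>(f K) = K" if "K \<in> ?X" for K
  proof -
    have "\<Union>((\<lambda>y. {a K, y}) ` (K - S)) = insert (a K) (K - S)"
      "\<Union>((\<lambda>x. {x, b K}) ` (K \<inter> S)) = insert (b K) (K \<inter> S)"
      using ab[OF that] by auto
    then have "\<Union>(f K) = insert (a K) (K - S) \<union> insert (b K) (K \<inter> S)"
      unfolding f_def Union_Un_distrib by simp
    then show ?thesis using ab[OF that] by auto
  qed
  have f: "f K \<in> {F. F \<subseteq> cut E S \<and> card F = t - 1}" if K: "K \<in> ?X" for K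
  proof -
    have fin: "finite K" using K assms kcl_finite_member[of K t E] by auto
    have "clique K E" using K by (simp add: kcl_def)
    have in_cut: "{x, y} \<in> cut E S" if "x \<in> K \<inter> S" "y \<in> K - S" for x y
      using cliqueD[OF \<open>clique K E\<close>, of x y] that by (auto simp: cut_def)
    have "f K \<subseteq> cut E S"
    proof
      fix e assume "e \<in> f K"
      then consider y where "y \<in> K - S" "e = {a K, y}" | x where "x \<in> K \<inter> S" "e = {x, b K}"
        unfolding f_def by auto
      then show "e \<in> cut E S" using in_cut ab[OF K] by cases simp_all
    qed
    moreover have "card (f K) = t - 1"
    proof -
      have i1: "inj_on (\<lambda>y. {a K, y}) (K - S)"
        by (rule inj_onI) (auto simp: doubleton_eq_iff)
      have i2: "inj_on (\<lambda>x. {x, b K}) (K \<inter> S)"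
        by (rule inj_onI) (auto simp: doubleton_eq_iff)
      have "(\<lambda>y. {a K, y}) ` (K - S) \<inter> (\<lambda>x. {x, b K}) ` (K \<inter> S) = {{a K, b K}}"
      proof (intro equalityI subsetI)
        fix e assume "e \<in> (\<lambda>y. {a K, y}) ` (K - S) \<inter> (\<lambda>x. {x, b K}) ` (K \<inter> S)"
        then obtain x y where e: "e = {a K, y}" "e = {x, b K}" and "y \<in> K - S" "x \<in> K \<inter> S" by blast
        moreover have "{a K, y} = {x, b K}" by (rule trans[OF e(1)[symmetric] e(2)])
        ultimately have "y = b K" using doubleton_cut_eq[of "a K" y x "b K" S] ab[OF K] by blast
        then show "e \<in> {{a K, b K}}" using e(1) by simp
      next
        fix e assume "e \<in> {{a K, b K}}"
        then have e: "e = {a K, b K}" by (rule singletonD)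
        have "e \<in> (\<lambda>y. {a K, y}) ` (K - S)" unfolding e using ab[OF K] by simp
        moreover have "e \<in> (\<lambda>x. {x, b K}) ` (K \<inter> S)" unfolding e using ab[OF K] by simp
        ultimately show "e \<in> (\<lambda>y. {a K, y}) ` (K - S) \<inter> (\<lambda>x. {x, b K}) ` (K \<inter> S)"
          by (rule IntI)
      qed
      moreover have "card (K - S) + card (K \<inter> S) = t"
        using K card_Int_Diff[OF fin, of S] by (simp add: kcl_def)
      ultimately show ?thesis
        using card_Un_Int[of "(\<lambda>y. {a K, y}) ` (K - S)" "(\<lambda>x. {x, b K}) ` (K \<inter> S)"] fin i1 i2
        by (simp add: f_def card_image)
    qed
    ultimately show ?thesis by simp
  qed
  have cutfin: "finite (cut E S)" using edge_set_finite[OF assms(1)] by (auto simp: cut_def)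
  have "inj_on f ?X"
  proof (rule inj_onI)
    fix K L assume K: "K \<in> ?X" and L: "L \<in> ?X" and eq: "f K = f L"
    have "K = \<Union>(f K)" by (rule Un[OF K, symmetric])
    also have "\<dots> = L" unfolding eq by (rule Un[OF L])
    finally show "K = L" .
  qed
  moreover have "f ` ?X \<subseteq> {F. F \<subseteq> cut E S \<and> card F = t - 1}" by (rule image_subsetI) (rule f)
  moreover have "finite {F. F \<subseteq> cut E S \<and> card F = t - 1}" using cutfin by simp
  ultimately have "card ?X \<le> card {F. F \<subseteq> cut E S \<and> card F = t - 1}"
    by (rule card_inj_on_le)
  then show ?thesis using n_subsets[OF cutfin] by simp
qed

lemma card_kcl_cut_le:
  assumes "edge_set E" "2 \<le> t"
  shows "card (kcl t E) \<le> card (kcl t (E \<inter> Pow S)) + card (kcl t (E \<inter> Pow (- S)))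
    + (card (cut E S) choose (t - 1))"
proof -
  have "kcl t E \<subseteq> (kcl t (E \<inter> Pow S) \<union> kcl t (E \<inter> Pow (- S)))
      \<union> {K \<in> kcl t E. K \<inter> S \<noteq> {} \<and> K - S \<noteq> {}}"
    unfolding kcl_Int_Pow[OF assms(2)] by auto
  moreover have "finite ((kcl t (E \<inter> Pow S) \<union> kcl t (E \<inter> Pow (- S)))
      \<union> {K \<in> kcl t E. K \<inter> S \<noteq> {} \<and> K - S \<noteq> {}})"
    unfolding kcl_Int_Pow[OF assms(2)] using finite_kcl[OF assms] by auto
  ultimately have "card (kcl t E) \<le> card (kcl t (E \<inter> Pow S) \<union> kcl t (E \<inter> Pow (- S)))
      + card {K \<in> kcl t E. K \<inter> S \<noteq> {} \<and> K - S \<noteq> {}}"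
    by (meson card_mono card_Un_le order_trans)
  then show ?thesis
    using card_Un_le[of "kcl t (E \<inter> Pow S)" "kcl t (E \<inter> Pow (- S))"] card_crossing_le[OF assms, of S]
    by linarith
qed

lemma card_edges_remove:
  assumes "edge_set E"
  shows "card E = card (E \<inter> Pow (- {v})) + card (nbhd E v)"
proof -
  have "(E \<inter> Pow (- {v})) \<union> {e \<in> E. v \<in> e} = E" by auto
  moreover have "(E \<inter> Pow (- {v})) \<inter> {e \<in> E. v \<in> e} = {}" by auto
  ultimately show ?thesis using card_incident[OF assms, of v] edge_set_finite[OF assms]
      card_Un_disjoint[of "E \<inter> Pow (- {v})" "{e \<in> E. v \<in> e}"] by simp
qed

lemma card_kcl_remove:
  assumes "edge_set E" "2 \<le> t"
  shows "card (kcl t E) = card (kcl t (E \<inter> Pow (- {v}))) + card {K \<in> kcl t E. v \<in> K}"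
proof -
  have "kcl t (E \<inter> Pow (- {v})) \<union> {K \<in> kcl t E. v \<in> K} = kcl t E"
    "kcl t (E \<inter> Pow (- {v})) \<inter> {K \<in> kcl t E. v \<in> K} = {}"
    unfolding kcl_Int_Pow[OF assms(2)] by auto
  moreover have "finite (kcl t (E \<inter> Pow (- {v})))" "finite {K \<in> kcl t E. v \<in> K}"
    unfolding kcl_Int_Pow[OF assms(2)] using finite_kcl[OF assms] by auto
  ultimately show ?thesis
    using card_Un_disjoint[of "kcl t (E \<inter> Pow (- {v}))" "{K \<in> kcl t E. v \<in> K}"] by simp
qed

section \<open>The Kruskal-Katona theorem for graphs\<close>

lemma two_times_choose_two: "2 * (r choose 2) = r * (r - 1)"
  using times_binomial_minus1_eq[of 2 r] by simp

text \<open>If all degrees were at least \<open>r\<close>, there would be at least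
  \<open>r + 1\<close> vertices and hence \<open>(r + 1) choose 2\<close> edges, more than
  \<open>s < r\<close> allows.\<close>

lemma obtain_min_degree:
  assumes "edge_set E" "card E = (r choose 2) + s" "s < r" "E \<noteq> {}"
  obtains v where "v \<in> \<Union>E" "0 < card (nbhd E v)" "card (nbhd E v) < r"
    "\<And>u. u \<in> \<Union>E \<Longrightarrow> card (nbhd E v) \<le> card (nbhd E u)"
proof -
  have fin: "finite (\<Union>E)" using edge_set_finite_Union[OF assms(1)] .
  have ne: "\<Union>E \<noteq> {}" using assms(4) edge_set_card[OF assms(1)] by fastforce
  define v where "v = arg_min_on (\<lambda>u. card (nbhd E u)) (\<Union>E)"
  have v: "v \<in> \<Union>E" "\<And>u. u \<in> \<Union>E \<Longrightarrow> card (nbhd E v) \<le> card (nbhd E u)"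
    using arg_min_if_finite[OF fin ne, of "\<lambda>u. card (nbhd E u)"]
    unfolding v_def by (auto simp: not_less[symmetric])
  have pos: "0 < card (nbhd E v)"
    using nbhd_nonempty[OF assms(1) v(1)] finite_nbhd[OF assms(1)] by (simp add: card_gt_0_iff)
  have "card (nbhd E v) < r"
  proof (rule ccontr)
    assume "\<not> card (nbhd E v) < r"
    then have ge: "r \<le> card (nbhd E v)" by simp
    have "insert v (nbhd E v) \<subseteq> \<Union>E" using v(1) nbhd_subset[of E v] by simp
    then have "card (insert v (nbhd E v)) \<le> card (\<Union>E)" by (rule card_mono[OF fin])
    then have n: "Suc r \<le> card (\<Union>E)"
      using ge nbhd_irrefl[OF assms(1), of v] finite_nbhd[OF assms(1), of v] by simp
    have "Suc r * r \<le> card (\<Union>E) * r" by (rule mult_le_mono1[OF n])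
    also have "\<dots> \<le> (\<Sum>u\<in>\<Union>E. card (nbhd E u))"
      using sum_bounded_below[of "\<Union>E" r "\<lambda>u. card (nbhd E u)"] v(2) ge by fastforce
    also have "\<dots> = 2 * (r choose 2) + 2 * s"
      using handshake[OF assms(1) fin] assms(2) by simp
    also have "2 * (r choose 2) = r * (r - 1)" by (rule two_times_choose_two)
    finally show False using assms(3) by (cases r) auto
  qed
  then show ?thesis using that v pos by blast
qed

text \<open>A vertex of degree \<open>d\<close> lies in at most \<open>d choose (t - 1)\<close>
  cliques; minimality of \<open>d\<close> yields \<open>d < r\<close>, the condition under which
  \<open>gam_step\<close> pays for them.\<close>

lemma kruskal_katona:
  assumes "edge_set E" "2 \<le> t"
  shows "card (kcl t E) \<le> gam t (card E)"
  using assms(1)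
proof (induction "card E" arbitrary: E rule: less_induct)
  case less
  show ?case
  proof (cases "E = {}")
    case False
    obtain r s where rs: "card E = (r choose 2) + s" "s < r" using colex_decomp_ex by blast
    obtain v where v: "0 < card (nbhd E v)" "card (nbhd E v) < r"
      using obtain_min_degree[OF less.prems rs False] by metis
    let ?F = "E \<inter> Pow (- {v})"
    have F: "edge_set ?F" using less.prems by (rule edge_set_subset) auto
    have m: "card E = card ?F + card (nbhd E v)" by (rule card_edges_remove[OF less.prems])
    have "card (kcl t E) = card (kcl t ?F) + card {K \<in> kcl t E. v \<in> K}"
      by (rule card_kcl_remove[OF less.prems assms(2)])
    also have "\<dots> \<le> gam t (card ?F) + (card (nbhd E v) choose (t - 1))"
      using less.hyps[OF _ F] m v card_star_le[OF less.prems, of t v] assms(2) by (intro add_mono) auto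
    also have "\<dots> \<le> gam t ((r choose 2) + s)"
      using m rs v assms(2) by (intro gam_step) auto
    finally show ?thesis using rs by simp
  qed (simp add: kcl_empty assms)
qed

text \<open>In the equality case, each step of the induction is an equality.\<close>

lemma kruskal_katona_eq_step:
  assumes "edge_set E" "3 \<le> t" "card E = (r choose 2) + s" "s < r" "t \<le> r"
    "gam t (card E) \<le> card (kcl t E)"
  obtains v where "v \<in> \<Union>E" "0 < card (nbhd E v)"
    "\<And>u. u \<in> \<Union>E \<Longrightarrow> card (nbhd E v) \<le> card (nbhd E u)"
    "card E = card (E \<inter> Pow (- {v})) + card (nbhd E v)"
    "gam t (card (E \<inter> Pow (- {v}))) \<le> card (kcl t (E \<inter> Pow (- {v})))"
    "(card (nbhd E v) choose (t - 1)) \<le> card {K \<in> kcl t E. v \<in> K}"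
    "card (nbhd E v) \<le> s \<and> (t - 1 \<le> s \<longrightarrow> card (nbhd E v) = s)
      \<or> s < card (nbhd E v) \<and> card (nbhd E v) = r - 1"
proof -
  have "0 < (r choose 2)" using assms by simp
  then have "E \<noteq> {}" using assms(3) by auto
  from obtain_min_degree[OF assms(1,3,4) this] obtain v where
    v: "v \<in> \<Union>E" "0 < card (nbhd E v)" "card (nbhd E v) < r"
    "\<And>u. u \<in> \<Union>E \<Longrightarrow> card (nbhd E v) \<le> card (nbhd E u)" by metis
  let ?F = "E \<inter> Pow (- {v})"
  define d where "d = card (nbhd E v)"
  have F: "edge_set ?F" using assms(1) by (rule edge_set_subset) auto
  have m: "card E = card ?F + d" unfolding d_def by (rule card_edges_remove[OF assms(1)])
  have k: "card (kcl t E) = card (kcl t ?F) + card {K \<in> kcl t E. v \<in> K}"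
    using assms(2) by (intro card_kcl_remove[OF assms(1)]) simp
  have le1: "card (kcl t ?F) \<le> gam t (card ?F)"
    using kruskal_katona[OF F] assms(2) by simp
  have le2: "card {K \<in> kcl t E. v \<in> K} \<le> (d choose (t - 1))"
    unfolding d_def using assms(2) by (intro card_star_le[OF assms(1)]) simp
  have le3: "gam t (card ?F) + (d choose (t - 1)) \<le> gam t ((r choose 2) + s)"
    using m v(3) assms unfolding d_def by (intro gam_step) auto
  have eq: "gam t (card ?F) + (d choose (t - 1)) = gam t ((r choose 2) + s)"
    "card (kcl t ?F) = gam t (card ?F)" "card {K \<in> kcl t E. v \<in> K} = (d choose (t - 1))"
    using le1 le2 le3 k assms(3,6) by simp_all
  have g: "gam t ((r choose 2) + s) = (r choose t) + (s choose (t - 1))"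
    using assms by (intro gam_eq_less)
  \<comment> \<open>Equality in \<open>gam_step\<close> means that its exchange of rows changes
    nothing. By strict convexity this leaves \<open>d = s\<close> (once
    \<open>t - 1 \<le> s\<close>) or, for \<open>d > s\<close>, only
    \<open>d = r - 1\<close>.\<close>
  have d: "d \<le> s \<and> (t - 1 \<le> s \<longrightarrow> d = s) \<or> s < d \<and> d = r - 1"
  proof (cases "d \<le> s")
    case True
    then have "card ?F = (r choose 2) + (s - d)" using m assms(3) by simp
    then have "gam t (card ?F) = (r choose t) + (s - d choose (t - 1))"
      using assms gam_eq_less[of "s - d" r t] by simp
    then have "(s - d choose (t - 1)) + (d choose (t - 1)) = (s choose (t - 1))"
      using eq(1) g by simp
    moreover have "(s - d choose (t - 1)) + (d choose (t - 1)) < (s choose (t - 1)) + (0 choose (t - 1))"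
      if "t - 1 \<le> s" "d \<noteq> s"
      using that True v(2) assms unfolding d_def by (intro choose_spread_strict) auto
    moreover have "(0 choose (t - 1) :: nat) = 0" using assms by (simp add: binomial_eq_0)
    ultimately show ?thesis using True by auto
  next
    case False
    obtain u where u: "r = Suc u" using assms by (cases r) auto
    have "card ?F = (u choose 2) + (u + s - d)"
      using m assms(3) False v(3) unfolding u d_def by (simp add: Suc_choose_two)
    then have "gam t (card ?F) = (u choose t) + (u + s - d choose (t - 1))"
      using False assms by (simp add: gam_eq)
    moreover have "(r choose t) = (u choose t) + (u choose (t - 1))"
      using assms u Suc_choose_eq[of t u] by simp
    ultimately have "(d choose (t - 1)) + (u + s - d choose (t - 1)) = (u choose (t - 1)) + (s choose (t - 1))"
      using eq(1) g by simp
    moreover have "(d choose (t - 1)) + (u + s - d choose (t - 1)) < (u choose (t - 1)) + (s choose (t - 1))"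
      if "d < u"
      using that False assms u by (intro choose_spread_strict) auto
    ultimately have "\<not> d < u" by auto
    then show ?thesis using False v(3) u unfolding d_def by auto
  qed
  show ?thesis
    by (rule that[OF v(1,2,4)]) (use m eq d in \<open>simp_all add: d_def\<close>)
qed

text \<open>Deleting a vertex of degree at most \<open>s\<close> keeps \<open>r\<close> and lowers
  \<open>s\<close>, so the induction runs on \<open>s\<close>. Otherwise the minimum degree is
  \<open>r - 1\<close> with a full star, and the closed neighbourhood is the wanted
  \<open>K_r\<close>.\<close>

lemma kruskal_katona_eq_clique:
  assumes "edge_set E" "3 \<le> t" "card E = (r choose 2) + s" "s < r" "t \<le> r"
    "gam t (card E) \<le> card (kcl t E)"
  shows "\<exists>R. card R = r \<and> clique R E"
  using assms(1,3,4,6)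
proof (induction s arbitrary: E rule: less_induct)
  case (less s)
  obtain v where v: "v \<in> \<Union>E" "0 < card (nbhd E v)"
    "\<And>u. u \<in> \<Union>E \<Longrightarrow> card (nbhd E v) \<le> card (nbhd E u)"
    "card E = card (E \<inter> Pow (- {v})) + card (nbhd E v)"
    "gam t (card (E \<inter> Pow (- {v}))) \<le> card (kcl t (E \<inter> Pow (- {v})))"
    "(card (nbhd E v) choose (t - 1)) \<le> card {K \<in> kcl t E. v \<in> K}"
    "card (nbhd E v) \<le> s \<and> (t - 1 \<le> s \<longrightarrow> card (nbhd E v) = s)
      \<or> s < card (nbhd E v) \<and> card (nbhd E v) = r - 1"
    by (rule kruskal_katona_eq_step[OF less.prems(1) assms(2) less.prems(2,3) assms(5) less.prems(4)]) (rule that)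
  let ?F = "E \<inter> Pow (- {v})"
  have F: "edge_set ?F" using less.prems(1) by (rule edge_set_subset) auto
  show ?case
  proof (cases "card (nbhd E v) \<le> s")
    case True
    have "\<exists>R. card R = r \<and> clique R ?F"
      by (rule less.IH[of "s - card (nbhd E v)"]) (use True v F less.prems in auto)
    then show ?thesis using clique_mono[of _ ?F E] by blast
  next
    case False
    then have d: "card (nbhd E v) = r - 1" using v(7) by simp
    then have "clique (insert v (nbhd E v)) E"
      using v(6) assms(2,5) by (intro card_star_eq_imp_clique[OF less.prems(1) assms(2)]) auto
    moreover have "card (insert v (nbhd E v)) = r"
      using d nbhd_irrefl[OF less.prems(1), of v] finite_nbhd[OF less.prems(1), of v] assms(2,5) by simp
    ultimately show ?thesis by blast
  qed
qed

lemma nsets_two_subset_clique: "clique R E \<Longrightarrow> [R]\<^bsup>2\<^esup> \<subseteq> E"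
  by (auto simp: nsets_def card_2_iff clique_def)

lemma kruskal_katona_eq_colex:
  assumes "edge_set E" "3 \<le> t" "card E = (r choose 2) + s" "s < r" "t - 1 \<le> s"
    "gam t (card E) \<le> card (kcl t E)"
  obtains R v S where "card R = r" "v \<notin> R" "S \<subseteq> R" "card S = s"
    "E = [R]\<^bsup>2\<^esup> \<union> (\<lambda>x. {x, v}) ` S"
proof -
  have tr: "t \<le> r" using assms by simp
  obtain v where v: "v \<in> \<Union>E" "0 < card (nbhd E v)"
    "\<And>u. u \<in> \<Union>E \<Longrightarrow> card (nbhd E v) \<le> card (nbhd E u)"
    "card E = card (E \<inter> Pow (- {v})) + card (nbhd E v)"
    "gam t (card (E \<inter> Pow (- {v}))) \<le> card (kcl t (E \<inter> Pow (- {v})))"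
    "(card (nbhd E v) choose (t - 1)) \<le> card {K \<in> kcl t E. v \<in> K}"
    "card (nbhd E v) \<le> s \<and> (t - 1 \<le> s \<longrightarrow> card (nbhd E v) = s)
      \<or> s < card (nbhd E v) \<and> card (nbhd E v) = r - 1"
    by (rule kruskal_katona_eq_step[OF assms(1-4) tr assms(6)]) (rule that)
  let ?F = "E \<inter> Pow (- {v})"
  have F: "edge_set ?F" using assms(1) by (rule edge_set_subset) auto
  have finE: "finite E" using edge_set_finite[OF assms(1)] .
  have nc: "clique (insert v (nbhd E v)) E"
    using v(6,7) assms by (intro card_star_eq_imp_clique[OF assms(1,2)]) auto
  \<comment> \<open>Otherwise the closed neighbourhood of \<open>v\<close> is a \<open>K_r\<close>
    with only \<open>s > 0\<close> edges not inside it. Such an edge has an end beyond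
    \<open>K_r\<close>, which meets only those edges and so has degree at most \<open>s\<close>,
    below the minimum.\<close>
  have "card (nbhd E v) \<le> s"
  proof (rule ccontr)
    assume not: "\<not> card (nbhd E v) \<le> s"
    then have d: "s < card (nbhd E v)" "card (nbhd E v) = r - 1" using v(7) by auto
    let ?R = "insert v (nbhd E v)"
    have R: "finite ?R" "card ?R = r"
      using d nbhd_irrefl[OF assms(1), of v] finite_nbhd[OF assms(1), of v] assms(4) by auto
    have sub: "[?R]\<^bsup>2\<^esup> \<subseteq> E" using nc by (rule nsets_two_subset_clique)
    have "card (E - [?R]\<^bsup>2\<^esup>) = s"
      using sub finE R card_nsets[of ?R 2] assms(3) by (simp add: card_Diff_subset finite_subset)
    then have "E - [?R]\<^bsup>2\<^esup> \<noteq> {}" using assms by force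
    then obtain e where e: "e \<in> E" "e \<notin> [?R]\<^bsup>2\<^esup>" by blast
    have "card e = 2" using edge_set_card[OF assms(1) e(1)] .
    have "\<not> e \<subseteq> ?R"
    proof
      assume "e \<subseteq> ?R"
      moreover from this have "finite e" using R(1) by (rule finite_subset)
      ultimately show False using e(2) \<open>card e = 2\<close> by (simp add: nsets_def)
    qed
    then obtain x where x: "x \<in> e" "x \<notin> ?R" by blast
    have "{f \<in> E. x \<in> f} \<subseteq> E - [?R]\<^bsup>2\<^esup>" using x(2) by (auto simp: nsets_def)
    then have "card {f \<in> E. x \<in> f} \<le> card (E - [?R]\<^bsup>2\<^esup>)" using finE by (intro card_mono) auto
    then have "card (nbhd E x) \<le> s" using card_incident[OF assms(1), of x] \<open>card (E - [?R]\<^bsup>2\<^esup>) = s\<close> by simp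
    moreover have "card (nbhd E v) \<le> card (nbhd E x)" using v(3) x(1) e(1) by blast
    ultimately show False using d by simp
  qed
  then have ds: "card (nbhd E v) = s" using v(7) assms(5) by auto
  have mF: "card ?F = (r choose 2) + 0" using v(4) ds assms(3) by simp
  have "\<exists>R. card R = r \<and> clique R ?F"
    using assms(4) by (intro kruskal_katona_eq_clique[OF F assms(2) mF _ tr v(5)]) simp
  then obtain R where R: "card R = r" "clique R ?F" by blast
  have finR: "finite R" using R(1) assms(4) by (intro card_ge_0_finite) simp
  \<comment> \<open>\<open>K_r\<close> uses up all \<open>r choose 2\<close> edges that avoid
    \<open>v\<close>.\<close>
  have FR: "[R]\<^bsup>2\<^esup> = ?F"
    using nsets_two_subset_clique[OF R(2)] card_nsets[of R 2] R(1) mF finE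
    by (intro card_subset_eq) auto
  have "R \<subseteq> \<Union>?F" using R assms by (intro clique_subset_Union) auto
  then have vR: "v \<notin> R" by auto
  \<comment> \<open>As \<open>t - 1\<close> is at least 2, \<open>v\<close> has at least two
    neighbours; they are pairwise adjacent, so each is an end of an edge avoiding \<open>v\<close>,
    that is, of an edge of \<open>K_r\<close>.\<close>
  have SR: "nbhd E v \<subseteq> R"
  proof
    fix x assume x: "x \<in> nbhd E v"
    have "\<not> nbhd E v \<subseteq> {x}" using ds assms card_mono[of "{x}" "nbhd E v"] by auto
    then obtain y where y: "y \<in> nbhd E v" "y \<noteq> x" by blast
    have "{x, y} \<in> E" using nc x y by (auto simp: clique_def)
    moreover have "x \<noteq> v" "y \<noteq> v" using x y nbhd_irrefl[OF assms(1), of v] by auto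
    ultimately have "{x, y} \<in> ?F" by auto
    then have "{x, y} \<in> [R]\<^bsup>2\<^esup>" using FR by simp
    then show "x \<in> R" by (auto simp: nsets_def)
  qed
  have star: "{e \<in> E. v \<in> e} = (\<lambda>x. {x, v}) ` nbhd E v"
  proof (intro equalityI subsetI)
    fix e assume e: "e \<in> {e \<in> E. v \<in> e}"
    then obtain x y where "e = {x, y}" using edge_setE[OF assms(1), of e] by blast
    then show "e \<in> (\<lambda>x. {x, v}) ` nbhd E v" using e by (auto simp: nbhd_def insert_commute)
  qed (auto simp: nbhd_def)
  have "E = ?F \<union> {e \<in> E. v \<in> e}" by auto
  then have "E = [R]\<^bsup>2\<^esup> \<union> (\<lambda>x. {x, v}) ` nbhd E v" using FR star by simp
  then show ?thesis using that R(1) vR SR ds by blast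
qed

section \<open>Bounded degree and few vertices\<close>

text \<open>Local form of Chase's double counting: in a set \<open>W\<close> of \<open>t + 1\<close> vertices, at least as
  many vertices are adjacent to all others as there are vertices whose removal leaves a clique
  to which they are attached.\<close>

lemma attached_le_dominating:
  assumes "edge_set E" "3 \<le> t" "card W = t + 1"
  shows "card {z \<in> W. clique (W - {z}) E \<and> (W - {z}) \<inter> nbhd E z \<noteq> {}}
    \<le> card {u \<in> W. W - {u} \<subseteq> nbhd E u}" (is "card ?p \<le> card ?q")
proof (cases "?p = {}")
  case False
  have finW: "finite W" using assms by (intro card_ge_0_finite) simp
  have finq: "finite ?q" using finW by simp
  from False obtain z where z: "z \<in> W" "clique (W - {z}) E" "(W - {z}) \<inter> nbhd E z \<noteq> {}" by blast
  \<comment> \<open>With \<open>W - {z}\<close> a clique, a single edge from \<open>u\<close> to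
    \<open>z\<close> makes \<open>u\<close> adjacent to all of \<open>W\<close>.\<close>
  have dom: "u \<in> ?q" if u: "u \<in> W - {z}" "{u, z} \<in> E" for u
  proof -
    have "x \<in> nbhd E u" if x: "x \<in> W - {u}" for x
    proof (cases "x = z")
      case True
      then show ?thesis using u by (simp add: nbhd_def insert_commute)
    next
      case False
      then show ?thesis using cliqueD[OF z(2), of x u] x u by (auto simp: nbhd_def)
    qed
    then show ?thesis using u by auto
  qed
  show ?thesis
  proof (cases "?p \<subseteq> {z}")
    case True
    obtain u where "u \<in> W - {z}" "u \<in> nbhd E z" using z(3) by blast
    then have "u \<in> ?q" by (intro dom) (auto simp: nbhd_def)
    then have "0 < card ?q" using finq card_gt_0_iff by blast
    moreover have "card ?p \<le> 1" using card_mono[OF _ True] by simp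
    ultimately show ?thesis by linarith
  next
    case False
    then obtain z' where z': "z' \<in> W" "z' \<noteq> z" "clique (W - {z'}) E" by blast
    have adj: "{u, z} \<in> E" if "u \<in> W - {z, z'}" for u
      using cliqueD[OF z'(3), of u z] that z(1) z'(2) by auto
    show ?thesis
    proof (cases "{z', z} \<in> E")
      case True
      have "W - {z} \<subseteq> ?q" using dom adj True by blast
      moreover have "z \<in> ?q" using adj True z(1) by (auto simp: nbhd_def)
      ultimately have "W \<subseteq> ?q" by blast
      then have "?p \<subseteq> ?q" by blast
      then show ?thesis by (rule card_mono[OF finq])
    next
      \<comment> \<open>If \<open>z\<close> and \<open>z'\<close> are not adjacent, no third vertex
        leaves a clique behind. The other \<open>t - 1\<close> vertices dominate, and
        \<open>t - 1\<close> is at least 2.\<close>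
      case nadj: False
      have "x \<in> {z, z'}" if x: "x \<in> ?p" for x
      proof (rule ccontr)
        assume "x \<notin> {z, z'}"
        moreover have "clique (W - {x}) E" using x by simp
        ultimately have "{z', z} \<in> E" using z(1) z'(1,2) cliqueD[of "W - {x}" E z' z] by blast
        then show False using nadj by simp
      qed
      then have "?p \<subseteq> {z, z'}" by blast
      then have "card ?p \<le> card {z, z'}" by (rule card_mono[rotated]) simp
      also have "\<dots> = 2" using z'(2) by simp
      also have "2 \<le> card (W - {z, z'})"
        using assms z(1) z'(1,2) finW by (simp add: card_Diff_subset)
      also have "\<dots> \<le> card ?q"
      proof (rule card_mono[OF finq])
        show "W - {z, z'} \<subseteq> ?q" using dom adj by blast
      qed
      finally show ?thesis .
    qed
  qed
next
  case True
  then show ?thesis by (metis card.empty le0)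
qed

text \<open>The cliques destroyed when the closed neighbourhood of \<open>v\<close> is
  deleted.\<close>

definition meeting :: "nat \<Rightarrow> 'a set set \<Rightarrow> 'a \<Rightarrow> 'a set set" where
  "meeting t E v = {K \<in> kcl t E. K \<inter> insert v (nbhd E v) \<noteq> {}}"

text \<open>Both sides are compared through the \<open>(t + 1)\<close>-sets \<open>W\<close>: a pair
  \<open>(z, K)\<close> on the left spans \<open>W = insert z K\<close>, and a dominating vertex
  \<open>u\<close> of \<open>W\<close> yields the \<open>t\<close>-subset \<open>W - {u}\<close> of
  its neighbourhood, counted on the right.\<close>

lemma sum_attached_le:
  assumes E: "edge_set E" and t: "3 \<le> t" and V: "finite V" "\<Union>E \<subseteq> V"
  shows "(\<Sum>v\<in>V. card {K \<in> kcl t E. v \<notin> K \<and> K \<inter> nbhd E v \<noteq> {}})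
    \<le> (\<Sum>v\<in>V. (card (nbhd E v) choose t))"
proof -
  define P where "P = (SIGMA z:V. {K \<in> kcl t E. z \<notin> K \<and> K \<inter> nbhd E z \<noteq> {}})"
  define Q where "Q = (SIGMA u:V. {S. S \<subseteq> nbhd E u \<and> card S = t})"
  define WW where "WW = {W. W \<subseteq> V \<and> card W = t + 1}"
  define p where "p W = {z \<in> W. clique (W - {z}) E \<and> (W - {z}) \<inter> nbhd E z \<noteq> {}}" for W
  define q where "q W = {u \<in> W. W - {u} \<subseteq> nbhd E u}" for W
  have finWW: "finite WW" using V by (simp add: WW_def)
  have finW: "finite W" if "W \<in> WW" for W using that V finite_subset unfolding WW_def by blast
  have fin: "finite (Sigma WW p)" "finite (Sigma WW q)"
    using finWW finW by (auto simp: p_def q_def intro!: finite_SigmaI)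
  have finQ: "finite Q" unfolding Q_def
    using V finite_nbhd[OF E] by (intro finite_SigmaI) auto
  have finP: "finite P" unfolding P_def
    using V finite_kcl[OF E, of t] t by (intro finite_SigmaI) auto
  have "card P \<le> card (Sigma WW p)"
  proof (rule card_inj_on_le[OF _ _ fin(1)])
    show "inj_on (\<lambda>(z, K). (insert z K, z)) P"
    proof (rule inj_onI)
      fix x y assume *: "x \<in> P" "y \<in> P" "(\<lambda>(z, K). (insert z K, z)) x = (\<lambda>(z, K). (insert z K, z)) y"
      obtain z K z' K' where xy: "x = (z, K)" "y = (z', K')" by (cases x; cases y)
      have "z = z'" "insert z K = insert z' K'" "z \<notin> K" "z' \<notin> K'" using * by (auto simp: xy P_def)
      then have "insert z K - {z} = insert z K' - {z}" "z \<notin> K" "z \<notin> K'" "z = z'" by auto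
      then show "x = y" by (simp add: xy)
    qed
    show "(\<lambda>(z, K). (insert z K, z)) ` P \<subseteq> Sigma WW p"
    proof (rule image_subsetI)
      fix x assume x: "x \<in> P"
      obtain z K where xz: "x = (z, K)" by (cases x)
      have z: "z \<in> V" "K \<in> kcl t E" "z \<notin> K" "K \<inter> nbhd E z \<noteq> {}" using x by (auto simp: xz P_def)
      have "finite K" "K \<subseteq> V"
        using kcl_finite_member[OF z(2)] kcl_subset_Union[OF z(2)] t V(2) by auto
      then have "insert z K \<in> WW" using z by (simp add: WW_def kcl_def)
      moreover have "insert z K - {z} = K" using z(3) by simp
      ultimately show "(case x of (z, K) \<Rightarrow> (insert z K, z)) \<in> Sigma WW p"
        using z by (simp add: xz p_def kcl_def)
    qed
  qed
  also have "\<dots> = (\<Sum>W\<in>WW. card (p W))"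
    using finWW finW by (intro card_SigmaI) (auto simp: p_def)
  also have "\<dots> \<le> (\<Sum>W\<in>WW. card (q W))"
    unfolding p_def q_def by (intro sum_mono attached_le_dominating[OF E t]) (simp add: WW_def)
  also have "\<dots> = card (Sigma WW q)"
    using finWW finW by (intro card_SigmaI[symmetric]) (auto simp: q_def)
  also have "\<dots> \<le> card Q"
  proof (rule card_inj_on_le[OF _ _ finQ])
    show "inj_on (\<lambda>(W, u). (u, W - {u})) (Sigma WW q)"
    proof (rule inj_onI)
      fix x y assume *: "x \<in> Sigma WW q" "y \<in> Sigma WW q"
        "(\<lambda>(W, u). (u, W - {u})) x = (\<lambda>(W, u). (u, W - {u})) y"
      obtain W u W' u' where xy: "x = (W, u)" "y = (W', u')" by (cases x; cases y)
      have u: "u = u'" "W - {u} = W' - {u}" "u \<in> W" "u \<in> W'" using * by (auto simp: xy q_def)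
      from u(2) have "insert u (W - {u}) = insert u (W' - {u})" by simp
      then show "x = y" using u by (simp add: xy insert_absorb)
    qed
    show "(\<lambda>(W, u). (u, W - {u})) ` Sigma WW q \<subseteq> Q"
    proof (rule image_subsetI)
      fix x assume x: "x \<in> Sigma WW q"
      obtain W u where xy: "x = (W, u)" by (cases x)
      have "W \<subseteq> V" "card W = t + 1" "u \<in> W" "W - {u} \<subseteq> nbhd E u"
        using x by (auto simp: xy q_def WW_def)
      then show "(case x of (W, u) \<Rightarrow> (u, W - {u})) \<in> Q" by (auto simp: xy Q_def)
    qed
  qed
  also have "\<dots> = (\<Sum>v\<in>V. (card (nbhd E v) choose t))"
    unfolding Q_def using V finite_nbhd[OF E] n_subsets[OF finite_nbhd[OF E]]
    by (subst card_SigmaI) auto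
  also have "card P = (\<Sum>v\<in>V. card {K \<in> kcl t E. v \<notin> K \<and> K \<inter> nbhd E v \<noteq> {}})"
    unfolding P_def using V finite_kcl[OF E, of t] t by (intro card_SigmaI) auto
  finally show ?thesis .
qed

text \<open>On average, deleting a closed neighbourhood destroys at most as many cliques as a
  component \<open>K_(d+1)\<close> contains. The star sums are kept instead of being estimated, so
  that equality reveals that all stars are full.\<close>

lemma sum_meeting_le:
  assumes E: "edge_set E" and t: "3 \<le> t" and V: "finite V" "\<Union>E \<subseteq> V"
  shows "(\<Sum>v\<in>V. card (meeting t E v)) + (\<Sum>v\<in>V. (card (nbhd E v) choose (t - 1)))
    \<le> (\<Sum>v\<in>V. (card (nbhd E v) + 1 choose t)) + (\<Sum>v\<in>V. card {K \<in> kcl t E. v \<in> K})"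
proof -
  have meet: "card (meeting t E v) = card {K \<in> kcl t E. v \<in> K}
      + card {K \<in> kcl t E. v \<notin> K \<and> K \<inter> nbhd E v \<noteq> {}}" for v
  proof -
    have "meeting t E v = {K \<in> kcl t E. v \<in> K} \<union> {K \<in> kcl t E. v \<notin> K \<and> K \<inter> nbhd E v \<noteq> {}}"
      by (auto simp: meeting_def)
    moreover have "finite (kcl t E)" using finite_kcl[OF E] t by simp
    ultimately show ?thesis by (simp add: card_Un_disjoint disjoint_iff)
  qed
  have "(card (nbhd E v) + 1 choose t) = (card (nbhd E v) choose t) + (card (nbhd E v) choose (t - 1))" for v
    using Suc_choose_eq[of t] t by simp
  then show ?thesis using sum_attached_le[OF E t V] unfolding meet by (simp add: sum.distrib)
qed

text \<open>The number of \<open>t\<close>-cliques of \<open>qK\<^bsub>D+1\<^esub> \<union> K\<^sub>c\<close>, where \<open>n = q(D + 1) + c\<close>.\<close>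

definition bmax :: "nat \<Rightarrow> nat \<Rightarrow> nat \<Rightarrow> nat" where
  "bmax t D n = n div (D + 1) * (D + 1 choose t) + (n mod (D + 1) choose t)"

lemma bmax_eq:
  assumes "c < D + 1"
  shows "bmax t D (q * (D + 1) + c) = q * (D + 1 choose t) + (c choose t)"
proof -
  have "(q * N + c) div N = q \<and> (q * N + c) mod N = c" if "c < N" for N
    using that by simp
  from this[OF assms] show ?thesis by (simp only: bmax_def)
qed

text \<open>The blocks \<open>x\<close> and \<open>c\<close> either merge or, from
  \<open>D + 1\<close> on, are exchanged for a complete block and a smaller rest, which convexity
  favours.\<close>

lemma bmax_superadditive:
  assumes "x \<le> D + 1" "1 \<le> t"
  shows "(x choose t) + bmax t D y \<le> bmax t D (x + y)"
proof -
  obtain q c where y: "y = q * (D + 1) + c" "c < D + 1"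
    using div_mult_mod_eq[of y "D + 1"] mod_less_divisor[of "D + 1" y] by (metis zero_less_Suc Suc_eq_plus1)
  have b: "bmax t D y = q * (D + 1 choose t) + (c choose t)" unfolding y(1) by (rule bmax_eq[OF y(2)])
  show ?thesis
  proof (cases "x + c < D + 1")
    case True
    have "x + y = q * (D + 1) + (x + c)" using y by simp
    then have "bmax t D (x + y) = q * (D + 1 choose t) + (x + c choose t)"
      using bmax_eq[OF True, of t q] by (simp only:)
    then show ?thesis using b choose_superadditive[OF assms(2), of x c] by linarith
  next
    case False
    define w where "w = x + c - (D + 1)"
    have w: "w < D + 1" "x + c = D + 1 + w" using False assms y(2) unfolding w_def by linarith+
    have "x + y = (q + 1) * (D + 1) + w" using y w by (simp add: algebra_simps)
    then have "bmax t D (x + y) = (q + 1) * (D + 1 choose t) + (w choose t)"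
      using bmax_eq[OF w(1), of t "q + 1"] by (simp only:)
    moreover have "(x choose t) + (c choose t) \<le> (D + 1 choose t) + (w choose t)"
      using assms y(2) w by (intro choose_spread) auto
    ultimately show ?thesis using b by (simp add: algebra_simps)
  qed
qed

lemma bmax_mono:
  assumes "1 \<le> t" "m \<le> n"
  shows "bmax t D m \<le> bmax t D n"
  using assms(2)
proof (induction rule: dec_induct)
  case (step n)
  have "bmax t D n \<le> (1 choose t) + bmax t D n" by simp
  also have "\<dots> \<le> bmax t D (1 + n)" using assms by (intro bmax_superadditive) auto
  finally show ?case using step.IH by simp
qed simp

lemma card_kcl_le_choose:
  assumes "edge_set E" "2 \<le> t" "finite V" "\<Union>E \<subseteq> V"
  shows "card (kcl t E) \<le> (card V choose t)"
proof -
  have "kcl t E \<subseteq> {K. K \<subseteq> V \<and> card K = t}"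
    using kcl_subset_Union[OF _ assms(2), of _ E] assms(4) by (fastforce simp: kcl_def)
  then have "card (kcl t E) \<le> card {K. K \<subseteq> V \<and> card K = t}"
    by (rule card_mono[rotated]) (use assms in simp)
  then show ?thesis using n_subsets[OF assms(3)] by simp
qed

text \<open>The version of the theorem with the number of vertices in place of the number of edges;
  here it is only needed for graphs without \<open>K\<^bsub>\<Delta>+1\<^esub>\<close>, where the bound is strict.\<close>

lemma chase_bound_strict:
  assumes "edge_set E" "3 \<le> t" "t \<le> D + 1" "finite V" "\<Union>E \<subseteq> V" "D + 1 \<le> card V"
    "\<And>v. card (nbhd E v) \<le> D" "kcl (D + 1) E = {}"
  shows "card (kcl t E) < bmax t D (card V)"
  using assms(1,4-)
proof (induction "card V" arbitrary: V E rule: less_induct)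
  case less
  note E = less.prems(1) and V = less.prems(2,3)
  define d where "d v = card (nbhd E v)" for v
  define F where "F v = E \<inter> Pow (V - insert v (nbhd E v))" for v
  have split: "card (kcl t E) \<le> card (meeting t E v) + card (kcl t (F v))"
    for v
  proof -
    have "kcl t E \<subseteq> meeting t E v \<union> kcl t (F v)"
    proof
      fix K assume K: "K \<in> kcl t E"
      have "K \<subseteq> V" using kcl_subset_Union[OF K] assms(2) V(2) by auto
      then show "K \<in> meeting t E v \<union> kcl t (F v)"
        using K assms(2) kcl_Int_Pow[of t E "V - insert v (nbhd E v)"] by (auto simp: meeting_def F_def)
    qed
    moreover have "finite (kcl t E)" using finite_kcl[OF E] assms(2) by simp
    moreover have "kcl t (F v) \<subseteq> kcl t E" unfolding F_def by (rule kcl_mono) auto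
    ultimately have "card (kcl t E) \<le> card (meeting t E v \<union> kcl t (F v))"
      by (intro card_mono finite_UnI) (auto simp: meeting_def intro: finite_subset)
    then show ?thesis using card_Un_le le_trans by blast
  qed
  have rest: "card (V - insert v (nbhd E v)) = card V - (d v + 1)" "d v + 1 \<le> card V" if "v \<in> V" for v
  proof -
    have "insert v (nbhd E v) \<subseteq> V" using that nbhd_subset[of E v] V(2) by auto
    moreover have "card (insert v (nbhd E v)) = d v + 1"
      using finite_nbhd[OF E, of v] nbhd_irrefl[OF E, of v] by (simp add: d_def)
    ultimately show "card (V - insert v (nbhd E v)) = card V - (d v + 1)" "d v + 1 \<le> card V"
      using V(1) card_mono[of V "insert v (nbhd E v)"] card_Diff_subset[of "insert v (nbhd E v)" V]
        finite_nbhd[OF E, of v] by simp_all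
  qed
  have sub: "edge_set (F v)"
      "finite (V - insert v (nbhd E v))" "\<Union>(F v) \<subseteq> V - insert v (nbhd E v)"
      "card (nbhd (F v) u) \<le> D" "kcl (D + 1) (F v) = {}" for v u
  proof -
    show "edge_set (F v)" unfolding F_def by (rule edge_set_subset[OF E]) auto
    show "finite (V - insert v (nbhd E v))" using V by simp
    show "\<Union>(F v) \<subseteq> V - insert v (nbhd E v)" by (auto simp: F_def)
    have "card (nbhd (F v) u) \<le> card (nbhd E u)"
      unfolding F_def by (rule card_mono[OF finite_nbhd[OF E] nbhd_mono]) auto
    then show "card (nbhd (F v) u) \<le> D" using less.prems(5)[of u] by linarith
    show "kcl (D + 1) (F v) = {}" using kcl_mono[of "F v" E "D + 1"] less.prems(6) by (auto simp: F_def)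
  qed
  have bound: "card (kcl t (F v)) \<le> bmax t D (card V - (d v + 1))"
    and strict: "D + 1 \<le> card V - (d v + 1) \<Longrightarrow>
      card (kcl t (F v)) < bmax t D (card V - (d v + 1))"
    and small: "card (kcl t (F v)) \<le> (card V - (d v + 1) choose t)"
    if v: "v \<in> V" for v
  proof -
    show st: "card (kcl t (F v)) < bmax t D (card V - (d v + 1))"
      if "D + 1 \<le> card V - (d v + 1)"
      using less.hyps[of "V - insert v (nbhd E v)", OF _ sub(1,2,3) _ sub(4,5)] rest[OF v] that by simp
    show sm: "card (kcl t (F v)) \<le> (card V - (d v + 1) choose t)"
      using card_kcl_le_choose[OF sub(1) _ sub(2,3), of t v] rest[OF v] assms(2) by simp
    show "card (kcl t (F v)) \<le> bmax t D (card V - (d v + 1))"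
    proof (cases "D + 1 \<le> card V - (d v + 1)")
      case False
      then show ?thesis using sm bmax_eq[of "card V - (d v + 1)" D t 0] by simp
    qed (use st in simp)
  qed
  have dD: "d v \<le> D" for v using less.prems(5) by (simp add: d_def)
  show ?case
  \<comment> \<open>A vertex whose closed neighbourhood meets fewer cliques than
    \<open>K_(d+1)\<close> contains gives strictness at once, even with the weak bound for the
    rest.\<close>
  proof (cases "\<exists>v\<in>V. card (meeting t E v) < (d v + 1 choose t)")
    case True
    then obtain v where v: "v \<in> V" "card (meeting t E v) < (d v + 1 choose t)" by blast
    have "card (kcl t E) < (d v + 1 choose t) + bmax t D (card V - (d v + 1))"
      using split[of v] bound[OF v(1)] v(2) by linarith
    also have "\<dots> \<le> bmax t D (d v + 1 + (card V - (d v + 1)))"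
      using dD[of v] assms(2) by (intro bmax_superadditive) auto
    finally show ?thesis using rest(2)[OF v(1)] by simp
  next
    case False
    have star: "card {K \<in> kcl t E. v \<in> K} \<le> (d v choose (t - 1))" for v
      using card_star_le[OF E, of t v] assms(2) by (simp add: d_def)
    have m1: "(\<Sum>v\<in>V. (d v + 1 choose t)) \<le> (\<Sum>v\<in>V. card (meeting t E v))"
      using False by (intro sum_mono) (auto simp: not_less)
    have m2: "(\<Sum>v\<in>V. card {K \<in> kcl t E. v \<in> K}) \<le> (\<Sum>v\<in>V. (d v choose (t - 1)))"
      using star by (intro sum_mono)
    have s: "(\<Sum>v\<in>V. card (meeting t E v)) + (\<Sum>v\<in>V. (d v choose (t - 1)))
      \<le> (\<Sum>v\<in>V. (d v + 1 choose t)) + (\<Sum>v\<in>V. card {K \<in> kcl t E. v \<in> K})"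
      using sum_meeting_le[OF E assms(2) V] by (simp add: d_def)
    \<comment> \<open>No vertex gains, so averaging turns all estimates into equalities: every star
      is full, and a vertex of degree \<open>D\<close> would sit in a
      \<open>K_(D+1)\<close>.\<close>
    have e1: "(\<Sum>v\<in>V. (d v + 1 choose t)) = (\<Sum>v\<in>V. card (meeting t E v))"
      and e2: "(\<Sum>v\<in>V. card {K \<in> kcl t E. v \<in> K}) = (\<Sum>v\<in>V. (d v choose (t - 1)))"
      using m1 m2 s by linarith+
    have "V \<noteq> {}" using less.prems(4) by auto
    then obtain v where v: "v \<in> V" by blast
    have meet: "(d v + 1 choose t) = card (meeting t E v)"
      by (rule sum_mono_inv[OF e1 _ v V(1)]) (use False in \<open>auto simp: not_less\<close>)
    have full: "card {K \<in> kcl t E. v \<in> K} = (d v choose (t - 1))"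
      by (rule sum_mono_inv[OF e2 star v V(1)])
    have "d v \<noteq> D"
    proof
      assume *: "d v = D"
      have "clique (insert v (nbhd E v)) E"
        using full * assms(2,3) by (intro card_star_eq_imp_clique[OF E assms(2)]) (auto simp: d_def)
      moreover have "card (insert v (nbhd E v)) = D + 1"
        using * finite_nbhd[OF E, of v] nbhd_irrefl[OF E, of v] by (simp add: d_def)
      ultimately show False using less.prems(6) by (auto simp: kcl_def)
    qed
    then have dv: "d v < D" using dD[of v] by simp
    show ?thesis
    proof (cases "D + 1 \<le> card V - (d v + 1)")
      case True
      have "card (kcl t E) < (d v + 1 choose t) + bmax t D (card V - (d v + 1))"
        using split[of v] strict[OF v True] meet by linarith
      also have "\<dots> \<le> bmax t D (d v + 1 + (card V - (d v + 1)))"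
        using dv assms(2) by (intro bmax_superadditive) auto
      finally show ?thesis using rest(2)[OF v] by simp
    next
      case small_rest: False
      \<comment> \<open>The rest has at most \<open>D\<close> vertices, so the induction hypothesis
        gives nothing strict. But both blocks are smaller than \<open>D + 1\<close>, and exchanging
        them for \<open>D + 1\<close> and \<open>w\<close> is a strict gain.\<close>
      define w where "w = card V - (D + 1)"
      have w: "card V = D + 1 + w" using less.prems(4) by (simp add: w_def)
      have "card (kcl t E) \<le> (d v + 1 choose t) + (card V - (d v + 1) choose t)"
        using split[of v] small[OF v] meet by linarith
      also have "\<dots> < (D + 1 choose t) + (w choose t)"
        using dv small_rest w rest(2)[OF v] assms(2,3) by (intro choose_spread_strict) auto
      also have "\<dots> = bmax t D (card V)"
        using bmax_eq[of w D t 1] w small_rest dv by simp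
      finally show ?thesis .
    qed
  qed
qed

section \<open>Bounded degree and few edges\<close>

text \<open>Ordered pairs of neighbours of \<open>u\<close> are equal, adjacent or non-adjacent; the
  last kind are the induced paths with middle vertex \<open>u\<close>.\<close>

lemma card_nonadjacent_pairs:
  assumes "edge_set E"
  shows "(\<Sum>v\<in>nbhd E u. card {w \<in> nbhd E u. w \<noteq> v \<and> {w, v} \<notin> E})
      + card (nbhd E u) + 2 * card (E \<inter> Pow (nbhd E u)) = card (nbhd E u) * card (nbhd E u)"
proof -
  let ?N = "nbhd E u" and ?H = "E \<inter> Pow (nbhd E u)"
  have fin: "finite ?N" by (rule finite_nbhd[OF assms])
  have H: "edge_set ?H" by (rule edge_set_subset[OF assms]) auto
  have "card {w \<in> ?N. w \<noteq> v \<and> {w, v} \<notin> E} + 1 + card (nbhd ?H v) = card ?N" if v: "v \<in> ?N" for v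
  proof -
    have nH: "nbhd ?H v = nbhd E v \<inter> ?N" by (rule nbhd_Int_Pow[OF v])
    have "?N = insert v ({w \<in> ?N. w \<noteq> v \<and> {w, v} \<notin> E} \<union> nbhd ?H v)"
      unfolding nH using v by (auto simp: nbhd_iff)
    moreover have "v \<notin> {w \<in> ?N. w \<noteq> v \<and> {w, v} \<notin> E} \<union> nbhd ?H v"
      using nbhd_irrefl[OF H, of v] by simp
    moreover have "{w \<in> ?N. w \<noteq> v \<and> {w, v} \<notin> E} \<inter> nbhd ?H v = {}"
      unfolding nH by (auto simp: nbhd_iff)
    moreover have "finite (nbhd ?H v)" by (rule finite_nbhd[OF H])
    ultimately have "card ?N = Suc (card {w \<in> ?N. w \<noteq> v \<and> {w, v} \<notin> E} + card (nbhd ?H v))"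
      using fin card_insert_disjoint[of "{w \<in> ?N. w \<noteq> v \<and> {w, v} \<notin> E} \<union> nbhd ?H v" v]
        card_Un_disjoint[of "{w \<in> ?N. w \<noteq> v \<and> {w, v} \<notin> E}" "nbhd ?H v"] by simp
    then show ?thesis by simp
  qed
  then have "(\<Sum>v\<in>?N. card {w \<in> ?N. w \<noteq> v \<and> {w, v} \<notin> E} + 1 + card (nbhd ?H v)) = (\<Sum>v\<in>?N. card ?N)"
    by (intro sum.cong) auto
  moreover have "(\<Sum>v\<in>?N. card (nbhd ?H v)) = 2 * card ?H"
    by (rule handshake[OF H fin]) auto
  ultimately show ?thesis by (simp add: sum_Suc sum.distrib)
qed

text \<open>An edge leaving the closed neighbourhood starts at a neighbour \<open>u\<close> and ends
  at some \<open>w\<close> outside, which makes \<open>v u w\<close> an induced path.\<close>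

lemma card_cut_closed_nbhd_le:
  assumes "edge_set E"
  shows "card (cut E (insert v (nbhd E v)))
    \<le> (\<Sum>u\<in>nbhd E v. card {w \<in> nbhd E u. w \<noteq> v \<and> {w, v} \<notin> E})"
proof -
  let ?A = "\<lambda>u. {w \<in> nbhd E u. w \<noteq> v \<and> {w, v} \<notin> E}"
  have fin: "finite (nbhd E u)" for u by (rule finite_nbhd[OF assms])
  have sub: "cut E (insert v (nbhd E v)) \<subseteq> (\<Union>u\<in>nbhd E v. (\<lambda>w. {u, w}) ` ?A u)"
  proof
    fix e assume "e \<in> cut E (insert v (nbhd E v))"
    then have e: "e \<in> E" "e \<inter> insert v (nbhd E v) \<noteq> {}" "e - insert v (nbhd E v) \<noteq> {}"
      by (auto simp: cut_def)
    obtain u where u: "u \<in> e" "u \<in> insert v (nbhd E v)" using e(2) by blast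
    obtain w where w: "w \<in> e" "w \<notin> insert v (nbhd E v)" using e(3) by blast
    obtain x y where xy: "e = {x, y}" using edge_setE[OF assms e(1)] by blast
    have "u \<noteq> w" using u w by blast
    then have euw: "e = {u, w}" using u w unfolding xy by auto
    then have wu: "w \<in> nbhd E u" using e(1) by (simp add: nbhd_iff insert_commute)
    have "u \<noteq> v"
    proof
      assume "u = v"
      then show False using wu w(2) by simp
    qed
    then have "u \<in> nbhd E v" using u(2) by simp
    moreover have "w \<in> ?A u" using wu w(2) by (simp add: nbhd_iff)
    ultimately show "e \<in> (\<Union>u\<in>nbhd E v. (\<lambda>w. {u, w}) ` ?A u)" using euw by blast
  qed
  have "card (cut E (insert v (nbhd E v))) \<le> card (\<Union>u\<in>nbhd E v. (\<lambda>w. {u, w}) ` ?A u)"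
    by (rule card_mono[OF _ sub]) (use fin in auto)
  also have "\<dots> \<le> (\<Sum>u\<in>nbhd E v. card ((\<lambda>w. {u, w}) ` ?A u))"
    by (rule card_UN_le[OF fin])
  also have "\<dots> \<le> (\<Sum>u\<in>nbhd E v. card (?A u))"
    using fin by (intro sum_mono card_image_le) auto
  finally show ?thesis .
qed

text \<open>Double counting of the induced paths with three vertices, by an end vertex and by the
  middle vertex.\<close>

lemma sum_cut_closed_nbhd_le:
  assumes "edge_set E" "finite V" "\<Union>E \<subseteq> V"
  shows "(\<Sum>v\<in>V. card (cut E (insert v (nbhd E v)))) + (\<Sum>v\<in>V. card (nbhd E v))
      + 2 * (\<Sum>v\<in>V. card (E \<inter> Pow (nbhd E v))) \<le> (\<Sum>v\<in>V. card (nbhd E v) * card (nbhd E v))"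
proof -
  let ?f = "\<lambda>u v. card {w \<in> nbhd E u. w \<noteq> v \<and> {w, v} \<notin> E}"
  have nb: "nbhd E v = {u \<in> V. u \<in> nbhd E v}" for v
    using nbhd_subset[of E v] assms(3) by auto
  have "(\<Sum>v\<in>V. card (cut E (insert v (nbhd E v)))) \<le> (\<Sum>v\<in>V. \<Sum>u\<in>nbhd E v. ?f u v)"
    by (intro sum_mono card_cut_closed_nbhd_le[OF assms(1)])
  also have "\<dots> = (\<Sum>v\<in>V. \<Sum>u | u \<in> V \<and> u \<in> nbhd E v. ?f u v)"
    by (intro sum.cong refl) (use nb in auto)
  also have "\<dots> = (\<Sum>u\<in>V. \<Sum>v | v \<in> V \<and> u \<in> nbhd E v. ?f u v)"
    by (rule sum.swap_restrict[OF assms(2,2)])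
  also have "\<dots> = (\<Sum>u\<in>V. \<Sum>v\<in>nbhd E u. ?f u v)"
  proof (rule sum.cong[OF refl], rule sum.cong)
    fix u
    show "{v \<in> V. u \<in> nbhd E v} = nbhd E u"
      using nb[of u] nbhd_sym[of u E] by blast
  qed simp
  finally have "(\<Sum>v\<in>V. card (cut E (insert v (nbhd E v)))) + (\<Sum>v\<in>V. card (nbhd E v))
      + 2 * (\<Sum>v\<in>V. card (E \<inter> Pow (nbhd E v)))
    \<le> (\<Sum>u\<in>V. (\<Sum>v\<in>nbhd E u. ?f u v) + card (nbhd E u) + 2 * card (E \<inter> Pow (nbhd E u)))"
    by (simp add: sum.distrib sum_distrib_left)
  also have "\<dots> = (\<Sum>v\<in>V. card (nbhd E v) * card (nbhd E v))"
    by (rule sum.cong[OF refl]) (rule card_nonadjacent_pairs[OF assms(1)])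
  finally show ?thesis .
qed

text \<open>Each Pascal increment up to \<open>n\<close> is at most \<open>n choose (k - 1)\<close>.
  This will compare the star of a vertex of \<open>K_r\<close> with that of the additional vertex of
  the colex graph.\<close>

lemma choose_diff_le_slope:
  assumes "1 \<le> k" "s \<le> n"
  shows "(n choose k) \<le> (s choose k) + (n - s) * (n choose (k - 1))"
proof -
  have "(j choose k) \<le> (s choose k) + (j - s) * (n choose (k - 1))" if "s \<le> j" "j \<le> n" for j
    using that
  proof (induction j rule: dec_induct)
    case (step j)
    have "(Suc j choose k) = (j choose k) + (j choose (k - 1))" by (rule Suc_choose_eq[OF assms(1)])
    moreover have "(j choose (k - 1)) \<le> (n choose (k - 1))"
      using step.prems by (intro binomial_right_mono) simp
    ultimately show ?case using step by (simp add: Suc_diff_le)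
  qed simp
  then show ?thesis using assms by simp
qed

text \<open>The numerical core: \<open>n\<close> is the number of vertices, \<open>W\<close> the number of edges
  inside neighbourhoods, summed over all vertices, and \<open>\<tau>\<close> the slope of a chord.\<close>

lemma clique_sum_arith:
  fixes n q D r s t k F0 F1 Y0 c S W m \<tau> :: real
  assumes cliques: "t * k \<le> n * F0 + \<tau> * (W - n * Y0)"
    and paths: "2 * W \<le> 2 * m * (D + r - 1) - n * r * (D + 1)"
    and m: "2 * m = q * D * (D + 1) + r * (r - 1) + 2 * s"
    and n: "q * (D + 1) + r + 1 \<le> n"
    and Y0: "2 * Y0 = (r - 1) * (r - 2)"
    and F1: "2 * F1 = 2 * F0 + \<tau> * (D * (D - 1) - (r - 1) * (r - 2))"
    and \<tau>: "0 < \<tau>" "F0 \<le> \<tau> * Y0" "c \<le> \<tau> * (r - 1)"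
    and F0: "F0 \<le> S + (r - 1 - s) * c"
    and bounds: "1 \<le> q" "1 \<le> r" "r \<le> D" "0 \<le> s" "s \<le> r - 1" "0 \<le> c" "0 \<le> S" "1 \<le> t"
  shows "t * k < q * (D + 1) * F1 + r * F0 + t * S"
proof -
  \<comment> \<open>Intended values: \<open>F0\<close> and \<open>F1\<close> are the stars in
    \<open>K_r\<close> and \<open>K_(D+1)\<close>, namely \<open>(r - 1) choose (t - 1)\<close> and
    \<open>D choose (t - 1)\<close>; \<open>Y0\<close> is \<open>(r - 1) choose 2\<close>,
    \<open>c\<close> is \<open>(r - 1) choose (t - 2)\<close>, \<open>S\<close> is
    \<open>s choose (t - 1)\<close>, and \<open>k\<close> counts the cliques.\<close>
  define P where "P = r * (D + 1) + 2 * Y0"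
  define X where "X = - q * (D + 1) * r - 2 * D * (r - s) - r * r + r - 2 + 2 * s * (r - 1)"
  define n0 where "n0 = q * (D + 1) + r + 1"
  have "2 * (\<tau> * W) \<le> \<tau> * (2 * m * (D + r - 1) - n * r * (D + 1))"
    using mult_left_mono[OF paths, of \<tau>] \<tau>(1) by (simp add: algebra_simps)
  then have 1: "2 * (t * k) \<le> 2 * m * (D + r - 1) * \<tau> - n * (\<tau> * P - 2 * F0)"
    using cliques unfolding P_def by (simp add: algebra_simps)
  \<comment> \<open>\<open>n\<close> enters with the factor \<open>- (\<tau> * P - 2 * F0)\<close>;
    it may be replaced by its lower bound \<open>n0\<close> once the bracket is known to be
    nonnegative.\<close>
  have "0 \<le> \<tau> * (r * (D + 1))" using \<tau>(1) bounds by simp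
  moreover have "\<tau> * P - 2 * F0 = \<tau> * (r * (D + 1)) + 2 * (\<tau> * Y0 - F0)"
    unfolding P_def by (simp add: algebra_simps)
  ultimately have "0 \<le> \<tau> * P - 2 * F0" using \<tau>(2) by simp
  then have "n0 * (\<tau> * P - 2 * F0) \<le> n * (\<tau> * P - 2 * F0)"
    using n unfolding n0_def by (intro mult_right_mono)
  with 1 have 2: "2 * (t * k) \<le> 2 * m * (D + r - 1) * \<tau> - n0 * (\<tau> * P - 2 * F0)" by linarith
  \<comment> \<open>Separates the share of the complete blocks; \<open>X\<close> is what remains. It
    must absorb the surplus \<open>2 * F0\<close>, which stems from the one vertex by which
    \<open>n0\<close> exceeds \<open>q (D + 1) + r\<close>.\<close>
  have poly: "(q * D * (D + 1) + r * (r - 1) + 2 * s) * (D + r - 1) - n0 * P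
      - q * (D + 1) * (D * (D - 1) - (r - 1) * (r - 2)) = X"
    unfolding n0_def P_def X_def Y0 by (simp add: algebra_simps)
  have "2 * m * (D + r - 1) * \<tau> - n0 * (\<tau> * P - 2 * F0)
      = 2 * n0 * F0 + \<tau> * ((q * D * (D + 1) + r * (r - 1) + 2 * s) * (D + r - 1) - n0 * P)"
    unfolding m by (simp add: algebra_simps)
  also have "\<dots> = 2 * n0 * F0 + \<tau> * (X + q * (D + 1) * (D * (D - 1) - (r - 1) * (r - 2)))"
    unfolding poly[symmetric] by simp
  also have "\<dots> = q * (D + 1) * (2 * F0 + \<tau> * (D * (D - 1) - (r - 1) * (r - 2)))
      + 2 * (r + 1) * F0 + \<tau> * X"
    unfolding n0_def by (simp add: algebra_simps)
  finally have 3: "2 * (t * k) \<le> 2 * (q * (D + 1) * F1) + 2 * (r * F0) + 2 * F0 + \<tau> * X"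
    using 2 unfolding F1[symmetric] by (simp add: algebra_simps)
  have "(D + 1) * r \<le> q * ((D + 1) * r)" using mult_right_mono[of 1 q "(D + 1) * r"] bounds by simp
  moreover have "r * r \<le> D * r" using bounds by (intro mult_right_mono) auto
  ultimately have X: "X \<le> - 2 * (r - s) * (r - 1) - 2"
  proof -
    assume a: "(D + 1) * r \<le> q * ((D + 1) * r)" and b: "r * r \<le> D * r"
    have "0 \<le> D * (r - s)" using bounds by simp
    have "X \<le> - (D + 1) * r - 2 * (D * (r - s)) - r * r + r - 2 + 2 * s * (r - 1)"
      using a unfolding X_def by (simp add: algebra_simps)
    also have "\<dots> \<le> - (r * r) - r - r * r + r - 2 + 2 * s * (r - 1)"
      using b \<open>0 \<le> D * (r - s)\<close> by (simp add: algebra_simps)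
    also have "\<dots> = - 2 * (r - s) * (r - 1) - 2 * r - 2" by (simp add: algebra_simps)
    also have "\<dots> \<le> - 2 * (r - s) * (r - 1) - 2" using bounds by simp
    finally show ?thesis .
  qed
  \<comment> \<open>The slope bound on \<open>c\<close> turns the negative \<open>X\<close> into
    multiples of \<open>c\<close>, the unit in which \<open>F0 - S\<close> is bounded; the leftover
    \<open>- 2 * \<tau>\<close> makes the result strict.\<close>
  have "\<tau> * X \<le> \<tau> * (- 2 * (r - s) * (r - 1) - 2)" using X \<tau>(1) by (intro mult_left_mono) auto
  also have "\<dots> = - 2 * ((r - s) * (\<tau> * (r - 1))) - 2 * \<tau>" by (simp add: algebra_simps)
  also have "\<dots> \<le> - 2 * ((r - s) * c) - 2 * \<tau>"
    using mult_left_mono[OF \<tau>(3), of "r - s"] bounds by simp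
  finally have "\<tau> * X < - 2 * ((r - s) * c)" using \<tau>(1) by simp
  moreover have "(r - 1 - s) * c \<le> (r - s) * c" using bounds by (intro mult_right_mono) auto
  moreover have "S \<le> t * S" using mult_right_mono[of 1 t S] bounds by simp
  ultimately show ?thesis using 3 F0 by linarith
qed

section \<open>The inductive step for graphs without a clique of order D + 1\<close>

lemma card_cut_singleton:
  assumes "edge_set E"
  shows "card (cut E {v}) = card (nbhd E v)"
proof -
  have "cut E {v} = {e \<in> E. v \<in> e}"
    using edge_set_card[OF assms, of "{v}"] by (auto simp: cut_def subset_singleton_iff)
  then show ?thesis using card_incident[OF assms] by simp
qed

lemma card_induced_less:
  assumes "edge_set E" "x \<in> \<Union>E" "x \<notin> W"
  shows "card (E \<inter> Pow W) < card E"
proof (rule psubset_card_mono[OF edge_set_finite[OF assms(1)]])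
  show "E \<inter> Pow W \<subset> E" using assms(2,3) by blast
qed

text \<open>The strict induction hypothesis covers only subgraphs with at least \<open>N\<close>
  edges; where all parts are smaller, strictness has to come from
  \<open>gmax_superadditive\<close>.\<close>

lemma clique_bound_step:
  assumes E: "edge_set E" and t: "3 \<le> t" "t \<le> D + 1"
    and deg: "\<And>v. card (nbhd E v) \<le> D" and free: "kcl (D + 1) E = {}"
    and large: "(D + 1 choose 2) \<le> card E"
    and IH: "\<And>F. \<lbrakk>F \<subseteq> E; card F < card E\<rbrakk> \<Longrightarrow> card (kcl t F) \<le> gmax t D (card F)"
      "\<And>F. \<lbrakk>F \<subseteq> E; card F < card E; (D + 1 choose 2) \<le> card F\<rbrakk>
        \<Longrightarrow> card (kcl t F) < gmax t D (card F)"
  shows "card (kcl t E) < gmax t D (card E)"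
proof (rule ccontr)
  assume "\<not> ?thesis"
  then have cex: "gmax t D (card E) \<le> card (kcl t E)" by simp
  let ?N = "D + 1 choose 2"
  define V where "V = \<Union>E"
  define n where "n = card V"
  define m where "m = card E"
  define q where "q = m div ?N"
  define d where "d v = card (nbhd E v)" for v
  have finV: "finite V" unfolding V_def by (rule edge_set_finite_Union[OF E])
  have D2: "2 \<le> D" using t by simp
  have N: "?N = (D choose 2) + D" using Suc_choose_two[of D] by simp
  have "0 < ?N" using D2 by simp
  obtain r s where rs: "m mod ?N = (r choose 2) + s" "s < r" using colex_decomp_ex by blast
  have m_eq: "m = q * ?N + ((r choose 2) + s)"
    using div_mult_mod_eq[of m ?N] rs(1) unfolding q_def by simp
  have b_less: "(r choose 2) + s < ?N" using rs(1) mod_less_divisor[OF \<open>0 < ?N\<close>, of m] by simp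
  have rD: "r \<le> D"
  proof (rule ccontr)
    assume "\<not> r \<le> D"
    then have "?N \<le> (r choose 2)" by (intro binomial_right_mono) simp
    then show False using b_less by simp
  qed
  have q1: "1 \<le> q" unfolding q_def using large \<open>0 < ?N\<close> div_greater_zero_iff[of m ?N] by (simp add: m_def)
  have qN: "?N \<le> q * ?N" using q1 mult_le_mono1[of 1 q ?N] by simp
  note step = gmax_step[OF t(1) m_eq rs(2) rD]
  \<comment> \<open>A cut with \<open>l < r\<close> edges lowers the bound by at least
    \<open>l choose (t - 1)\<close>, all that the crossing cliques can contribute, while both sides
    together stay strictly below the bound for their edges.\<close>
  have cut_ge: "r \<le> card (cut E S)" if S: "x \<in> V" "x \<in> S" "y \<in> V" "y \<notin> S" for S x y
  proof (rule ccontr)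
    assume "\<not> r \<le> card (cut E S)"
    then have l: "card (cut E S) < r" by simp
    let ?F = "E \<inter> Pow S" and ?G = "E \<inter> Pow (- S)"
    have F: "?F \<subseteq> E" "card ?F < card E" and G: "?G \<subseteq> E" "card ?G < card E"
      using card_induced_less[OF E, of y S] card_induced_less[OF E, of x "- S"] S
      by (auto simp: V_def)
    have split: "m - card (cut E S) = card ?F + card ?G"
      using card_edges_split[OF E, of S] by (simp add: m_def)
    have large_FG: "?N \<le> card ?F + card ?G"
      using split step(1)[OF l] m_eq qN by linarith
    have "card (kcl t ?F) + card (kcl t ?G) < gmax t D (card ?F + card ?G)"
    proof (cases "card ?F < ?N \<and> card ?G < ?N")
      case True
      then show ?thesis using IH(1)[OF F] IH(1)[OF G] gmax_superadditive(2)[OF t, of "card ?F" "card ?G"] large_FG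
        by linarith
    next
      case False
      then show ?thesis
        using IH(1)[OF F] IH(1)[OF G] IH(2)[OF F] IH(2)[OF G]
          gmax_superadditive(1)[OF t, of "card ?F" "card ?G"] by linarith
    qed
    moreover have "card (kcl t E) \<le> card (kcl t ?F) + card (kcl t ?G) + (card (cut E S) choose (t - 1))"
      using t by (intro card_kcl_cut_le[OF E]) simp
    ultimately show False using step(2)[OF l, unfolded split] cex unfolding m_def by linarith
  qed
  have nV: "D + 1 \<le> n"
  proof (rule ccontr)
    assume "\<not> D + 1 \<le> n"
    then have "(n choose 2) \<le> (D choose 2)" by (intro binomial_right_mono) simp
    moreover have "card E \<le> (n choose 2)"
      using card_kcl_le_choose[OF E, of 2 V] kcl_two[OF E] finV unfolding n_def V_def by simp
    ultimately show False using large N D2 by simp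
  qed
  have d_ge: "r \<le> d v" if v: "v \<in> V" for v
  proof -
    have "\<not> V \<subseteq> {v}" using nV D2 card_mono[of "{v}" V] unfolding n_def by auto
    then obtain y where "y \<in> V" "y \<noteq> v" by blast
    then show ?thesis using cut_ge[of v "{v}" y] v card_cut_singleton[OF E, of v] by (simp add: d_def)
  qed
  have dD: "d v \<le> D" for v using deg by (simp add: d_def)
  define y where "y v = card (E \<inter> Pow (nbhd E v))" for v
  have sub: "edge_set (E \<inter> Pow W)" for W by (rule edge_set_subset[OF E]) auto
  have star: "card {K \<in> kcl t E. v \<in> K} \<le> gam (t - 1) (y v)" for v
    unfolding card_star_nbhd[OF E t(1)] y_def using t by (intro kruskal_katona[OF sub]) simp
  \<comment> \<open>Needed to start the chord at \<open>(r - 1) choose 2\<close>. Otherwise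
    \<open>v\<close> lies in at most \<open>(r - 1) choose (t - 1)\<close> cliques although its
    deletion removes at least \<open>r\<close> edges; the bound pays for that many cliques already
    with \<open>r - 1\<close> edges.\<close>
  have y_ge: "((r - 1) choose 2) \<le> y v" if v: "v \<in> V" for v
  proof (rule ccontr)
    assume less: "\<not> ((r - 1) choose 2) \<le> y v"
    then have "0 < ((r - 1) choose 2)" by linarith
    then have "2 \<le> r - 1" by (simp only: zero_less_binomial_iff)
    then have r3: "3 \<le> r" by linarith
    let ?F = "E \<inter> Pow (- {v})"
    have mF: "card E = card ?F + d v" unfolding d_def by (rule card_edges_remove[OF E])
    have F: "?F \<subseteq> E" "card ?F < card E" using mF d_ge[OF v] r3 by auto
    have "card {K \<in> kcl t E. v \<in> K} \<le> gam (t - 1) ((r - 1) choose 2)"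
    proof (rule order_trans[OF star gam_mono])
      show "2 \<le> t - 1" "y v \<le> ((r - 1) choose 2)" using t less by linarith+
    qed
    then have "card {K \<in> kcl t E. v \<in> K} \<le> ((r - 1) choose (t - 1))"
      using gam_choose_two[of "t - 1" "r - 1"] t by simp
    moreover have "card (kcl t E) = card (kcl t ?F) + card {K \<in> kcl t E. v \<in> K}"
      using t by (intro card_kcl_remove[OF E]) simp
    moreover have l: "r - 1 < r" using r3 by simp
    moreover have "card (kcl t ?F) < gmax t D (m - (r - 1))"
    proof (cases "?N \<le> card ?F")
      case True
      have "card (kcl t ?F) < gmax t D (card ?F)" by (rule IH(2)[OF F True])
      also have "\<dots> \<le> gmax t D (m - (r - 1))"
        using mF d_ge[OF v] by (intro gmax_mono[OF t]) (simp add: m_def)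
      finally show ?thesis .
    next
      \<comment> \<open>The remaining graph has fewer than \<open>N\<close> edges, but
        \<open>m - (r - 1)\<close> is at least \<open>N\<close>; the strict increase of
        \<open>gmax\<close> from \<open>N - 1\<close> to \<open>N\<close> helps out.\<close>
      case False
      have "card (kcl t ?F) \<le> gmax t D (card ?F)" by (rule IH(1)[OF F])
      also have "\<dots> \<le> gmax t D (?N - 1)" using False by (intro gmax_mono[OF t]) simp
      also have "\<dots> < gmax t D ?N"
      proof -
        have "gmax t D (?N - 1) + gmax t D 1 < gmax t D (?N - 1 + 1)"
          using N D2 by (intro gmax_superadditive(2)[OF t]) auto
        then show ?thesis using \<open>0 < ?N\<close> by simp
      qed
      also have "\<dots> \<le> gmax t D (m - (r - 1))"
        using step(1)[OF l] m_eq qN by (intro gmax_mono[OF t]) linarith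
      finally show ?thesis .
    qed
    ultimately show False using step(2)[OF l] cex unfolding m_def by linarith
  qed
  have gm: "gmax t D m = q * (D + 1 choose t) + ((r choose t) + (s choose (t - 1)))"
    unfolding m_eq gmax_eq[OF b_less] gam_eq_less[OF rs(2)] ..
  \<comment> \<open>At \<open>q (D + 1) + r\<close> vertices the bound by vertices equals
    \<open>gmax\<close> without the term for \<open>s\<close>, so fewer vertices contradict the
    strict bound.\<close>
  have n_ge: "q * (D + 1) + r + 1 \<le> n"
  proof (rule ccontr)
    assume "\<not> q * (D + 1) + r + 1 \<le> n"
    then have "n \<le> q * (D + 1) + r" by simp
    then have "bmax t D n \<le> bmax t D (q * (D + 1) + r)" using t by (intro bmax_mono) auto
    also have "\<dots> = q * (D + 1 choose t) + (r choose t)" using rD by (intro bmax_eq) simp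
    also have "\<dots> \<le> gmax t D m" unfolding gm by simp
    finally have "bmax t D n \<le> gmax t D m" .
    moreover have "card (kcl t E) < bmax t D n"
      unfolding n_def using nV by (intro chase_bound_strict[OF E t finV _ _ deg free]) (auto simp: V_def n_def)
    ultimately show False using cex by (simp add: m_def)
  qed
  \<comment> \<open>As \<open>q\<close> is at least 1, \<open>n\<close> exceeds
    \<open>D + 1\<close>, so every closed neighbourhood misses a vertex and the cut bound applies to
    it.\<close>
  have closed_cut: "r \<le> card (cut E (insert v (nbhd E v)))" if v: "v \<in> V" for v
  proof -
    have "card (insert v (nbhd E v)) \<le> D + 1"
      using dD[of v] finite_nbhd[OF E, of v] nbhd_irrefl[OF E, of v] by (simp add: d_def)
    also have "\<dots> = 1 * (D + 1)" by simp
    also have "\<dots> \<le> q * (D + 1)" by (rule mult_le_mono1[OF q1])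
    also have "\<dots> < n" using n_ge rs(2) by linarith
    finally have "\<not> V \<subseteq> insert v (nbhd E v)"
      using card_mono[of "insert v (nbhd E v)" V] finite_nbhd[OF E, of v] unfolding n_def by auto
    then obtain z where "z \<in> V" "z \<notin> insert v (nbhd E v)" by blast
    then show ?thesis using cut_ge[of v "insert v (nbhd E v)" z] v by simp
  qed
  define W where "W = (\<Sum>v\<in>V. y v)"
  have shake: "(\<Sum>v\<in>V. d v) = 2 * m"
    unfolding d_def m_def by (rule handshake[OF E finV]) (simp add: V_def)
  have paths: "n * r + 2 * m + 2 * W \<le> (\<Sum>v\<in>V. d v * d v)"
  proof -
    have "n * r \<le> (\<Sum>v\<in>V. card (cut E (insert v (nbhd E v))))"
      using sum_bounded_below[of V r "\<lambda>v. card (cut E (insert v (nbhd E v)))"] closed_cut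
      unfolding n_def by simp
    then show ?thesis
      using sum_cut_closed_nbhd_le[OF E finV] shake unfolding W_def y_def d_def V_def by simp
  qed
  \<comment> \<open>All degrees lie between \<open>r\<close> and \<open>D\<close>, so
    \<open>(d - r) (D - d)\<close> is nonnegative; this bounds the squares by linear terms in the
    degrees, whose sum is \<open>2 * m\<close>.\<close>
  have sq: "real (\<Sum>v\<in>V. d v * d v) \<le> (D + real r) * (2 * m) - n * (real D * r)"
  proof -
    have "real (d v) * d v \<le> (D + real r) * d v - real D * r" if v: "v \<in> V" for v
    proof -
      have "0 \<le> (real (d v) - r) * (D - real (d v))"
        using d_ge[OF v] dD[of v] by simp
      then show ?thesis by (simp add: algebra_simps)
    qed
    then have "(\<Sum>v\<in>V. real (d v) * d v) \<le> (\<Sum>v\<in>V. (D + real r) * d v - real D * r)"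
      by (rule sum_mono)
    also have "\<dots> = (D + real r) * real (\<Sum>v\<in>V. d v) - n * (real D * r)"
      by (simp add: sum_subtractf sum_distrib_left n_def)
    finally show ?thesis unfolding shake by simp
  qed
  have two: "real (2 * (k choose 2)) = real k * (real k - 1)" for k
    unfolding two_times_choose_two by (cases k) (auto simp: algebra_simps)
  define R where "R = r - 1"
  have R: "r = R + 1" using rs(2) by (simp add: R_def)
  define Y0 Y1 F0 F1 c where Ys: "Y0 = real (R choose 2)" "Y1 = real (D choose 2)"
    "F0 = real (R choose (t - 1))" "F1 = real (D choose (t - 1))" "c = real (R choose (t - 2))"
  define \<tau> where "\<tau> = (F1 - F0) / (Y1 - Y0)"
  have "(R + 1 choose 2) \<le> (D choose 2)" using rD R by (intro binomial_right_mono) simp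
  have Ypos: "0 < Y1 - Y0"
  proof (cases "R = 0")
    case True
    then show ?thesis using D2 by (simp add: Ys binomial_eq_0)
  next
    case False
    then show ?thesis using \<open>(R + 1 choose 2) \<le> (D choose 2)\<close> by (simp add: Ys Suc_choose_two)
  qed
  have "(R choose (t - 1)) < (D choose (t - 1))"
    using rD R t by (intro choose_strict_right_mono) auto
  then have \<tau>pos: "0 < \<tau>" using Ypos by (simp add: \<tau>_def Ys)
  have \<tau>F: "\<tau> * (Y1 - Y0) = F1 - F0" using Ypos by (simp add: \<tau>_def)
  have t2: "t - 1 - 1 = t - 2" by simp
  \<comment> \<open>By convexity the chord is at least as steep as the first segment right of its
    left end, whose slope is \<open>c / R\<close>.\<close>
  have slope: "c \<le> \<tau> * R"
  proof -
    have "c * (Y1 - Y0) \<le> R * (F1 - F0)"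
      using choose_slope_ge[of "t - 1" R D] t rD R unfolding Ys t2 by simp
    then have "c * (Y1 - Y0) \<le> \<tau> * R * (Y1 - Y0)" unfolding \<tau>F[symmetric] by (simp add: algebra_simps)
    then show ?thesis using Ypos by simp
  qed
  \<comment> \<open>The chord is also at least as steep as the line from the origin to its left
    end.\<close>
  have F0Y0: "F0 \<le> \<tau> * Y0"
  proof (cases "R = 0")
    case True
    then show ?thesis using t by (simp add: Ys binomial_eq_0)
  next
    case False
    have "R * F0 \<le> c * Y0"
      using choose_slope_le[of "t - 1" 0 R] t unfolding Ys t2 by (simp add: binomial_eq_0)
    also have "\<dots> \<le> \<tau> * R * Y0" using slope by (intro mult_right_mono) (simp_all add: Ys)
    finally have "R * F0 \<le> R * (\<tau> * Y0)" by (simp add: algebra_simps)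
    then show ?thesis using False by simp
  qed
  have y_le: "y v \<le> (D choose 2)" for v
  proof -
    have "y v \<le> (d v choose 2)"
      using card_kcl_le_choose[OF sub, of 2 "nbhd E v" "nbhd E v"] kcl_two[OF sub] finite_nbhd[OF E]
      unfolding y_def d_def by auto
    also have "\<dots> \<le> (D choose 2)" by (rule binomial_right_mono[OF dD])
    finally show ?thesis .
  qed
  have star_chord: "real (card {K \<in> kcl t E. v \<in> K}) \<le> F0 + \<tau> * (y v - Y0)" if v: "v \<in> V" for v
  proof -
    have "(real (gam (t - 1) (y v)) - F0) * (Y1 - Y0) \<le> (F1 - F0) * (y v - Y0)"
      unfolding Ys using y_ge[OF v] y_le[of v] t rD R by (intro gam_chord) auto
    also have "\<dots> = \<tau> * (y v - Y0) * (Y1 - Y0)" unfolding \<tau>F[symmetric] by (simp add: algebra_simps)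
    finally have "real (gam (t - 1) (y v)) - F0 \<le> \<tau> * (y v - Y0)" using Ypos by simp
    moreover have "real (card {K \<in> kcl t E. v \<in> K}) \<le> real (gam (t - 1) (y v))"
      using star[of v] by simp
    ultimately show ?thesis by linarith
  qed
  have cliques: "real t * card (kcl t E) \<le> n * F0 + \<tau> * (W - n * Y0)"
  proof -
    have "(\<Sum>v\<in>V. card {K \<in> kcl t E. v \<in> K}) = t * card (kcl t E)"
      using t by (intro sum_card_kcl[OF E _ finV]) (auto simp: V_def)
    then have "real t * card (kcl t E) = (\<Sum>v\<in>V. real (card {K \<in> kcl t E. v \<in> K}))"
      by (metis of_nat_mult of_nat_sum)
    also have "\<dots> \<le> (\<Sum>v\<in>V. F0 + \<tau> * (y v - Y0))" by (rule sum_mono[OF star_chord])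
    also have "\<dots> = n * F0 + \<tau> * ((\<Sum>v\<in>V. real (y v)) - n * Y0)"
      by (simp add: sum.distrib sum_distrib_left[symmetric] sum_subtractf n_def)
    finally show ?thesis by (simp add: W_def)
  qed
  have "real t * card (kcl t E) < real q * (real D + 1) * F1 + real r * F0 + real t * real (s choose (t - 1))"
  proof (rule clique_sum_arith[OF cliques])
    have "real (n * r + 2 * m + 2 * W) \<le> real (\<Sum>v\<in>V. d v * d v)" using paths by (rule of_nat_mono)
    then show "2 * real W \<le> 2 * real m * (real D + real r - 1) - real n * real r * (real D + 1)"
      using sq by (simp add: algebra_simps)
    have "2 * real m = q * real (2 * ?N) + real (2 * (r choose 2)) + 2 * s"
      unfolding m_eq by simp
    then show "2 * real m = real q * real D * (real D + 1) + real r * (real r - 1) + 2 * real s"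
      unfolding two by (simp add: algebra_simps)
    have "real (q * (D + 1) + r + 1) \<le> real n" using n_ge by (rule of_nat_mono)
    then show "real q * (real D + 1) + real r + 1 \<le> real n" by (simp add: algebra_simps)
    show Y0: "2 * Y0 = (real r - 1) * (real r - 2)"
      using two[of R] unfolding Ys R by (simp add: algebra_simps)
    have Y1: "2 * Y1 = real D * (real D - 1)" using two[of D] unfolding Ys by simp
    have "\<tau> * (real D * (real D - 1) - (real r - 1) * (real r - 2)) = 2 * (\<tau> * (Y1 - Y0))"
      unfolding Y0[symmetric] Y1[symmetric] by (simp add: algebra_simps)
    then show "2 * F1 = 2 * F0 + \<tau> * (real D * (real D - 1) - (real r - 1) * (real r - 2))"
      unfolding \<tau>F by simp
    show "0 < \<tau>" "F0 \<le> \<tau> * Y0" by fact+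
    show "c \<le> \<tau> * (real r - 1)" using slope R by simp
    have "(R choose (t - 1)) \<le> (s choose (t - 1)) + (R - s) * (R choose (t - 1 - 1))"
      using t rs(2) R by (intro choose_diff_le_slope) auto
    then have "F0 \<le> real ((s choose (t - 1)) + (R - s) * (R choose (t - 2)))"
      unfolding Ys t2 by (rule of_nat_mono)
    then show "F0 \<le> real (s choose (t - 1)) + (real r - 1 - real s) * c"
      using rs(2) R unfolding Ys by (simp add: of_nat_diff)
  qed (use q1 rs(2) rD R t in \<open>auto simp: Ys\<close>)
  also have "\<dots> = real (t * gmax t D m)"
  proof -
    \<comment> \<open>Absorption writes \<open>t\<close> times the clique count of a complete graph
      as a sum over its vertices: one of \<open>K_(D+1)\<close> lies in
      \<open>D choose (t - 1)\<close> cliques, one of \<open>K_r\<close> in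
      \<open>R choose (t - 1)\<close>.\<close>
    have "t * (D + 1 choose t) = (D + 1) * (D choose (t - 1))"
      using times_binomial_minus1_eq[of t "D + 1"] t by simp
    moreover have "t * (r choose t) = r * (R choose (t - 1))"
      using times_binomial_minus1_eq[of t r] t R by simp
    moreover have "t * gmax t D m = q * (t * (D + 1 choose t)) + (t * (r choose t)) + t * (s choose (t - 1))"
      unfolding gm by (simp add: algebra_simps)
    ultimately have "t * gmax t D m = q * ((D + 1) * (D choose (t - 1))) + r * (R choose (t - 1))
        + t * (s choose (t - 1))" by simp
    then have "real (t * gmax t D m) = real (q * ((D + 1) * (D choose (t - 1))) + r * (R choose (t - 1))
        + t * (s choose (t - 1)))" by (simp only:)
    then show ?thesis unfolding Ys by (simp add: algebra_simps)
  qed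
  finally have "t * card (kcl t E) < t * gmax t D m" by (metis of_nat_less_iff of_nat_mult)
  then show False using cex by (simp add: m_def)
qed

text \<open>Below \<open>N\<close> edges \<open>gmax\<close> is \<open>gam\<close> and
  Kruskal-Katona suffices; from there on \<open>clique_bound_step\<close> applies, since subgraphs
  inherit both assumptions.\<close>

lemma clique_bound_free:
  assumes "3 \<le> t" "t \<le> D + 1" "edge_set E" "\<And>v. card (nbhd E v) \<le> D" "kcl (D + 1) E = {}"
  shows "card (kcl t E) \<le> gmax t D (card E) \<and>
    ((D + 1 choose 2) \<le> card E \<longrightarrow> card (kcl t E) < gmax t D (card E))"
  using assms(3-)
proof (induction "card E" arbitrary: E rule: less_induct)
  case less
  show ?case
  proof (cases "(D + 1 choose 2) \<le> card E")
    case True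
    have IH: "card (kcl t F) \<le> gmax t D (card F) \<and>
      ((D + 1 choose 2) \<le> card F \<longrightarrow> card (kcl t F) < gmax t D (card F))"
      if F: "F \<subseteq> E" "card F < card E" for F
    proof (rule less.hyps[OF F(2) edge_set_subset[OF less.prems(1) F(1)]])
      show "card (nbhd F v) \<le> D" for v
        using card_mono[OF finite_nbhd[OF less.prems(1)] nbhd_mono[OF F(1)], of v] less.prems(2)[of v]
        by linarith
      show "kcl (D + 1) F = {}" using kcl_mono[OF F(1), of "D + 1"] less.prems(3) by simp
    qed
    have "card (kcl t E) < gmax t D (card E)"
      by (rule clique_bound_step[OF less.prems(1) assms(1,2) less.prems(2,3) True]) (use IH in auto)
    then show ?thesis by simp
  next
    case False
    then show ?thesis using kruskal_katona[OF less.prems(1), of t] gmax_less[of "card E" D t] assms(1) by simp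
  qed
qed

section \<open>Components that are complete graphs\<close>

lemma kcl_add_disjoint_cliques:
  assumes "edge_set F" "\<And>Q. Q \<in> QQ \<Longrightarrow> finite Q" "\<And>Q. Q \<in> QQ \<Longrightarrow> Q \<inter> \<Union>F = {}"
    "pairwise disjnt QQ" "2 \<le> k"
  shows "kcl k (F \<union> (\<Union>Q\<in>QQ. [Q]\<^bsup>2\<^esup>)) = kcl k F \<union> (\<Union>Q\<in>QQ. [Q]\<^bsup>k\<^esup>)" (is "kcl k ?E = _")
proof (intro equalityI subsetI)
  fix K assume K: "K \<in> kcl k ?E"
  then have cK: "card K = k" "clique K ?E" by (auto simp: kcl_def)
  have finK: "finite K" using cK(1) assms(5) by (intro card_ge_0_finite) simp
  show "K \<in> kcl k F \<union> (\<Union>Q\<in>QQ. [Q]\<^bsup>k\<^esup>)"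
  proof (cases "\<exists>Q\<in>QQ. K \<inter> Q \<noteq> {}")
    case True
    then obtain Q x where Q: "Q \<in> QQ" "x \<in> K" "x \<in> Q" by blast
    have "K \<subseteq> Q"
    proof
      fix y assume y: "y \<in> K"
      show "y \<in> Q"
      proof (cases "y = x")
        case False
        then have "{x, y} \<in> ?E" using cliqueD[OF cK(2) Q(2) y] by simp
        moreover have "{x, y} \<notin> F" using assms(3)[OF Q(1)] Q(3) by blast
        ultimately obtain P where P: "P \<in> QQ" "{x, y} \<subseteq> P" by (auto simp: nsets_def)
        then have "P = Q" using assms(4) Q by (auto simp: pairwise_def disjnt_def)
        then show ?thesis using P by simp
      qed (use Q in simp)
    qed
    then show ?thesis using Q(1) cK(1) finK by (auto simp: nsets_def)
  next
    case False
    have "clique K F"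
      unfolding clique_def
    proof (intro ballI impI)
      fix x y assume xy: "x \<in> K" "y \<in> K" "x \<noteq> y"
      have "{x, y} \<in> ?E" using cliqueD[OF cK(2) xy] .
      moreover have "{x, y} \<notin> (\<Union>Q\<in>QQ. [Q]\<^bsup>2\<^esup>)" using False xy(1) by (auto simp: nsets_def)
      ultimately show "{x, y} \<in> F" by blast
    qed
    then show ?thesis using cK(1) by (simp add: kcl_def)
  qed
next
  fix K assume "K \<in> kcl k F \<union> (\<Union>Q\<in>QQ. [Q]\<^bsup>k\<^esup>)"
  then show "K \<in> kcl k ?E"
  proof
    assume "K \<in> kcl k F"
    then show ?thesis using kcl_mono[of F ?E k] by auto
  next
    assume "K \<in> (\<Union>Q\<in>QQ. [Q]\<^bsup>k\<^esup>)"
    then obtain Q where Q: "Q \<in> QQ" "K \<subseteq> Q" "card K = k" by (auto simp: nsets_def)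
    have "{x, y} \<in> [Q]\<^bsup>2\<^esup>" if "x \<in> K" "y \<in> K" "x \<noteq> y" for x y
      using that Q by (auto simp: nsets_def)
    then have "clique K ?E" unfolding clique_def using Q(1) by blast
    then show ?thesis using Q(3) by (simp add: kcl_def)
  qed
qed

text \<open>Used with \<open>k = 2\<close> for edges and \<open>k = t\<close> for cliques; with
  empty \<open>F\<close> and a single block it also counts inside a colex graph.\<close>

lemma card_kcl_add_disjoint_cliques:
  assumes "edge_set F" "finite QQ" "\<And>Q. Q \<in> QQ \<Longrightarrow> finite Q \<and> card Q = c"
    "\<And>Q. Q \<in> QQ \<Longrightarrow> Q \<inter> \<Union>F = {}" "pairwise disjnt QQ" "2 \<le> k"
  shows "card (kcl k (F \<union> (\<Union>Q\<in>QQ. [Q]\<^bsup>2\<^esup>))) = card (kcl k F) + card QQ * (c choose k)"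
proof -
  have ne: "K \<noteq> {}" if "card K = k" for K :: "'a set" using that assms(6) by auto
  have "card (\<Union>Q\<in>QQ. [Q]\<^bsup>k\<^esup>) = (\<Sum>Q\<in>QQ. card ([Q]\<^bsup>k\<^esup>))"
  proof (rule card_UN_disjoint[OF assms(2)])
    show "\<forall>Q\<in>QQ. finite ([Q]\<^bsup>k\<^esup>)" using assms(3) finite_imp_finite_nsets by blast
    show "\<forall>Q\<in>QQ. \<forall>P\<in>QQ. Q \<noteq> P \<longrightarrow> [Q]\<^bsup>k\<^esup> \<inter> [P]\<^bsup>k\<^esup> = {}"
    proof (intro ballI impI)
      fix Q P assume "Q \<in> QQ" "P \<in> QQ" "Q \<noteq> P"
      then have "Q \<inter> P = {}" using assms(5) by (auto simp: pairwise_def disjnt_def)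
      moreover have "K \<noteq> {} \<and> K \<subseteq> R" if "K \<in> [R]\<^bsup>k\<^esup>" for K R :: "'a set"
        using that ne[of K] by (simp add: nsets_def)
      ultimately show "[Q]\<^bsup>k\<^esup> \<inter> [P]\<^bsup>k\<^esup> = {}" by blast
    qed
  qed
  also have "\<dots> = (\<Sum>Q\<in>QQ. (c choose k))"
    using assms(3) card_nsets by (intro sum.cong) auto
  finally have c: "card (\<Union>Q\<in>QQ. [Q]\<^bsup>k\<^esup>) = card QQ * (c choose k)" by simp
  have "finite (\<Union>Q\<in>QQ. [Q]\<^bsup>k\<^esup>)" using assms(2,3) finite_imp_finite_nsets by blast
  moreover have "kcl k F \<inter> (\<Union>Q\<in>QQ. [Q]\<^bsup>k\<^esup>) = {}"
  proof -
    have False if "K \<in> kcl k F" "Q \<in> QQ" "K \<in> [Q]\<^bsup>k\<^esup>" for K Q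
    proof -
      have "K \<subseteq> \<Union>F" "K \<subseteq> Q" "K \<noteq> {}"
        using that kcl_subset_Union[OF that(1) assms(6)] ne[of K] by (auto simp: nsets_def)
      then show False using assms(4)[OF that(2)] by blast
    qed
    then show ?thesis by blast
  qed
  ultimately show ?thesis
    using kcl_add_disjoint_cliques[OF assms(1) _ assms(4,5,6)] assms(3) finite_kcl[OF assms(1,6)]
    by (simp add: card_Un_disjoint c)
qed

text \<open>A vertex of \<open>Q\<close> has \<open>D\<close> neighbours within \<open>Q\<close>
  already, so the degree bound leaves no room for an edge out of \<open>Q\<close>.\<close>

lemma max_clique_component:
  assumes E: "edge_set E" and deg: "\<And>v. card (nbhd E v) \<le> D" and Q: "Q \<in> kcl (D + 1) E"
    and "e \<in> E" "e \<inter> Q \<noteq> {}"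
  shows "e \<subseteq> Q"
proof -
  obtain v where v: "v \<in> e" "v \<in> Q" using assms(5) by blast
  have cQ: "card Q = D + 1" "clique Q E" using Q by (auto simp: kcl_def)
  have sub: "Q - {v} \<subseteq> nbhd E v" using cQ(2) v(2) by (auto simp: nbhd_def dest: cliqueD)
  have "card (nbhd E v) \<le> card (Q - {v})" using cQ(1) v(2) deg[of v] by simp
  then have eq: "Q - {v} = nbhd E v" using card_seteq[OF finite_nbhd[OF E] sub] by simp
  obtain x y where "e = {x, y}" using edge_setE[OF E assms(4)] by blast
  then have "e \<subseteq> insert v (nbhd E v)" using v(1) assms(4) by (auto simp: nbhd_def insert_commute)
  then show ?thesis using eq v(2) by blast
qed

text \<open>Being components, the cliques of order \<open>D + 1\<close> are pairwise disjoint and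
  can be removed all at once; a clique of that order in the rest would be one of those
  removed.\<close>

lemma strip_max_cliques:
  fixes E :: "'a set set"
  assumes E: "edge_set E" and deg: "\<And>v. card (nbhd E v) \<le> D" and D: "2 \<le> D"
  defines "QQ \<equiv> kcl (D + 1) E"
  defines "F \<equiv> E \<inter> Pow (- \<Union>QQ)"
  shows "E = F \<union> (\<Union>Q\<in>QQ. [Q]\<^bsup>2\<^esup>)" "edge_set F" "finite QQ" "pairwise disjnt QQ"
    "\<And>Q. Q \<in> QQ \<Longrightarrow> finite Q \<and> card Q = D + 1" "\<And>Q. Q \<in> QQ \<Longrightarrow> Q \<inter> \<Union>F = {}"
    "kcl (D + 1) F = {}" "\<And>v. card (nbhd F v) \<le> D"
proof -
  show F: "edge_set F" unfolding F_def by (rule edge_set_subset[OF E]) auto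
  show "finite QQ" unfolding QQ_def using D by (intro finite_kcl[OF E]) simp
  show Q: "finite Q \<and> card Q = D + 1" if "Q \<in> QQ" for Q
    using that kcl_finite_member[of Q "D + 1" E] unfolding QQ_def by (simp add: kcl_def)
  show "Q \<inter> \<Union>F = {}" if "Q \<in> QQ" for Q using that unfolding F_def by blast
  have comp: "e \<subseteq> Q" if "Q \<in> QQ" "e \<in> E" "e \<inter> Q \<noteq> {}" for e Q
    using max_clique_component[OF E deg, of Q e] that unfolding QQ_def by blast
  show "pairwise disjnt QQ"
  proof (rule pairwiseI)
    fix P Q assume PQ: "P \<in> QQ" "Q \<in> QQ" "P \<noteq> Q"
    show "disjnt P Q"
    proof (rule ccontr)
      assume "\<not> disjnt P Q"
      then obtain x where x: "x \<in> P" "x \<in> Q" by (auto simp: disjnt_def)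
      have "P \<subseteq> Q"
      proof
        fix y assume y: "y \<in> P"
        show "y \<in> Q"
        proof (cases "y = x")
          case False
          then have "{x, y} \<in> E" using PQ(1) x(1) y unfolding QQ_def kcl_def by (auto dest: cliqueD)
          then show ?thesis using comp[OF PQ(2), of "{x, y}"] x(2) by blast
        qed (use x in simp)
      qed
      then show False using PQ Q[OF PQ(1)] Q[OF PQ(2)] card_subset_eq[of Q P] by simp
    qed
  qed
  show "E = F \<union> (\<Union>Q\<in>QQ. [Q]\<^bsup>2\<^esup>)"
  proof (intro equalityI subsetI)
    fix e assume e: "e \<in> E"
    show "e \<in> F \<union> (\<Union>Q\<in>QQ. [Q]\<^bsup>2\<^esup>)"
    proof (cases "\<exists>Q\<in>QQ. e \<inter> Q \<noteq> {}")
      case True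
      then obtain P where P: "P \<in> QQ" "e \<subseteq> P" using comp[OF _ e] by blast
      have "card e = 2" by (rule edge_set_card[OF E e])
      then have "e \<in> [P]\<^bsup>2\<^esup>" using P(2) by (simp add: nsets_def card_ge_0_finite)
      then show ?thesis using P(1) by blast
    next
      case False
      then show ?thesis using e unfolding F_def by blast
    qed
  next
    fix e assume "e \<in> F \<union> (\<Union>Q\<in>QQ. [Q]\<^bsup>2\<^esup>)"
    then show "e \<in> E"
      using nsets_two_subset_clique[of _ E] unfolding F_def QQ_def kcl_def by blast
  qed
  show "kcl (D + 1) F = {}"
  proof -
    have False if K: "K \<in> kcl (D + 1) F" for K
    proof -
      have "K \<in> QQ" using K kcl_mono[of F E "D + 1"] unfolding QQ_def F_def by blast
      moreover have "K \<subseteq> \<Union>F" using kcl_subset_Union[OF K] D by simp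
      moreover have "K \<noteq> {}" using K by (auto simp: kcl_def)
      ultimately show False unfolding F_def by blast
    qed
    then show ?thesis by blast
  qed
  show "card (nbhd F v) \<le> D" for v
    using card_mono[OF finite_nbhd[OF E] nbhd_mono[of F E v]] deg[of v] unfolding F_def by simp
qed

text \<open>The stripped graph may still have \<open>N\<close> or more edges; \<open>q'\<close> is
  its quotient, and uniqueness of division gives \<open>q' + c = q\<close>. In the equality case
  strictness rules out \<open>q' > 0\<close>, so exactly \<open>q\<close> blocks were
  stripped.\<close>

theorem clique_bound:
  assumes t: "3 \<le> t" "t \<le> D + 1" and E: "edge_set E" and deg: "\<And>v. card (nbhd E v) \<le> D"
    and m: "card E = q * (D + 1 choose 2) + b" "b < (D + 1 choose 2)"
  shows "card (kcl t E) \<le> q * (D + 1 choose t) + gam t b"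
    and "card (kcl t E) = q * (D + 1 choose t) + gam t b \<Longrightarrow>
      \<exists>QQ F. E = F \<union> (\<Union>Q\<in>QQ. [Q]\<^bsup>2\<^esup>) \<and> edge_set F \<and> finite QQ \<and> pairwise disjnt QQ
        \<and> (\<forall>Q\<in>QQ. finite Q \<and> card Q = D + 1) \<and> (\<forall>Q\<in>QQ. Q \<inter> \<Union>F = {})
        \<and> (\<forall>v. card (nbhd F v) \<le> D) \<and> card QQ = q \<and> card F = b \<and> card (kcl t F) = gam t b"
proof -
  let ?N = "D + 1 choose 2"
  define QQ where "QQ = kcl (D + 1) E"
  define F where "F = E \<inter> Pow (- \<Union>QQ)"
  define c where "c = card QQ"
  have D: "2 \<le> D" using t by simp
  note strip = strip_max_cliques[OF E deg D, folded QQ_def F_def]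
  have cards: "card (kcl k E) = card (kcl k F) + c * (D + 1 choose k)" if "2 \<le> k" for k
    unfolding c_def using card_kcl_add_disjoint_cliques[OF strip(2,3,5,6,4) that] strip(1) by simp
  have mF: "card E = card F + c * ?N" using cards[of 2] kcl_two[OF E] kcl_two[OF strip(2)] by simp
  have kt: "card (kcl t E) = card (kcl t F) + c * (D + 1 choose t)" using cards[of t] t by simp
  have free: "card (kcl t F) \<le> gmax t D (card F)"
    "?N \<le> card F \<Longrightarrow> card (kcl t F) < gmax t D (card F)"
    using clique_bound_free[OF t strip(2,8,7)] by auto
  define q' b' where "q' = card F div ?N" and "b' = card F mod ?N"
  have F: "card F = q' * ?N + b'" unfolding q'_def b'_def by (simp only: div_mult_mod_eq)
  have "0 < ?N" using D by simp
  then have b': "b' < ?N" unfolding b'_def by simp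
  have "(q' + c) * ?N + b' = q * ?N + b" using mF F m(1) by (simp add: algebra_simps)
  then have "((q' + c) * ?N + b') div ?N = (q * ?N + b) div ?N"
    "((q' + c) * ?N + b') mod ?N = (q * ?N + b) mod ?N" by (simp_all only:)
  moreover have "(x * M + y) div M = x" "(x * M + y) mod M = y" if "y < M" for x y M :: nat
    using that by simp_all
  ultimately have qb: "q' + c = q" "b' = b" using b' m(2) by metis+
  have g: "gmax t D (card F) = q' * (D + 1 choose t) + gam t b"
    unfolding F qb(2) by (rule gmax_eq[OF m(2)])
  have tot: "q * (D + 1 choose t) = q' * (D + 1 choose t) + c * (D + 1 choose t)"
    unfolding qb(1)[symmetric] by (simp add: distrib_right)
  show "card (kcl t E) \<le> q * (D + 1 choose t) + gam t b"
    using kt free(1) g tot by linarith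
  show "\<exists>QQ F. E = F \<union> (\<Union>Q\<in>QQ. [Q]\<^bsup>2\<^esup>) \<and> edge_set F \<and> finite QQ \<and> pairwise disjnt QQ
        \<and> (\<forall>Q\<in>QQ. finite Q \<and> card Q = D + 1) \<and> (\<forall>Q\<in>QQ. Q \<inter> \<Union>F = {})
        \<and> (\<forall>v. card (nbhd F v) \<le> D) \<and> card QQ = q \<and> card F = b \<and> card (kcl t F) = gam t b"
    if eq: "card (kcl t E) = q * (D + 1 choose t) + gam t b"
  proof -
    have "\<not> ?N \<le> card F" using free(2) kt g tot eq by linarith
    then have "card F = b'" unfolding b'_def by simp
    moreover from this have "q' = 0" using F \<open>0 < ?N\<close> by simp
    ultimately have "card F = b" "c = q" "card (kcl t F) = gam t b"
      using qb kt eq by auto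
    then show ?thesis
      using strip unfolding c_def
      by (intro exI[of _ QQ] exI[of _ F] conjI ballI allI) auto
  qed
qed

section \<open>Isomorphisms and disjoint unions\<close>

lemma simple_edge_set: "simple_graph G \<Longrightarrow> edge_set (edges G)"
  and simple_Union_edges: "simple_graph G \<Longrightarrow> \<Union>(edges G) \<subseteq> verts G"
proof -
  assume G: "simple_graph G"
  then have "finite ([verts G]\<^bsup>2\<^esup>)" by (auto simp: simple_graph_def intro: finite_imp_finite_nsets)
  then show "edge_set (edges G)"
    using G by (auto simp: simple_graph_def edge_set_def nsets_def intro: finite_subset)
  show "\<Union>(edges G) \<subseteq> verts G" using G by (auto simp: simple_graph_def nsets_def)
qed

lemma simple_graphI:
  "\<lbrakk>finite (verts G); edge_set (edges G); \<Union>(edges G) \<subseteq> verts G\<rbrakk> \<Longrightarrow> simple_graph G"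
  by (auto simp: simple_graph_def nsets_def edge_set_def intro: card_ge_0_finite)

lemma degree_eq: "simple_graph G \<Longrightarrow> degree G v = card (nbhd (edges G) v)"
  using nbhd_subset[of "edges G" v] simple_Union_edges[of G]
  unfolding degree_def nbhd_def by (intro arg_cong[where f = card]) auto

lemma num_cliques_eq:
  assumes "simple_graph G" "2 \<le> t"
  shows "num_cliques t G = card (kcl t (edges G))"
proof -
  have "cliques t G = kcl t (edges G)"
  proof (intro equalityI subsetI)
    fix K assume K: "K \<in> kcl t (edges G)"
    have "K \<subseteq> verts G" using kcl_subset_Union[OF K assms(2)] simple_Union_edges[OF assms(1)] by simp
    moreover have "finite K" using kcl_finite_member[OF K] assms(2) by simp
    ultimately show "K \<in> cliques t G" using K by (simp add: cliques_def nsets_def kcl_def)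
  qed (simp add: cliques_def nsets_def kcl_def)
  then show ?thesis by (simp add: num_cliques_def)
qed

lemma max_degree_le_iff:
  assumes "simple_graph G"
  shows "max_degree G \<le> D \<longleftrightarrow> (\<forall>v. card (nbhd (edges G) v) \<le> D)"
proof -
  have "finite (verts G)" using assms by (simp add: simple_graph_def)
  then have "max_degree G \<le> D \<longleftrightarrow> (\<forall>v\<in>verts G. degree G v \<le> D)"
    by (simp add: max_degree_def)
  moreover have "nbhd (edges G) v = {}" if "v \<notin> verts G" for v
    using that simple_Union_edges[OF assms] by (auto simp: nbhd_def)
  ultimately show ?thesis using degree_eq[OF assms] by (metis card.empty le0)
qed

lemma verts_delete_isolated:
  assumes "simple_graph G"
  shows "verts (delete_isolated G) = \<Union>(edges G)"
proof -
  note E = simple_edge_set[OF assms]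
  have "degree G v \<noteq> 0 \<longleftrightarrow> v \<in> \<Union>(edges G)" for v
    using finite_nbhd[OF E, of v] nbhd_nonempty[OF E, of v] by (auto simp: degree_eq[OF assms] nbhd_def)
  then show ?thesis using simple_Union_edges[OF assms] by (auto simp: delete_isolated_def)
qed

lemma edges_delete_isolated: "edges (delete_isolated G) = edges G"
  by (simp add: delete_isolated_def)

text \<open>Without isolated vertices the vertex set is the union of the edges, so equivalence
  amounts to an injection on that union carrying one edge set onto the other.\<close>

lemma graph_equivI:
  assumes "simple_graph G" "simple_graph H" "inj_on f (\<Union>(edges G))" "(`) f ` edges G = edges H"
  shows "G \<simeq> H"
  unfolding graph_equiv_def graph_iso_def verts_delete_isolated[OF assms(1)]
    verts_delete_isolated[OF assms(2)] edges_delete_isolated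
proof (intro exI[of _ f] conjI ballI)
  have "f ` \<Union>(edges G) = \<Union>(edges H)" unfolding assms(4)[symmetric] by auto
  then show "bij_betw f (\<Union>(edges G)) (\<Union>(edges H))" using assms(3) by (simp add: bij_betw_def)
  fix u v assume uv: "u \<in> \<Union>(edges G)" "v \<in> \<Union>(edges G)"
  show "({u, v} \<in> edges G) = ({f u, f v} \<in> edges H)"
  proof
    assume "{u, v} \<in> edges G"
    then have "f ` {u, v} \<in> (`) f ` edges G" by (rule imageI)
    then show "{f u, f v} \<in> edges H" unfolding assms(4) by simp
  next
    assume "{f u, f v} \<in> edges H"
    then have "f ` {u, v} \<in> (`) f ` edges G" unfolding assms(4) by simp
    then obtain e where e: "e \<in> edges G" "f ` {u, v} = f ` e" by blast
    then have "{u, v} = e" using inj_on_image_eq_iff[OF assms(3), of "{u, v}" e] uv by blast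
    then show "{u, v} \<in> edges G" using e(1) by simp
  qed
qed

lemma graph_equivD:
  assumes "simple_graph G" "simple_graph H" "G \<simeq> H"
  obtains f where "inj_on f (\<Union>(edges G))" "(`) f ` edges G = edges H"
proof -
  from assms(3) obtain f where f: "bij_betw f (\<Union>(edges G)) (\<Union>(edges H))"
    "\<And>u v. u \<in> \<Union>(edges G) \<Longrightarrow> v \<in> \<Union>(edges G) \<Longrightarrow> {u, v} \<in> edges G \<longleftrightarrow> {f u, f v} \<in> edges H"
    unfolding graph_equiv_def graph_iso_def verts_delete_isolated[OF assms(1)]
      verts_delete_isolated[OF assms(2)] edges_delete_isolated by blast
  have "(`) f ` edges G = edges H"
  proof (intro equalityI subsetI)
    fix e' assume "e' \<in> (`) f ` edges G"
    then obtain e where e: "e \<in> edges G" "e' = f ` e" by blast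
    obtain u v where uv: "e = {u, v}" using edge_setE[OF simple_edge_set[OF assms(1)] e(1)] by blast
    then have "u \<in> \<Union>(edges G)" "v \<in> \<Union>(edges G)" using e(1) by auto
    then show "e' \<in> edges H" using f(2)[of u v] e uv by simp
  next
    fix e' assume e': "e' \<in> edges H"
    obtain a b where ab: "e' = {a, b}" using edge_setE[OF simple_edge_set[OF assms(2)] e'] by blast
    then have "a \<in> f ` \<Union>(edges G)" "b \<in> f ` \<Union>(edges G)" using f(1) e' by (auto simp: bij_betw_def)
    then obtain u v where uv: "u \<in> \<Union>(edges G)" "v \<in> \<Union>(edges G)" "a = f u" "b = f v" by blast
    then have "{u, v} \<in> edges G" using f(2)[of u v] e' ab by simp
    moreover have "e' = f ` {u, v}" using ab uv by simp
    ultimately show "e' \<in> (`) f ` edges G" by blast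
  qed
  then show ?thesis using that f(1) by (auto simp: bij_betw_def)
qed

lemma edge_set_image:
  assumes "edge_set E" "inj_on f (\<Union>E)"
  shows "edge_set ((`) f ` E)"
proof -
  have "card (f ` e) = 2" if "e \<in> E" for e
    using edge_set_card[OF assms(1) that] card_image[of f e] inj_on_subset[OF assms(2), of e] that by auto
  then show ?thesis using edge_set_finite[OF assms(1)] by (auto simp: edge_set_def)
qed

lemma inj_on_image_edges: "inj_on f (\<Union>E) \<Longrightarrow> inj_on ((`) f) E"
  by (rule inj_onI) (metis Union_upper inj_on_image_eq_iff)

lemma kcl_image:
  assumes "inj_on f (\<Union>E)" "2 \<le> t"
  shows "kcl t ((`) f ` E) = (`) f ` kcl t E"
proof (intro equalityI subsetI)
  fix L assume L: "L \<in> kcl t ((`) f ` E)"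
  have "L \<subseteq> \<Union>((`) f ` E)" by (rule kcl_subset_Union[OF L assms(2)])
  then have "L \<subseteq> f ` \<Union>E" unfolding image_Union .
  then obtain K where K: "K \<subseteq> \<Union>E" "L = f ` K" by (rule subset_imageE)
  have "card K = t" using card_image[OF inj_on_subset[OF assms(1) K(1)]] L K(2) by (simp add: kcl_def)
  moreover have "clique K E"
    unfolding clique_def
  proof (intro ballI impI)
    fix x y assume xy: "x \<in> K" "y \<in> K" "x \<noteq> y"
    then have "f x \<noteq> f y" using inj_onD[OF assms(1), of x y] K(1) by blast
    then have "{f x, f y} \<in> (`) f ` E" using L K(2) xy by (auto simp: kcl_def dest: cliqueD)
    then obtain e where e: "e \<in> E" "f ` {x, y} = f ` e" by auto
    then have "{x, y} = e" using inj_on_image_eq_iff[OF assms(1), of "{x, y}" e] xy K(1) by blast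
    then show "{x, y} \<in> E" using e(1) by simp
  qed
  ultimately show "L \<in> (`) f ` kcl t E" using K(2) by (simp add: kcl_def)
next
  fix L assume "L \<in> (`) f ` kcl t E"
  then obtain K where K: "K \<in> kcl t E" "L = f ` K" by blast
  have sub: "K \<subseteq> \<Union>E" by (rule kcl_subset_Union[OF K(1) assms(2)])
  have "card L = t" using card_image[OF inj_on_subset[OF assms(1) sub]] K by (simp add: kcl_def)
  moreover have "clique L ((`) f ` E)"
    unfolding clique_def
  proof (intro ballI impI)
    fix x y assume "x \<in> L" "y \<in> L" "x \<noteq> y"
    then obtain a b where ab: "a \<in> K" "b \<in> K" "a \<noteq> b" "x = f a" "y = f b" using K(2) by blast
    have "{a, b} \<in> E" using K(1) ab by (auto simp: kcl_def dest: cliqueD)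
    then have "f ` {a, b} \<in> (`) f ` E" by (rule imageI)
    then show "{x, y} \<in> (`) f ` E" using ab by simp
  qed
  ultimately show "L \<in> kcl t ((`) f ` E)" by (simp add: kcl_def)
qed

lemma card_kcl_image:
  assumes "inj_on f (\<Union>E)" "2 \<le> t"
  shows "card (kcl t ((`) f ` E)) = card (kcl t E)"
proof -
  have "\<Union>(kcl t E) \<subseteq> \<Union>E" using kcl_subset_Union[OF _ assms(2)] by blast
  then have "inj_on ((`) f) (kcl t E)" by (intro inj_on_image_edges inj_on_subset[OF assms(1)])
  then show ?thesis unfolding kcl_image[OF assms] by (rule card_image)
qed

lemma nbhd_image_le:
  assumes "edge_set E" "inj_on f (\<Union>E)" "\<And>v. card (nbhd E v) \<le> D"
  shows "card (nbhd ((`) f ` E) w) \<le> D"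
proof (cases "w \<in> f ` \<Union>E")
  case True
  then obtain v where v: "v \<in> \<Union>E" "w = f v" by blast
  have "nbhd ((`) f ` E) w \<subseteq> f ` nbhd E v"
  proof
    fix x assume "x \<in> nbhd ((`) f ` E) w"
    then obtain e where e: "e \<in> E" "{x, f v} = f ` e" by (auto simp: nbhd_def v)
    then have "x \<in> f ` e" by blast
    then obtain u where u: "u \<in> e" "x = f u" by blast
    have "f ` {u, v} = f ` e" using e(2) u(2) by simp
    then have "{u, v} = e" using inj_on_image_eq_iff[OF assms(2), of "{u, v}" e] u(1) v(1) e(1) by blast
    then show "x \<in> f ` nbhd E v" using e(1) u(2) by (auto simp: nbhd_def)
  qed
  then have "card (nbhd ((`) f ` E) w) \<le> card (f ` nbhd E v)"
    by (rule card_mono[rotated]) (use finite_nbhd[OF assms(1)] in simp)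
  also have "\<dots> \<le> card (nbhd E v)" by (rule card_image_le[OF finite_nbhd[OF assms(1)]])
  finally show ?thesis using assms(3)[of v] by linarith
next
  case False
  have "w \<in> \<Union>((`) f ` E)" if "u \<in> nbhd ((`) f ` E) w" for u
    using that nbhd_sym[of u "(`) f ` E" w] nbhd_subset[of "(`) f ` E" u] by blast
  with False have "nbhd ((`) f ` E) w = {}" unfolding image_Union by blast
  then show ?thesis by simp
qed

lemma image_nsets:
  assumes "inj_on f A"
  shows "(`) f ` ([A]\<^bsup>k\<^esup>) = [f ` A]\<^bsup>k\<^esup>"
proof (intro equalityI subsetI)
  fix B assume "B \<in> (`) f ` ([A]\<^bsup>k\<^esup>)"
  then obtain C where "C \<subseteq> A" "finite C" "card C = k" "B = f ` C" by (auto simp: nsets_def)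
  then show "B \<in> [f ` A]\<^bsup>k\<^esup>"
    using card_image[OF inj_on_subset[OF assms]] by (auto simp: nsets_def)
next
  fix B assume B: "B \<in> [f ` A]\<^bsup>k\<^esup>"
  then have "B \<subseteq> f ` A" by (simp add: nsets_def)
  then obtain C where C: "C \<subseteq> A" "B = f ` C" by (rule subset_imageE)
  have inj: "inj_on f C" by (rule inj_on_subset[OF assms C(1)])
  have "C \<in> [A]\<^bsup>k\<^esup>" using B C card_image[OF inj] finite_image_iff[OF inj] by (simp add: nsets_def)
  then show "B \<in> (`) f ` ([A]\<^bsup>k\<^esup>)" using C(2) by blast
qed

text \<open>Brings the target graph into the shape of \<open>F\<close> plus disjoint complete
  blocks, for which cliques have been counted.\<close>

lemma edges_union_copies_complete:
  fixes L :: "'b graph"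
  shows "edges (disjoint_union (copies q (complete_graph n)) L)
    = (`) Inr ` edges L \<union> (\<Union>Q\<in>(\<lambda>i. Inl ` ({i} \<times> {..<n})) ` {..<q}. [Q]\<^bsup>2\<^esup>)"
proof -
  have "(`) Inl ` (`) (Pair i) ` [{..<n}]\<^bsup>2\<^esup> = [Inl ` ({i} \<times> {..<n}) :: (nat \<times> nat + 'b) set]\<^bsup>2\<^esup>" for i
  proof -
    have "(`) (Pair i) ` [{..<n}]\<^bsup>2\<^esup> = [Pair i ` {..<n}]\<^bsup>2\<^esup>"
      by (rule image_nsets) (simp add: inj_on_def)
    also have "Pair i ` {..<n} = {i} \<times> {..<n}" by auto
    also have "(`) Inl ` [{i} \<times> {..<n}]\<^bsup>2\<^esup> = [Inl ` ({i} \<times> {..<n})]\<^bsup>2\<^esup>"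
      by (rule image_nsets) simp
    finally show ?thesis .
  qed
  then show ?thesis
    by (simp add: disjoint_union_def copies_def complete_graph_def image_UN Un_commute)
qed

lemma union_copies_complete:
  fixes L :: "'b graph"
  assumes "simple_graph L"
  shows "simple_graph (disjoint_union (copies q (complete_graph n)) L)" (is "simple_graph ?H")
    and "2 \<le> t \<Longrightarrow> num_cliques t (disjoint_union (copies q (complete_graph n)) L)
      = q * (n choose t) + card (kcl t (edges L))"
proof -
  let ?Q = "\<lambda>i. Inl ` ({i} \<times> {..<n}) :: (nat \<times> nat + 'b) set"
  let ?F = "(`) Inr ` edges L :: (nat \<times> nat + 'b) set set"
  note L = simple_edge_set[OF assms]
  have inr: "inj_on Inr A" for A :: "'b set" by simp
  have F: "edge_set ?F" by (rule edge_set_image[OF L inr])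
  have fin: "finite (?Q i)" "card (?Q i) = n" for i by (simp_all add: card_image)
  show simple: "simple_graph ?H"
  proof (rule simple_graphI)
    show "finite (verts ?H)"
      using assms by (simp add: disjoint_union_def copies_def complete_graph_def simple_graph_def)
    have "edge_set ([?Q i]\<^bsup>2\<^esup>)" for i
      using fin finite_imp_finite_nsets by (auto simp: edge_set_def nsets_def)
    then show "edge_set (edges ?H)"
      using F unfolding edges_union_copies_complete edge_set_def by auto
    show "\<Union>(edges ?H) \<subseteq> verts ?H"
      using simple_Union_edges[OF assms] unfolding edges_union_copies_complete
      by (fastforce simp: disjoint_union_def copies_def complete_graph_def nsets_def)
  qed
  assume t: "2 \<le> t"
  show "num_cliques t ?H = q * (n choose t) + card (kcl t (edges L))"
  \<comment> \<open>For \<open>n = 0\<close> all blocks are the empty set, so their number is no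
    longer \<open>q\<close>.\<close>
  proof (cases "n = 0")
    case True
    then have "edges ?H = ?F" unfolding edges_union_copies_complete by (auto simp: nsets_def)
    then show ?thesis
      using num_cliques_eq[OF simple t] card_kcl_image[OF inr t, of "edges L"] True t
      by (simp add: binomial_eq_0)
  next
    case False
    have "inj_on ?Q {..<q}"
    proof (rule inj_onI)
      fix i j assume "?Q i = ?Q j"
      moreover have "Inl (i, 0) \<in> ?Q i" using False by simp
      ultimately have "Inl (i, 0) \<in> ?Q j" by simp
      then show "i = j" by auto
    qed
    then have q: "card (?Q ` {..<q}) = q" by (simp add: card_image)
    have "card (kcl t (?F \<union> (\<Union>Q\<in>?Q ` {..<q}. [Q]\<^bsup>2\<^esup>))) = card (kcl t ?F) + card (?Q ` {..<q}) * (n choose t)"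
    proof (rule card_kcl_add_disjoint_cliques[OF F _ _ _ _ t])
      show "finite P \<and> card P = n" if "P \<in> ?Q ` {..<q}" for P using that fin by blast
      show "P \<inter> \<Union>?F = {}" if "P \<in> ?Q ` {..<q}" for P using that by auto
      show "pairwise disjnt (?Q ` {..<q})" by (auto simp: pairwise_def disjnt_def)
    qed simp
    then show ?thesis
      unfolding num_cliques_eq[OF simple t] edges_union_copies_complete q
      using card_kcl_image[OF inr t, of "edges L"] by simp
  qed
qed

section \<open>Colex graphs and the extremal family\<close>

lemma colex_graph_eq:
  "s < r \<Longrightarrow> colex_graph ((r choose 2) + s) = Graph {..r} ([{..<r}]\<^bsup>2\<^esup> \<union> (\<lambda>i. {i, r}) ` {..<s})"
  by (simp add: colex_graph_def colex_decomp_eq)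

lemma colex_graph_simple: "simple_graph (colex_graph b)"
proof -
  obtain r s where b: "b = (r choose 2) + s" "s < r" using colex_decomp_ex by blast
  have "edge_set ([{..<r}]\<^bsup>2\<^esup> \<union> (\<lambda>i. {i, r}) ` {..<s})"
    using b(2) finite_imp_finite_nsets[of "{..<r}" 2] by (auto simp: edge_set_def nsets_def)
  then show ?thesis unfolding b(1) colex_graph_eq[OF b(2)]
    using b(2) by (intro simple_graphI) (auto simp: nsets_def)
qed

text \<open>Deleting the additional vertex leaves \<open>K_r\<close>; its star has
  \<open>s choose (t - 1)\<close> members since its neighbours belong to that clique.\<close>

lemma card_kcl_colex_graph:
  assumes "2 \<le> t"
  shows "card (kcl t (edges (colex_graph b))) = gam t b"
proof -
  obtain r s where b: "b = (r choose 2) + s" "s < r" using colex_decomp_ex by blast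
  define E where "E = [{..<r}]\<^bsup>2\<^esup> \<union> (\<lambda>i. {i, r}) ` {..<s}"
  have E: "edges (colex_graph b) = E" unfolding b(1) colex_graph_eq[OF b(2)] E_def by simp
  have es: "edge_set E" using simple_edge_set[OF colex_graph_simple, of b] unfolding E .
  have rest: "E \<inter> Pow (- {r}) = {} \<union> (\<Union>Q\<in>{{..<r}}. [Q]\<^bsup>2\<^esup>)"
    unfolding E_def by (auto simp: nsets_def)
  have "card (kcl t (E \<inter> Pow (- {r}))) = card (kcl t ({} :: nat set set)) + card {{..<r}} * (r choose t)"
    unfolding rest by (rule card_kcl_add_disjoint_cliques) (use assms in \<open>auto simp: edge_set_def\<close>)
  then have 1: "card (kcl t (E \<inter> Pow (- {r}))) = (r choose t)" by (simp add: kcl_empty assms)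
  have nb: "nbhd E r = {..<s}"
    using b(2) by (auto simp: nbhd_def E_def nsets_def doubleton_eq_iff)
  have "clique L E" if "L \<subseteq> {..<s}" for L
    unfolding clique_def
  proof (intro ballI impI)
    fix x y assume "x \<in> L" "y \<in> L" "x \<noteq> y"
    then have "x < r" "y < r" "x \<noteq> y" using that b(2) by auto
    then show "{x, y} \<in> E" by (simp add: E_def nsets_def)
  qed
  then have "{L. L \<subseteq> nbhd E r \<and> card L = t - 1 \<and> clique L E} = {L. L \<subseteq> {..<s} \<and> card L = t - 1}"
    unfolding nb by blast
  then have 2: "card {K \<in> kcl t E. r \<in> K} = (s choose (t - 1))"
    using card_star[OF es, of t r] n_subsets[of "{..<s}" "t - 1"] assms by simp
  show ?thesis
    unfolding E using card_kcl_remove[OF es assms, of r] 1 2 gam_eq_less[OF b(2), of t] b(1) by simp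
qed

lemma extremal_family_simple: "L \<in> extremal_family t \<Delta> b \<Longrightarrow> simple_graph L"
  using colex_graph_simple
  by (auto simp: extremal_family_def empty_graph_def simple_graph_def split: if_splits prod.splits)

text \<open>For members other than the colex graph, Kruskal-Katona is the upper bound. As
  \<open>s < t - 1\<close>, the second binomial vanishes: a single \<open>K_r\<close> already
  supplies all cliques, and for \<open>r < t\<close> there are none.\<close>

lemma card_kcl_extremal_family:
  assumes "3 \<le> t" "L \<in> extremal_family t \<Delta> b"
  shows "card (kcl t (edges L)) = gam t b"
proof -
  have t: "2 \<le> t" using assms by simp
  have L: "simple_graph L" by (rule extremal_family_simple[OF assms(2)])
  note EL = simple_edge_set[OF L]
  obtain r s where b: "b = (r choose 2) + s" "s < r" using colex_decomp_ex by blast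
  have dec: "colex_decomp b = (r, s)" unfolding b(1) by (rule colex_decomp_eq[OF b(2)])
  have g: "gam t b = (r choose t) + (s choose (t - 1))" unfolding b(1) by (rule gam_eq_less[OF b(2)])
  consider "b = 0" "L = empty_graph" | "L = colex_graph b"
    | "s < t - 1" "num_edges L = b" "t \<le> r" "cliques r L \<noteq> {}"
    | "s < t - 1" "num_edges L = b" "r < t"
    using assms(2) dec by (auto simp: extremal_family_def split: if_splits)
  then show ?thesis
  proof cases
    case 1
    then show ?thesis using gam_0[OF t] by (simp add: empty_graph_def kcl_empty[OF t])
  next
    case 2
    then show ?thesis using card_kcl_colex_graph[OF t] by simp
  next
    case 3
    have "card (kcl t (edges L)) \<le> gam t b"
      using kruskal_katona[OF EL t] 3(2) by (simp add: num_edges_def)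
    moreover have "gam t b = (r choose t)" using g 3(1) by (simp add: binomial_eq_0)
    moreover have "(r choose t) \<le> card (kcl t (edges L))"
    proof -
      obtain R where R: "finite R" "card R = r" "clique R (edges L)"
        using 3(4) by (auto simp: cliques_def nsets_def)
      have "{K. K \<subseteq> R \<and> card K = t} \<subseteq> kcl t (edges L)"
        using clique_subset[OF R(3)] by (auto simp: kcl_def)
      then have "card {K. K \<subseteq> R \<and> card K = t} \<le> card (kcl t (edges L))"
        by (rule card_mono[OF finite_kcl[OF EL t]])
      then show ?thesis using n_subsets[OF R(1), of t] R(2) by simp
    qed
    ultimately show ?thesis by simp
  next
    case 4
    have "card (kcl t (edges L)) \<le> gam t b"
      using kruskal_katona[OF EL t] 4(2) by (simp add: num_edges_def)
    moreover have "gam t b = 0" using g 4(1,3) by (simp add: binomial_eq_0)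
    ultimately show ?thesis by simp
  qed
qed

lemma colex_graph_embedding:
  assumes "card R = r" "s < r" "v \<notin> R" "S \<subseteq> R" "card S = s"
    and F: "F = [R]\<^bsup>2\<^esup> \<union> (\<lambda>x. {x, v}) ` S"
  obtains \<phi> where "inj_on \<phi> (\<Union>F)" "edges (colex_graph ((r choose 2) + s)) = (`) \<phi> ` F"
proof -
  have finR: "finite R" using assms(1,2) by (intro card_ge_0_finite) simp
  then have finS: "finite S" using assms(4) by (rule finite_subset[rotated])
  obtain h where h: "bij_betw h S {..<s}"
    using finS assms(5) finite_same_card_bij[of S "{..<s}"] by auto
  have "card (R - S) = card {s..<r}" using assms(1,4,5) finS by (simp add: card_Diff_subset)
  then obtain g where g: "bij_betw g (R - S) {s..<r}"
    using finR finite_same_card_bij[of "R - S" "{s..<r}"] by auto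
  \<comment> \<open>The default \<open>r\<close> is the image of \<open>v\<close>, the only vertex
    of \<open>F\<close> that may lie outside \<open>R\<close>.\<close>
  define \<phi> where "\<phi> x = (if x \<in> S then h x else if x \<in> R then g x else r)" for x
  have S: "\<phi> ` S = {..<s}" using h by (simp add: \<phi>_def bij_betw_def)
  have bS: "bij_betw \<phi> S {..<s}"
    using h by (rule bij_betw_cong[THEN iffD1, rotated]) (simp add: \<phi>_def)
  have bRS: "bij_betw \<phi> (R - S) {s..<r}"
    using g by (rule bij_betw_cong[THEN iffD1, rotated]) (simp add: \<phi>_def)
  have "bij_betw \<phi> (S \<union> (R - S)) ({..<s} \<union> {s..<r})"
    by (rule bij_betw_combine[OF bS bRS]) auto
  moreover have "S \<union> (R - S) = R" "{..<s} \<union> {s..<r} = {..<r}" using assms(2,4) by auto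
  ultimately have bR: "bij_betw \<phi> R {..<r}" by simp
  have v: "\<phi> v = r" using assms(3,4) by (auto simp: \<phi>_def)
  have injR: "inj_on \<phi> R" and imR: "\<phi> ` R = {..<r}" using bR by (auto simp: bij_betw_def)
  have "inj_on \<phi> (insert v R)"
    using injR imR v assms(3) by (simp add: inj_on_insert)
  moreover have "\<Union>F \<subseteq> insert v R" using assms(4) by (auto simp: F nsets_def)
  ultimately have "inj_on \<phi> (\<Union>F)" by (rule inj_on_subset)
  moreover have "(`) \<phi> ` F = [{..<r}]\<^bsup>2\<^esup> \<union> (\<lambda>i. {i, r}) ` {..<s}"
  proof -
    have "(`) \<phi> ` (\<lambda>x. {x, v}) ` S = (\<lambda>i. {i, r}) ` \<phi> ` S"
      unfolding image_image by (simp add: v)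
    then show ?thesis unfolding F image_Un image_nsets[OF injR] imR S by simp
  qed
  ultimately show ?thesis using that colex_graph_eq[OF assms(2)] by simp
qed

text \<open>Only \<open>t - 1 \<le> s\<close> requires the exact shape of \<open>F\<close>.
  Otherwise the family contains every admissible graph on \<open>nat\<close> (with a
  \<open>K_r\<close> if \<open>t \<le> r\<close>), so any numbering of the vertices will do.\<close>

lemma exists_extremal_graph:
  assumes t: "3 \<le> t" and F: "edge_set F" and deg: "\<And>v. card (nbhd F v) \<le> \<Delta>"
    and b: "card F = b" and max: "card (kcl t F) = gam t b"
  obtains L \<phi> where "L \<in> extremal_family t \<Delta> b" "inj_on \<phi> (\<Union>F)" "edges L = (`) \<phi> ` F"
proof (cases "b = 0")
  case True
  then have "F = {}" using b edge_set_finite[OF F] by simp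
  then show ?thesis using that[of empty_graph "\<lambda>x. 0"] True by (simp add: extremal_family_def empty_graph_def)
next
  case b0: False
  obtain r s where rs: "b = (r choose 2) + s" "s < r" using colex_decomp_ex by blast
  have dec: "colex_decomp b = (r, s)" unfolding rs(1) by (rule colex_decomp_eq[OF rs(2)])
  show ?thesis
  proof (cases "t - 1 \<le> s")
    case True
    obtain R v S where R: "card R = r" "v \<notin> R" "S \<subseteq> R" "card S = s"
      "F = [R]\<^bsup>2\<^esup> \<union> (\<lambda>x. {x, v}) ` S"
      by (rule kruskal_katona_eq_colex[OF F t _ rs(2) True]) (use b rs max in auto)
    obtain \<phi> where \<phi>: "inj_on \<phi> (\<Union>F)" "edges (colex_graph ((r choose 2) + s)) = (`) \<phi> ` F"
      by (rule colex_graph_embedding[OF R(1) rs(2) R(2,3,4,5)])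
    show ?thesis
      by (rule that[of "colex_graph b" \<phi>]) (use True b0 dec \<phi> rs in \<open>auto simp: extremal_family_def\<close>)
  next
    case False
    have fin: "finite (\<Union>F)" by (rule edge_set_finite_Union[OF F])
    obtain \<phi> :: "'a \<Rightarrow> nat" where \<phi>: "inj_on \<phi> (\<Union>F)"
      using finite_imp_inj_to_nat_seg[OF fin] by blast
    define L where "L = Graph (\<phi> ` \<Union>F) ((`) \<phi> ` F)"
    have simple: "simple_graph L"
      unfolding L_def by (rule simple_graphI) (use fin edge_set_image[OF F \<phi>] in auto)
    have edges: "num_edges L = b"
      unfolding L_def num_edges_def using card_image[OF inj_on_image_edges[OF \<phi>]] b by simp
    have degree: "max_degree L \<le> \<Delta>"
      unfolding max_degree_le_iff[OF simple] using nbhd_image_le[OF F \<phi> deg] by (simp add: L_def)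
    have "cliques r L \<noteq> {}" if tr: "t \<le> r"
    proof -
      obtain R where R: "card R = r" "clique R F"
        using kruskal_katona_eq_clique[OF F t _ rs(2) tr] b rs max by auto
      have "2 \<le> r" using tr t by simp
      have "R \<in> kcl r F" using R by (simp add: kcl_def)
      then have "\<phi> ` R \<in> kcl r (edges L)" using kcl_image[OF \<phi> \<open>2 \<le> r\<close>] by (simp add: L_def)
      then have "num_cliques r L \<noteq> 0"
        using num_cliques_eq[OF simple \<open>2 \<le> r\<close>] finite_kcl[OF simple_edge_set[OF simple] \<open>2 \<le> r\<close>]
        by (metis card_0_eq empty_iff)
      then show ?thesis unfolding num_cliques_def by (metis card.empty)
    qed
    then have "L \<in> extremal_family t \<Delta> b"
      using False b0 dec simple edges degree by (auto simp: extremal_family_def)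
    then show ?thesis by (rule that[OF _ \<phi>]) (simp add: L_def)
  qed
qed

lemma embed_disjoint_cliques:
  fixes F :: "'a set set" and L :: "'b graph"
  assumes "finite QQ" "pairwise disjnt QQ" "\<And>Q. Q \<in> QQ \<Longrightarrow> finite Q \<and> card Q = n"
    "\<And>Q. Q \<in> QQ \<Longrightarrow> Q \<inter> \<Union>F = {}" "card QQ = q" "inj_on \<phi> (\<Union>F)" "edges L = (`) \<phi> ` F"
    and E: "E = F \<union> (\<Union>Q\<in>QQ. [Q]\<^bsup>2\<^esup>)"
  obtains f where "inj_on f (\<Union>E)"
    "(`) f ` E = edges (disjoint_union (copies q (complete_graph n)) L)"
proof -
  obtain h where h: "bij_betw h QQ {..<q}"
    using finite_same_card_bij[OF assms(1), of "{..<q}"] assms(5) by auto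
  have "\<forall>Q\<in>QQ. \<exists>g. bij_betw g Q {..<n}"
    using assms(3) finite_same_card_bij[of _ "{..<n}"] by auto
  then obtain g where g: "\<And>Q. Q \<in> QQ \<Longrightarrow> bij_betw (g Q) Q {..<n}" by metis
  \<comment> \<open>The block of \<open>x\<close>, well defined because the blocks are
    disjoint.\<close>
  define C where "C x = (THE Q. Q \<in> QQ \<and> x \<in> Q)" for x
  have C: "C x = Q" if "Q \<in> QQ" "x \<in> Q" for x Q
    unfolding C_def
  proof (rule the_equality)
    show "P = Q" if "P \<in> QQ \<and> x \<in> P" for P
      using that assms(2) \<open>Q \<in> QQ\<close> \<open>x \<in> Q\<close> by (auto simp: pairwise_def disjnt_def)
  qed (use that in simp)
  define f :: "'a \<Rightarrow> nat \<times> nat + 'b" where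
    "f x = (if x \<in> \<Union>QQ then Inl (h (C x), g (C x) x) else Inr (\<phi> x))" for x
  have fQ: "f x = Inl (h Q, g Q x)" if "Q \<in> QQ" "x \<in> Q" for x Q
    using that C[OF that] by (auto simp: f_def)
  have fF: "f x = Inr (\<phi> x)" if "x \<in> \<Union>F" for x
    using that assms(4) by (auto simp: f_def)
  have imQ: "f ` Q = Inl ` ({h Q} \<times> {..<n})" if Q: "Q \<in> QQ" for Q
  proof -
    have "f ` Q = (\<lambda>x. Inl (h Q, g Q x)) ` Q" using fQ[OF Q] by (intro image_cong) auto
    also have "\<dots> = Inl ` Pair (h Q) ` g Q ` Q" by (simp add: image_image)
    also have "g Q ` Q = {..<n}" using g[OF Q] by (simp add: bij_betw_def)
    also have "Pair (h Q) ` {..<n} = {h Q} \<times> {..<n}" by auto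
    finally show ?thesis .
  qed
  have inj: "inj_on f (\<Union>QQ \<union> \<Union>F)"
  proof (rule inj_onI)
    fix x y assume x: "x \<in> \<Union>QQ \<union> \<Union>F" and y: "y \<in> \<Union>QQ \<union> \<Union>F" and eq: "f x = f y"
    show "x = y"
    proof (cases "x \<in> \<Union>QQ")
      case True
      then obtain Q where Q: "Q \<in> QQ" "x \<in> Q" by blast
      have "y \<notin> \<Union>F"
      proof
        assume "y \<in> \<Union>F"
        from fF[OF this] show False using eq fQ[OF Q] by simp
      qed
      then obtain P where P: "P \<in> QQ" "y \<in> P" using y by blast
      have hg: "h Q = h P" "g Q x = g P y" using eq fQ[OF Q] fQ[OF P] by simp_all
      have QP: "Q = P" by (rule inj_onD[OF bij_betw_imp_inj_on[OF h] hg(1) Q(1) P(1)])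
      have "g Q x = g Q y" using hg(2) QP by simp
      then show ?thesis
        by (rule inj_onD[OF bij_betw_imp_inj_on[OF g[OF Q(1)]]]) (use Q P QP in simp_all)
    next
      case False
      then have xF: "x \<in> \<Union>F" using x by blast
      have "y \<notin> \<Union>QQ"
      proof
        assume "y \<in> \<Union>QQ"
        then obtain P where "P \<in> QQ" "y \<in> P" by blast
        from fQ[OF this] show False using eq fF[OF xF] by simp
      qed
      then have yF: "y \<in> \<Union>F" using y by blast
      have "\<phi> x = \<phi> y" using eq fF[OF xF] fF[OF yF] by simp
      from inj_onD[OF assms(6) this xF yF] show ?thesis .
    qed
  qed
  have "\<Union>E \<subseteq> \<Union>QQ \<union> \<Union>F" unfolding E by (auto simp: nsets_def)
  then have "inj_on f (\<Union>E)" by (rule inj_on_subset[OF inj])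
  moreover have "(`) f ` E = edges (disjoint_union (copies q (complete_graph n)) L)"
  proof -
    have "(`) f ` F = (\<lambda>e. Inr ` \<phi> ` e) ` F"
    proof (rule image_cong[OF refl])
      fix e assume "e \<in> F"
      then have "f ` e = (\<lambda>x. Inr (\<phi> x)) ` e" using fF by (intro image_cong) auto
      then show "f ` e = Inr ` \<phi> ` e" by (simp add: image_image)
    qed
    also have "\<dots> = (`) Inr ` edges L" unfolding assms(7) by (simp add: image_image)
    finally have 1: "(`) f ` F = (`) Inr ` edges L" .
    have "(`) f ` [Q]\<^bsup>2\<^esup> = [Inl ` ({h Q} \<times> {..<n})]\<^bsup>2\<^esup>" if Q: "Q \<in> QQ" for Q
    proof -
      have "inj_on f Q" by (rule inj_on_subset[OF inj]) (use Q in blast)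
      then show ?thesis unfolding imQ[OF Q, symmetric] by (rule image_nsets)
    qed
    then have "(`) f ` (\<Union>Q\<in>QQ. [Q]\<^bsup>2\<^esup>) = (\<Union>Q\<in>QQ. [Inl ` ({h Q} \<times> {..<n})]\<^bsup>2\<^esup>)"
      by (simp add: image_UN)
    also have "\<dots> = (\<Union>i\<in>h ` QQ. [Inl ` ({i} \<times> {..<n})]\<^bsup>2\<^esup>)" by simp
    also have "h ` QQ = {..<q}" using h by (simp add: bij_betw_def)
    finally show ?thesis
      unfolding edges_union_copies_complete E image_Un 1 by simp
  qed
  ultimately show ?thesis by (rule that)
qed

theorem theorem1p8:
  fixes G :: "'a graph" and t \<Delta> m q b :: nat
  assumes "3 \<le> t" and "t \<le> \<Delta> + 1"
    and "simple_graph G" and "num_edges G = m" and "max_degree G \<le> \<Delta>"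
    and "m = q * ((\<Delta> + 1) choose 2) + b" and "b < (\<Delta> + 1) choose 2"
  shows "num_cliques t G
           \<le> num_cliques t (disjoint_union (copies q (complete_graph (\<Delta> + 1))) (colex_graph b)) \<and>
         (num_cliques t G
            = num_cliques t (disjoint_union (copies q (complete_graph (\<Delta> + 1))) (colex_graph b))
          \<longleftrightarrow> (\<exists>L \<in> extremal_family t \<Delta> b.
                G \<simeq> disjoint_union (copies q (complete_graph (\<Delta> + 1))) L))"
proof -
  let ?H = "\<lambda>L. disjoint_union (copies q (complete_graph (\<Delta> + 1))) L"
  let ?max = "q * (\<Delta> + 1 choose t) + gam t b"
  have t: "2 \<le> t" using assms(1) by simp
  have E: "edge_set (edges G)" by (rule simple_edge_set[OF assms(3)])
  have deg: "card (nbhd (edges G) v) \<le> \<Delta>" for v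
    using assms(5) max_degree_le_iff[OF assms(3)] by blast
  have card_E: "card (edges G) = q * (\<Delta> + 1 choose 2) + b"
    using assms(4,6) by (simp add: num_edges_def)
  have nG: "num_cliques t G = card (kcl t (edges G))" by (rule num_cliques_eq[OF assms(3) t])
  have nH: "num_cliques t (?H (colex_graph b)) = ?max"
    unfolding union_copies_complete(2)[OF colex_graph_simple t] card_kcl_colex_graph[OF t] ..
  note bound = clique_bound[OF assms(1,2) E deg card_E assms(7)]
  have "num_cliques t G = ?max \<longleftrightarrow> (\<exists>L \<in> extremal_family t \<Delta> b. G \<simeq> ?H L)"
  proof
    \<comment> \<open>The stripped blocks become the copies and the rest is renamed into the family;
      the two maps combine because blocks and rest are disjoint.\<close>
    assume "num_cliques t G = ?max"
    from bound(2)[OF this[unfolded nG]] obtain QQ F where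
      S: "edges G = F \<union> (\<Union>Q\<in>QQ. [Q]\<^bsup>2\<^esup>) \<and> edge_set F \<and> finite QQ \<and> pairwise disjnt QQ
        \<and> (\<forall>Q\<in>QQ. finite Q \<and> card Q = \<Delta> + 1) \<and> (\<forall>Q\<in>QQ. Q \<inter> \<Union>F = {})
        \<and> (\<forall>v. card (nbhd F v) \<le> \<Delta>) \<and> card QQ = q \<and> card F = b \<and> card (kcl t F) = gam t b"
      by (elim exE)
    have EF: "edges G = F \<union> (\<Union>Q\<in>QQ. [Q]\<^bsup>2\<^esup>)" using S by (elim conjE)
    have F: "edge_set F" using S by (elim conjE)
    have QQ: "finite QQ" "pairwise disjnt QQ" "card QQ = q" using S by simp_all
    have cF: "card F = b" "card (kcl t F) = gam t b" using S by simp_all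
    have Q: "finite P \<and> card P = \<Delta> + 1" "P \<inter> \<Union>F = {}" if "P \<in> QQ" for P
      using S that by simp_all
    have degF: "card (nbhd F v) \<le> \<Delta>" for v using S by simp
    obtain L :: "nat graph" and \<phi> where L: "L \<in> extremal_family t \<Delta> b" "inj_on \<phi> (\<Union>F)" "edges L = (`) \<phi> ` F"
      by (rule exists_extremal_graph[OF assms(1) F degF cF])
    obtain f where f: "inj_on f (\<Union>(edges G))" "(`) f ` edges G = edges (?H L)"
      by (rule embed_disjoint_cliques[OF QQ(1,2) Q QQ(3) L(2,3) EF])
    have "G \<simeq> ?H L"
      by (rule graph_equivI[OF assms(3) union_copies_complete(1)[OF extremal_family_simple[OF L(1)]] f])
    then show "\<exists>L \<in> extremal_family t \<Delta> b. G \<simeq> ?H L" using L(1) by blast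
  next
    assume "\<exists>L \<in> extremal_family t \<Delta> b. G \<simeq> ?H L"
    then obtain L where L: "L \<in> extremal_family t \<Delta> b" "G \<simeq> ?H L" by blast
    have simple: "simple_graph L" by (rule extremal_family_simple[OF L(1)])
    have simpleH: "simple_graph (?H L)" by (rule union_copies_complete(1)[OF simple])
    obtain f where f: "inj_on f (\<Union>(edges G))" "(`) f ` edges G = edges (?H L)"
      by (rule graph_equivD[OF assms(3) simpleH L(2)])
    have "num_cliques t G = num_cliques t (?H L)"
      unfolding nG num_cliques_eq[OF simpleH t] f(2)[symmetric] by (rule card_kcl_image[OF f(1) t, symmetric])
    also have "\<dots> = ?max"
      unfolding union_copies_complete(2)[OF simple t] card_kcl_extremal_family[OF assms(1) L(1)] ..
    finally show "num_cliques t G = ?max" .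
  qed
  then show ?thesis using bound(1) unfolding nG nH by simp
qed

end
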